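(* Suppose that (i) $A$ is injective; (ii) the exact solution $\bar u$ (the unique solution of $Au=f$) is piecewise constant; (iii) $\mathcal J(u)=\mathrm{TV}(u)+\gamma\|u\|_1$ with a constant $\gamma>0$. Denote by $\omega_n$ any region where $u_n$ is constant, and define $$u^l_{\omega_n}=\frac1{|\omega_n|}\min_{u\in\mathcal M_n^{\varepsilon,C}}(u,\mathbf 1_{\omega_n}),\qquad u^u_{\omega_n}=\frac1{|\omega_n|}\max_{u\in\mathcal M_n^{\varepsilon,C}}(u,\mathbf 1_{\omega_n}).$$ Then $u^u_{\omega_n}-u^l_{\omega_n}\to0$ as $n\to\infty$, and for sufficiently large $n$ $$u^l_{\omega_n}\leq\bar u|_{\omega_n}\leq u^u_{\omega_n},$$ where $\bar u|_{\omega_n}$ is the restriction of $\bar u$ to $\omega_n$, i.e. the actual (pointwise) value of $\bar u$ on the region $\omega_n$.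
   Context: $\Omega\subset\mathbb R^m$ is a bounded domain, $L^1=L^1(\Omega)$, $L^\infty=L^\infty(\Omega)$, $\mathbf 1_\omega$ is the indicator function of $\omega\subset\Omega$, $|\omega|$ is its Lebesgue measure, $\mathrm{TV}$ is the total variation (equal to $+\infty$ outside $\mathrm{BV}(\Omega)$), and $(\cdot,\cdot)$ denotes duality pairings. Functions are ordered a.e. pointwise; for regular linear operators $L^1\to L^\infty$ (differences of two positive operators), $S\geq T$ means that $(S-T)u\geq0$ for all $u\geq 0$; $\mu\in(L^\infty)^*$ satisfies $\mu\geq0$ iff $(\mu,\psi)\geq0$ for all $0\leq\psi\in L^\infty$; pairs are ordered componentwise. $A\colon L^1\to L^\infty$ is a linear operator and $f\in L^\infty$; it is assumed that $Au=f$ has a non-negative solution with finite $\mathcal J$. Sequences of bounds satisfy $f^l_n\leq f\leq f^u_n$, $f^l_{n+1}\geq f^l_n$, $f^u_{n+1}\leq f^u_n$, $A^l_n\leq A\leq A^u_n$, $A^l_{n+1}\geq A^l_n$, $A^u_{n+1}\leq A^u_n$, $\|f^u_n-f^l_n\|_\infty\to0$, $\|A^u_n-A^l_n\|\to0$. Put $B_nu=(A^l_nu,-A^u_nu)$ and $\phi_n=(f^u_n,-f^l_n)$; $B_n^*\colon(L^\infty)^*\times(L^\infty)^*\to L^\infty$ is the adjoint of $B_n$. $\mathcal J$ is regarded as a functional $L^1\to[0,\infty]$, with $\partial\mathcal J(u)=\{p\in L^\infty:\ \mathcal J(v)\geq(p,v)\ \forall v\in L^1,\ \mathcal J(u)=(p,u)\}$.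 $u_n$ is a minimiser of $\mathcal J(u)$ over $u\in L^1$, $u\geq0$, $B_nu\leq\phi_n$; it is assumed to be available along with the corresponding subgradient $p_n=\lambda_n-B_n^*\mu_n\in\partial\mathcal J(u_n)$, where $(\lambda_n,\mu_n)$ is a solution of the dual problem $\max_{\lambda\geq0,\mu\geq0}(\mu,-\phi_n)$ s.t. $\lambda-B_n^*\mu\in\partial\mathcal J(0)$ ($\lambda\in L^\infty$, $\mu\in(L^\infty)^*\times(L^\infty)^*$). For fixed constants $\varepsilon,C>0$, $$\mathcal M_n^{\varepsilon,C}=\{u\in L^1:\ u\geq0,\ B_nu\leq\phi_n,\ \mathcal J(u)-(p_n,u)\leq\varepsilon,\ (p_n,u-u_n)\leq C\}.$$
   Formalization: Adds that BV(Ω) embeds compactly in L^1(Ω); the convergence u^u−u^l→0 is stated only if |ω_n| stays bounded away from 0; the enclosure is for the value of ū on ω_n when ū is a.e. constant there, and otherwise for its mean over ω_n. *)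

theory Defs
  imports "HOL-Probability.Essential_Supremum" "HOL-Library.Disjoint_Sets"
begin

text \<open>
  Elements of \<open>L\<^sup>1(\<Omega>)\<close> and \<open>L\<^sup>\<infinity>(\<Omega>)\<close> are represented by functions on the ambient Euclidean
  space.  Only their values almost everywhere on \<open>\<Omega>\<close> matter, so equality and order are always
  taken a.e. with respect to \<open>lebesgue_on \<Omega>\<close>, and operators and functionals are required
  to respect a.e. equality.
\<close>

section \<open>Lebesgue spaces over a domain\<close>

definition ae_eq :: "'a::euclidean_space set \<Rightarrow> ('a \<Rightarrow> real) \<Rightarrow> ('a \<Rightarrow> real) \<Rightarrow> bool" where
  "ae_eq \<Omega> u v \<longleftrightarrow> (AE x in lebesgue_on \<Omega>. u x = v x)"

definition ae_le :: "'a::euclidean_space set \<Rightarrow> ('a \<Rightarrow> real) \<Rightarrow> ('a \<Rightarrow> real) \<Rightarrow> bool" where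
  "ae_le \<Omega> u v \<longleftrightarrow> (AE x in lebesgue_on \<Omega>. u x \<le> v x)"

definition L1 :: "'a::euclidean_space set \<Rightarrow> ('a \<Rightarrow> real) set" where
  "L1 \<Omega> = {u. integrable (lebesgue_on \<Omega>) u}"

definition L1_norm :: "'a::euclidean_space set \<Rightarrow> ('a \<Rightarrow> real) \<Rightarrow> real" where
  "L1_norm \<Omega> u = (\<integral>x. \<bar>u x\<bar> \<partial>lebesgue_on \<Omega>)"

definition Linf_norm :: "'a::euclidean_space set \<Rightarrow> ('a \<Rightarrow> real) \<Rightarrow> ereal" where
  "Linf_norm \<Omega> g = esssup (lebesgue_on \<Omega>) (\<lambda>x. ereal \<bar>g x\<bar>)"

definition Linf :: "'a::euclidean_space set \<Rightarrow> ('a \<Rightarrow> real) set" where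
  "Linf \<Omega> = {g \<in> borel_measurable (lebesgue_on \<Omega>). Linf_norm \<Omega> g < \<infinity>}"

definition pairing :: "'a::euclidean_space set \<Rightarrow> ('a \<Rightarrow> real) \<Rightarrow> ('a \<Rightarrow> real) \<Rightarrow> real" where
  "pairing \<Omega> p u = (\<integral>x. p x * u x \<partial>lebesgue_on \<Omega>)"

section \<open>Operators from \<open>L\<^sup>1\<close> to \<open>L\<^sup>\<infinity>\<close>\<close>

type_synonym 'a operator = "('a \<Rightarrow> real) \<Rightarrow> ('a \<Rightarrow> real)"

definition linear_L1_Linf :: "'a::euclidean_space set \<Rightarrow> 'a operator \<Rightarrow> bool" where
  "linear_L1_Linf \<Omega> S \<longleftrightarrow>
     (\<forall>u\<in>L1 \<Omega>. S u \<in> Linf \<Omega>) \<and>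
     (\<forall>u\<in>L1 \<Omega>. \<forall>v\<in>L1 \<Omega>. ae_eq \<Omega> u v \<longrightarrow> ae_eq \<Omega> (S u) (S v)) \<and>
     (\<forall>u\<in>L1 \<Omega>. \<forall>v\<in>L1 \<Omega>. ae_eq \<Omega> (S (\<lambda>x. u x + v x)) (\<lambda>x. S u x + S v x)) \<and>
     (\<forall>u\<in>L1 \<Omega>. \<forall>c. ae_eq \<Omega> (S (\<lambda>x. c * u x)) (\<lambda>x. c * S u x))"

definition op_le :: "'a::euclidean_space set \<Rightarrow> 'a operator \<Rightarrow> 'a operator \<Rightarrow> bool" where
  "op_le \<Omega> T S \<longleftrightarrow> (\<forall>u\<in>L1 \<Omega>. ae_le \<Omega> (\<lambda>x. 0) u \<longrightarrow> ae_le \<Omega> (\<lambda>x. 0) (\<lambda>x. S u x - T u x))"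

definition positive_L1_Linf :: "'a::euclidean_space set \<Rightarrow> 'a operator \<Rightarrow> bool" where
  "positive_L1_Linf \<Omega> S \<longleftrightarrow> linear_L1_Linf \<Omega> S \<and> op_le \<Omega> (\<lambda>u x. 0) S"

definition regular_L1_Linf :: "'a::euclidean_space set \<Rightarrow> 'a operator \<Rightarrow> bool" where
  "regular_L1_Linf \<Omega> S \<longleftrightarrow> linear_L1_Linf \<Omega> S \<and>
     (\<exists>P Q. positive_L1_Linf \<Omega> P \<and> positive_L1_Linf \<Omega> Q \<and>
            (\<forall>u\<in>L1 \<Omega>. ae_eq \<Omega> (S u) (\<lambda>x. P u x - Q u x)))"

definition op_norm :: "'a::euclidean_space set \<Rightarrow> 'a operator \<Rightarrow> ereal" where
  "op_norm \<Omega> S = (SUP u\<in>{u \<in> L1 \<Omega>. L1_norm \<Omega> u \<le> 1}. Linf_norm \<Omega> (S u))"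

definition injective_L1 :: "'a::euclidean_space set \<Rightarrow> 'a operator \<Rightarrow> bool" where
  "injective_L1 \<Omega> S \<longleftrightarrow>
     (\<forall>u\<in>L1 \<Omega>. \<forall>v\<in>L1 \<Omega>. ae_eq \<Omega> (S u) (S v) \<longrightarrow> ae_eq \<Omega> u v)"

section \<open>The dual of \<open>L\<^sup>\<infinity>\<close> and adjoints\<close>

type_synonym 'a functional = "('a \<Rightarrow> real) \<Rightarrow> real"

text \<open>
  The norm bound forces a functional to vanish on functions that are zero a.e., hence to respect
  a.e. equality.
\<close>

definition Linf_dual :: "'a::euclidean_space set \<Rightarrow> 'a functional set" where
  "Linf_dual \<Omega> = {m.
     (\<forall>g\<in>Linf \<Omega>. \<forall>h\<in>Linf \<Omega>. m (\<lambda>x. g x + h x) = m g + m h) \<and>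
     (\<forall>g\<in>Linf \<Omega>. \<forall>c. m (\<lambda>x. c * g x) = c * m g) \<and>
     (\<exists>K\<ge>0. \<forall>g\<in>Linf \<Omega>. ereal \<bar>m g\<bar> \<le> ereal K * Linf_norm \<Omega> g)}"

definition nonneg_functional :: "'a::euclidean_space set \<Rightarrow> 'a functional \<Rightarrow> bool" where
  "nonneg_functional \<Omega> m \<longleftrightarrow> (\<forall>g\<in>Linf \<Omega>. ae_le \<Omega> (\<lambda>x. 0) g \<longrightarrow> 0 \<le> m g)"

definition pair_op ::
  "'a operator \<Rightarrow> 'a operator \<Rightarrow> ('a \<Rightarrow> real) \<Rightarrow> ('a \<Rightarrow> real) \<times> ('a \<Rightarrow> real)" where
  "pair_op Al Au u = (Al u, \<lambda>x. - Au u x)"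

definition dual_pairing ::
  "'a functional \<times> 'a functional \<Rightarrow> ('a \<Rightarrow> real) \<times> ('a \<Rightarrow> real) \<Rightarrow> real" where
  "dual_pairing m g = fst m (fst g) + snd m (snd g)"

text \<open>
  For a bounded operator \<open>B\<close> the functional \<open>u \<mapsto> (m, B u)\<close> belongs to \<open>(L\<^sup>1)\<^sup>* = L\<^sup>\<infinity>\<close>; its
  representing function is unique up to a.e. equality, so the choice below is immaterial.
\<close>

definition adjoint_rep :: "'a::euclidean_space set \<Rightarrow>
    (('a \<Rightarrow> real) \<Rightarrow> ('a \<Rightarrow> real) \<times> ('a \<Rightarrow> real)) \<Rightarrow> 'a functional \<times> 'a functional \<Rightarrow> ('a \<Rightarrow> real)" where
  "adjoint_rep \<Omega> B m =
     (SOME h. h \<in> Linf \<Omega> \<and> (\<forall>u\<in>L1 \<Omega>. pairing \<Omega> h u = dual_pairing m (B u)))"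

section \<open>Total variation\<close>

definition divergence :: "('a::euclidean_space \<Rightarrow> 'a) \<Rightarrow> 'a \<Rightarrow> real" where
  "divergence \<phi> x = (\<Sum>b\<in>Basis. frechet_derivative \<phi> (at x) b \<bullet> b)"

text \<open>Compactly supported continuously differentiable vector fields of pointwise length at most 1.\<close>

definition test_fields :: "'a::euclidean_space set \<Rightarrow> ('a \<Rightarrow> 'a) set" where
  "test_fields \<Omega> = {\<phi>.
     (\<forall>x. \<phi> differentiable (at x)) \<and>
     (\<forall>b\<in>Basis. continuous_on UNIV (\<lambda>x. frechet_derivative \<phi> (at x) b)) \<and>
     (\<exists>K. compact K \<and> K \<subseteq> \<Omega> \<and> (\<forall>x. x \<notin> K \<longrightarrow> \<phi> x = 0)) \<and>
     (\<forall>x. norm (\<phi> x) \<le> 1)}"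

definition TV :: "'a::euclidean_space set \<Rightarrow> ('a \<Rightarrow> real) \<Rightarrow> ereal" where
  "TV \<Omega> u = (SUP \<phi>\<in>test_fields \<Omega>. ereal (\<integral>x. u x * divergence \<phi> x \<partial>lebesgue_on \<Omega>))"

definition TV_L1 :: "'a::euclidean_space set \<Rightarrow> real \<Rightarrow> ('a \<Rightarrow> real) \<Rightarrow> ereal" where
  "TV_L1 \<Omega> \<gamma> u = TV \<Omega> u + ereal (\<gamma> * L1_norm \<Omega> u)"

text \<open>
  Regularity of the domain: bounded sets of \<open>BV(\<Omega>)\<close> are relatively compact in \<open>L\<^sup>1(\<Omega>)\<close>.
  Bounded Lipschitz domains have this property, but arbitrary bounded domains need not.
\<close>

definition BV_compactly_embedded :: "'a::euclidean_space set \<Rightarrow> bool" where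
  "BV_compactly_embedded \<Omega> \<longleftrightarrow>
     (\<forall>v :: nat \<Rightarrow> 'a \<Rightarrow> real. \<forall>K :: real.
        (\<forall>n. v n \<in> L1 \<Omega> \<and> TV \<Omega> (v n) + ereal (L1_norm \<Omega> (v n)) \<le> ereal K) \<longrightarrow>
        (\<exists>r. \<exists>w\<in>L1 \<Omega>. strict_mono (r :: nat \<Rightarrow> nat) \<and>
             (\<lambda>n. L1_norm \<Omega> (\<lambda>x. v (r n) x - w x)) \<longlonglongrightarrow> 0))"

section \<open>Primal and dual problems\<close>

definition subdifferential ::
  "'a::euclidean_space set \<Rightarrow> (('a \<Rightarrow> real) \<Rightarrow> ereal) \<Rightarrow> ('a \<Rightarrow> real) \<Rightarrow> ('a \<Rightarrow> real) set" where
  "subdifferential \<Omega> J u =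
     {p \<in> Linf \<Omega>. (\<forall>v\<in>L1 \<Omega>. J v \<ge> ereal (pairing \<Omega> p v)) \<and> J u = ereal (pairing \<Omega> p u)}"

definition primal_feasible :: "'a::euclidean_space set \<Rightarrow>
    (('a \<Rightarrow> real) \<Rightarrow> ('a \<Rightarrow> real) \<times> ('a \<Rightarrow> real)) \<Rightarrow> ('a \<Rightarrow> real) \<times> ('a \<Rightarrow> real) \<Rightarrow> ('a \<Rightarrow> real) set" where
  "primal_feasible \<Omega> B \<phi> =
     {u \<in> L1 \<Omega>. ae_le \<Omega> (\<lambda>x. 0) u \<and>
                ae_le \<Omega> (fst (B u)) (fst \<phi>) \<and> ae_le \<Omega> (snd (B u)) (snd \<phi>)}"

definition primal_solution :: "'a::euclidean_space set \<Rightarrow> (('a \<Rightarrow> real) \<Rightarrow> ereal) \<Rightarrow>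
    (('a \<Rightarrow> real) \<Rightarrow> ('a \<Rightarrow> real) \<times> ('a \<Rightarrow> real)) \<Rightarrow> ('a \<Rightarrow> real) \<times> ('a \<Rightarrow> real) \<Rightarrow> ('a \<Rightarrow> real) \<Rightarrow> bool" where
  "primal_solution \<Omega> J B \<phi> u \<longleftrightarrow>
     u \<in> primal_feasible \<Omega> B \<phi> \<and> (\<forall>v\<in>primal_feasible \<Omega> B \<phi>. J u \<le> J v)"

definition dual_feasible :: "'a::euclidean_space set \<Rightarrow> (('a \<Rightarrow> real) \<Rightarrow> ereal) \<Rightarrow>
    (('a \<Rightarrow> real) \<Rightarrow> ('a \<Rightarrow> real) \<times> ('a \<Rightarrow> real)) \<Rightarrow> (('a \<Rightarrow> real) \<times> 'a functional \<times> 'a functional) set" where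
  "dual_feasible \<Omega> J B =
     {(l, m). l \<in> Linf \<Omega> \<and> ae_le \<Omega> (\<lambda>x. 0) l \<and>
              fst m \<in> Linf_dual \<Omega> \<and> nonneg_functional \<Omega> (fst m) \<and>
              snd m \<in> Linf_dual \<Omega> \<and> nonneg_functional \<Omega> (snd m) \<and>
              (\<lambda>x. l x - adjoint_rep \<Omega> B m x) \<in> subdifferential \<Omega> J (\<lambda>x. 0)}"

definition dual_solution :: "'a::euclidean_space set \<Rightarrow> (('a \<Rightarrow> real) \<Rightarrow> ereal) \<Rightarrow>
    (('a \<Rightarrow> real) \<Rightarrow> ('a \<Rightarrow> real) \<times> ('a \<Rightarrow> real)) \<Rightarrow> ('a \<Rightarrow> real) \<times> ('a \<Rightarrow> real) \<Rightarrow>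
    ('a \<Rightarrow> real) \<Rightarrow> 'a functional \<times> 'a functional \<Rightarrow> bool" where
  "dual_solution \<Omega> J B \<phi> l m \<longleftrightarrow>
     (l, m) \<in> dual_feasible \<Omega> J B \<and>
     (\<forall>(l', m')\<in>dual_feasible \<Omega> J B.
        dual_pairing m' (\<lambda>x. - fst \<phi> x, \<lambda>x. - snd \<phi> x)
          \<le> dual_pairing m (\<lambda>x. - fst \<phi> x, \<lambda>x. - snd \<phi> x))"

section \<open>Regions of constancy and bounds on them\<close>

definition region :: "'a::euclidean_space set \<Rightarrow> 'a set \<Rightarrow> bool" where
  "region \<Omega> \<omega> \<longleftrightarrow> \<omega> \<in> sets lebesgue \<and> \<omega> \<subseteq> \<Omega> \<and> measure lebesgue \<omega> > 0"

definition has_value_on :: "'a::euclidean_space set \<Rightarrow> ('a \<Rightarrow> real) \<Rightarrow> real \<Rightarrow> bool" where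
  "has_value_on \<omega> u c \<longleftrightarrow> (AE x in lebesgue_on \<omega>. u x = c)"

definition region_mean :: "'a::euclidean_space set \<Rightarrow> ('a \<Rightarrow> real) \<Rightarrow> 'a set \<Rightarrow> real" where
  "region_mean \<Omega> u \<omega> = 1 / measure lebesgue \<omega> * pairing \<Omega> u (indicator \<omega>)"

definition piecewise_constant :: "'a::euclidean_space set \<Rightarrow> ('a \<Rightarrow> real) \<Rightarrow> bool" where
  "piecewise_constant \<Omega> u \<longleftrightarrow>
     (\<exists>P. finite P \<and> partition_on \<Omega> P \<and> (\<forall>\<omega>\<in>P. \<omega> \<in> sets lebesgue \<and> (\<exists>c. has_value_on \<omega> u c)))"

definition near_minimisers :: "'a::euclidean_space set \<Rightarrow> (('a \<Rightarrow> real) \<Rightarrow> ereal) \<Rightarrow>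
    (('a \<Rightarrow> real) \<Rightarrow> ('a \<Rightarrow> real) \<times> ('a \<Rightarrow> real)) \<Rightarrow> ('a \<Rightarrow> real) \<times> ('a \<Rightarrow> real) \<Rightarrow>
    ('a \<Rightarrow> real) \<Rightarrow> ('a \<Rightarrow> real) \<Rightarrow> real \<Rightarrow> real \<Rightarrow> ('a \<Rightarrow> real) set" where
  "near_minimisers \<Omega> J B \<phi> un pn \<epsilon> C =
     {u \<in> primal_feasible \<Omega> B \<phi>.
        J u - ereal (pairing \<Omega> pn u) \<le> ereal \<epsilon> \<and> pairing \<Omega> pn (\<lambda>x. u x - un x) \<le> C}"

text \<open>
  \<open>LEAST\<close> and \<open>GREATEST\<close> are used instead of \<open>Inf\<close> and \<open>Sup\<close> because the extrema are meant to
  be attained.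
\<close>

definition lower_value :: "'a::euclidean_space set \<Rightarrow> ('a \<Rightarrow> real) set \<Rightarrow> 'a set \<Rightarrow> real" where
  "lower_value \<Omega> M \<omega> =
     1 / measure lebesgue \<omega> * (LEAST y. y \<in> (\<lambda>u. pairing \<Omega> u (indicator \<omega>)) ` M)"

definition upper_value :: "'a::euclidean_space set \<Rightarrow> ('a \<Rightarrow> real) set \<Rightarrow> 'a set \<Rightarrow> real" where
  "upper_value \<Omega> M \<omega> =
     1 / measure lebesgue \<omega> * (GREATEST y. y \<in> (\<lambda>u. pairing \<Omega> u (indicator \<omega>)) ` M)"

end

theory Submission
  imports Defs "HOL-Library.Function_Algebras"
begin

text \<open>
  Everything rests on one compactness argument. Suppose that \<open>v n\<close> is feasible for the \<open>n\<close>-th problem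
  and that the energies \<open>J (v n)\<close> are bounded. The bounds on \<open>A\<close> and \<open>f\<close> shrink, so the residuals
  \<open>A (v n) - f\<close> tend to zero uniformly (\<open>feasible_residual_bound\<close>). By the compact embedding of \<open>BV\<close> a
  subsequence converges in \<open>L\<^sup>1\<close>; its limit solves \<open>A w = f\<close>, and injectivity identifies it with \<open>ubar\<close>.
  Hence \<open>v n\<close> converges to \<open>ubar\<close> in \<open>L\<^sup>1\<close> (\<open>residual_tendsto_imp_L1_tendsto\<close>). On the sets \<open>M n\<close> the energy
  is at most \<open>\<epsilon> + C + J (u n) \<le> \<epsilon> + C + J ubar\<close>, so these sets shrink to \<open>ubar\<close>, and so do the means over
  regions whose measure stays away from zero. The same compactness makes each set of means compact, so
  that minimum and maximum are attained.
  
  For the enclosure it remains to see that \<open>ubar\<close> belongs to \<open>M n\<close> for large \<open>n\<close>. Lower semicontinuity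
  and \<open>J (u n) \<le> J ubar\<close> give \<open>J (u n) \<longlonglongrightarrow> J ubar\<close>, and the subgradient inequality gives
  \<open>(p n, ubar - u n) \<le> J ubar - J (u n)\<close>, which is eventually at most \<open>C\<close>. For the other condition the sign
  conditions in \<open>p n = lam n - B\<^sup>* mu n\<close> and the feasibility of \<open>ubar\<close> yield \<open>(p n, ubar) \<ge> - (mu n, \<phi> n)\<close>,
  so \<open>J ubar - (p n, ubar)\<close> is at most \<open>J ubar - J (u n)\<close> provided that there is no duality gap.
  
  Strong duality (\<open>dual_value_ge_primal_value\<close>) has to be proved without an interior feasible point, and
  again compactness does the work: a value below the minimum stays a lower bound when violated
  constraints are penalised strongly enough (\<open>exact_penalty\<close>). This says that a convex cone in the space
  of perturbations contains no negative multiple of the vertical direction, and a linear form below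
  that cone (\<open>linear_form_below_convex_cone\<close>) provides multipliers whose dual value is at least that value.
  Two facts about \<open>L\<^sup>1\<close> and \<open>L\<^sup>\<infinity>\<close> enter: positive operators are automatically bounded
  (\<open>positive_bounded\<close>), and positive bounded functionals on \<open>L\<^sup>1\<close> have bounded densities
  (\<open>positive_L1_functional_density\<close>), so that the multiplier for \<open>u \<ge> 0\<close> and the adjoint are functions.
\<close>

section \<open>Linear forms below convex cones\<close>

instantiation "fun" :: (type, real_vector) real_vector
begin

definition scaleR_fun :: "real \<Rightarrow> ('a \<Rightarrow> 'b) \<Rightarrow> 'a \<Rightarrow> 'b" where
  "scaleR_fun c g = (\<lambda>x. c *\<^sub>R g x)"

instance
  by standard (simp_all add: fun_eq_iff scaleR_fun_def scaleR_add_right scaleR_add_left)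

end

text \<open>
  On \<open>E\<close> the inequality \<open>q (c *\<^sub>R x) \<le> c * q x\<close> for all \<open>c > 0\<close> already gives equality: apply it to
  \<open>inverse c\<close> as well. Asking only for the inequality makes infima of such functions easy to treat.
\<close>
definition sublinear_on :: "'v::real_vector set \<Rightarrow> ('v \<Rightarrow> real) \<Rightarrow> bool" where
  "sublinear_on E q \<longleftrightarrow>
     (\<forall>x\<in>E. \<forall>y\<in>E. q (x + y) \<le> q x + q y) \<and> (\<forall>x\<in>E. \<forall>c>0. q (c *\<^sub>R x) \<le> c * q x)"

definition linear_form_on :: "'v::real_vector set \<Rightarrow> ('v \<Rightarrow> real) \<Rightarrow> bool" where
  "linear_form_on E l \<longleftrightarrow>
     (\<forall>x\<in>E. \<forall>y\<in>E. l (x + y) = l x + l y) \<and> (\<forall>x\<in>E. \<forall>c. l (c *\<^sub>R x) = c * l x)"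

lemma linear_form_on_add:
  "linear_form_on E l \<Longrightarrow> x \<in> E \<Longrightarrow> y \<in> E \<Longrightarrow> l (x + y) = l x + l y"
  unfolding linear_form_on_def by simp

lemma linear_form_on_scale:
  "linear_form_on E l \<Longrightarrow> x \<in> E \<Longrightarrow> l (c *\<^sub>R x) = c * l x"
  unfolding linear_form_on_def by simp

lemma sublinear_on_add:
  "sublinear_on E q \<Longrightarrow> x \<in> E \<Longrightarrow> y \<in> E \<Longrightarrow> q (x + y) \<le> q x + q y"
  unfolding sublinear_on_def by blast

lemma sublinear_on_scale_le:
  "sublinear_on E q \<Longrightarrow> x \<in> E \<Longrightarrow> c > 0 \<Longrightarrow> q (c *\<^sub>R x) \<le> c * q x"
  unfolding sublinear_on_def by blast

lemma sublinear_on_scale: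
  assumes "subspace E" "sublinear_on E q" "x \<in> E" "c > 0"
  shows "q (c *\<^sub>R x) = c * q x"
proof (rule antisym)
  show "q (c *\<^sub>R x) \<le> c * q x"
    using assms by (intro sublinear_on_scale_le)
  have "q (inverse c *\<^sub>R (c *\<^sub>R x)) \<le> inverse c * q (c *\<^sub>R x)"
    using assms by (intro sublinear_on_scale_le) (auto intro: subspace_scale)
  then show "c * q x \<le> q (c *\<^sub>R x)"
    using \<open>c > 0\<close> by (simp add: field_simps)
qed

lemma sublinear_on_zero:
  assumes "subspace E" "sublinear_on E q"
  shows "q 0 = 0"
  using sublinear_on_scale[OF assms subspace_0[OF assms(1)], of 2] by simp

lemma sublinear_on_lower:
  assumes "subspace E" "sublinear_on E q" "x \<in> E"
  shows "- q (- x) \<le> q x"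
  using sublinear_on_add[OF assms(2,3) subspace_neg[OF assms(1,3)]]
    sublinear_on_zero[OF assms(1,2)] by simp

text \<open>
  The chain condition is what makes an infimum of sublinear functions subadditive: two members that
  nearly attain the infimum at different points can be replaced by the smaller of the two. The
  infimum is finite because \<open>q x \<ge> - q (- x) \<ge> - S (- x)\<close> for every member \<open>q\<close>.
\<close>
lemma sublinear_on_chain_Inf:
  assumes E: "subspace E" and "C \<noteq> {}"
    and sub: "\<And>q. q \<in> C \<Longrightarrow> sublinear_on E q"
    and chain: "\<And>q r. q \<in> C \<Longrightarrow> r \<in> C \<Longrightarrow> q \<le> r \<or> r \<le> q"
    and le: "\<And>q x. q \<in> C \<Longrightarrow> x \<in> E \<Longrightarrow> q x \<le> S x"
  shows "sublinear_on E (\<lambda>x. INF q\<in>C. q x)"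
    and "\<And>q x. q \<in> C \<Longrightarrow> x \<in> E \<Longrightarrow> (INF q\<in>C. q x) \<le> q x"
proof -
  have bdd: "bdd_below ((\<lambda>q. q x) ` C)" if "x \<in> E" for x
  proof (rule bdd_belowI2)
    fix q assume "q \<in> C"
    then show "- S (- x) \<le> q x"
      using sublinear_on_lower[OF E sub that, of q] le[OF _ subspace_neg[OF E that], of q] by simp
  qed
  show lower: "(INF q\<in>C. q x) \<le> q x" if "q \<in> C" "x \<in> E" for q x
    using that by (intro cINF_lower bdd)
  show "sublinear_on E (\<lambda>x. INF q\<in>C. q x)"
    unfolding sublinear_on_def
  proof (intro conjI ballI allI impI)
    fix x y assume xy: "x \<in> E" "y \<in> E"
    have *: "(INF q\<in>C. q (x + y)) \<le> q1 x + q2 y" if q: "q1 \<in> C" "q2 \<in> C" for q1 q2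
    proof -
      from chain[OF q] obtain q where "q \<in> C" "q \<le> q1" "q \<le> q2" using q by auto
      have "(INF q\<in>C. q (x + y)) \<le> q (x + y)"
        using \<open>q \<in> C\<close> xy E by (intro lower) (auto intro: subspace_add)
      also have "\<dots> \<le> q x + q y" using sub[OF \<open>q \<in> C\<close>] xy by (intro sublinear_on_add)
      also have "\<dots> \<le> q1 x + q2 y"
        using \<open>q \<le> q1\<close> \<open>q \<le> q2\<close> by (intro add_mono) (auto simp: le_fun_def)
      finally show ?thesis .
    qed
    have "(INF q\<in>C. q (x + y)) - q2 y \<le> (INF q\<in>C. q x)" if "q2 \<in> C" for q2
      using *[OF _ that] \<open>C \<noteq> {}\<close> by (intro cINF_greatest) (auto simp: algebra_simps)
    then have "(INF q\<in>C. q (x + y)) - (INF q\<in>C. q x) \<le> (INF q\<in>C. q y)"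
      using \<open>C \<noteq> {}\<close> by (intro cINF_greatest) (auto simp: algebra_simps)
    then show "(INF q\<in>C. q (x + y)) \<le> (INF q\<in>C. q x) + (INF q\<in>C. q y)" by simp
  next
    fix x and c :: real assume x: "x \<in> E" and "c > 0"
    have "(INF q\<in>C. q (c *\<^sub>R x)) / c \<le> (INF q\<in>C. q x)"
    proof (rule cINF_greatest[OF \<open>C \<noteq> {}\<close>])
      fix q assume "q \<in> C"
      have "(INF q\<in>C. q (c *\<^sub>R x)) \<le> q (c *\<^sub>R x)"
        using \<open>q \<in> C\<close> x E by (intro lower) (auto intro: subspace_scale)
      also have "\<dots> \<le> c * q x" using sub[OF \<open>q \<in> C\<close>] x \<open>c > 0\<close> by (intro sublinear_on_scale_le)
      finally show "(INF q\<in>C. q (c *\<^sub>R x)) / c \<le> q x"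
        using \<open>c > 0\<close> by (simp add: field_simps)
    qed
    then show "(INF q\<in>C. q (c *\<^sub>R x)) \<le> c * (INF q\<in>C. q x)"
      using \<open>c > 0\<close> by (simp add: field_simps)
  qed
qed

text \<open>
  The function \<open>h\<close> lowers \<open>q\<close> as far as shifts along the ray through \<open>z\<close> allow, and it stays
  sublinear. If \<open>q\<close> is minimal then \<open>h = q\<close> on \<open>E\<close>, and \<open>t = 1\<close> yields the missing inequality \<open>q y + q z \<le> q (y + z)\<close>.
\<close>
lemma sublinear_on_tilt:
  assumes E: "subspace E" and q: "sublinear_on E q" and z: "z \<in> E"
  defines "h \<equiv> \<lambda>y. INF t\<in>{0::real..}. q (y + t *\<^sub>R z) - t * q z"
  shows "sublinear_on E h"
    and "\<And>y t. y \<in> E \<Longrightarrow> t \<ge> 0 \<Longrightarrow> h y \<le> q (y + t *\<^sub>R z) - t * q z"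
proof -
  have bdd: "bdd_below ((\<lambda>t. q (y + t *\<^sub>R z) - t * q z) ` {0..})" if y: "y \<in> E" for y
  proof (rule bdd_belowI2)
    fix t :: real assume "t \<in> {0..}"
    have tz: "q (t *\<^sub>R z) = t * q z"
      using sublinear_on_scale[OF E q z, of t] sublinear_on_zero[OF E q] \<open>t \<in> {0..}\<close>
      by (cases "t = 0") auto
    have "q ((y + t *\<^sub>R z) + (- y)) \<le> q (y + t *\<^sub>R z) + q (- y)"
      using E y z by (intro sublinear_on_add[OF q]) (auto intro: subspace_add subspace_scale subspace_neg)
    then show "- q (- y) \<le> q (y + t *\<^sub>R z) - t * q z" using tz by simp
  qed
  show lower: "h y \<le> q (y + t *\<^sub>R z) - t * q z" if "y \<in> E" "t \<ge> 0" for y t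
    unfolding h_def using that by (intro cINF_lower bdd) auto
  have greatest: "a \<le> h y" if "\<And>t. t \<ge> 0 \<Longrightarrow> a \<le> q (y + t *\<^sub>R z) - t * q z" for a y
    unfolding h_def using that by (intro cINF_greatest) auto
  show "sublinear_on E h"
    unfolding sublinear_on_def
  proof (intro conjI ballI allI impI)
    fix x y assume xy: "x \<in> E" "y \<in> E"
    have *: "h (x + y) \<le> (q (x + s *\<^sub>R z) - s * q z) + (q (y + t *\<^sub>R z) - t * q z)"
      if "s \<ge> 0" "t \<ge> 0" for s t
    proof -
      have "h (x + y) \<le> q ((x + y) + (s + t) *\<^sub>R z) - (s + t) * q z"
        using that xy E by (intro lower) (auto intro: subspace_add)
      also have "(x + y) + (s + t) *\<^sub>R z = (x + s *\<^sub>R z) + (y + t *\<^sub>R z)"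
        by (simp add: scaleR_add_left)
      also have "q \<dots> \<le> q (x + s *\<^sub>R z) + q (y + t *\<^sub>R z)"
        using xy z E by (intro sublinear_on_add[OF q]) (auto intro: subspace_add subspace_scale)
      finally show ?thesis by (simp add: algebra_simps)
    qed
    have "h (x + y) - (q (y + t *\<^sub>R z) - t * q z) \<le> h x" if "t \<ge> 0" for t
      using *[OF _ that] by (intro greatest) (auto simp: algebra_simps)
    then have "h (x + y) - h x \<le> h y"
      by (intro greatest) (auto simp: algebra_simps)
    then show "h (x + y) \<le> h x + h y" by simp
  next
    fix x and c :: real assume x: "x \<in> E" and "c > 0"
    have "h (c *\<^sub>R x) / c \<le> h x"
    proof (rule greatest)
      fix t :: real assume t: "t \<ge> 0"
      have "h (c *\<^sub>R x) \<le> q (c *\<^sub>R x + (c * t) *\<^sub>R z) - (c * t) * q z"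
        using x t E \<open>c > 0\<close> by (intro lower) (auto intro: subspace_scale)
      also have "c *\<^sub>R x + (c * t) *\<^sub>R z = c *\<^sub>R (x + t *\<^sub>R z)" by (simp add: scaleR_add_right)
      also have "q \<dots> \<le> c * q (x + t *\<^sub>R z)"
        using x z E \<open>c > 0\<close>
        by (intro sublinear_on_scale_le[OF q]) (auto intro: subspace_scale subspace_add)
      finally show "h (c *\<^sub>R x) / c \<le> q (x + t *\<^sub>R z) - t * q z"
        using \<open>c > 0\<close> by (simp add: field_simps)
    qed
    then show "h (c *\<^sub>R x) \<le> c * h x" using \<open>c > 0\<close> by (simp add: field_simps)
  qed
qed

lemma minimal_sublinear_on_linear:
  assumes E: "subspace E" and q: "sublinear_on E q"
    and minimal: "\<And>r x. sublinear_on E r \<Longrightarrow> (\<And>x. x \<in> E \<Longrightarrow> r x \<le> q x) \<Longrightarrow> x \<in> E \<Longrightarrow> r x = q x"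
  shows "linear_form_on E q"
proof -
  have add: "q (x + z) = q x + q z" if x: "x \<in> E" and z: "z \<in> E" for x z
  proof (rule antisym)
    show "q (x + z) \<le> q x + q z" using q x z by (rule sublinear_on_add)
    let ?h = "\<lambda>y. INF t\<in>{0::real..}. q (y + t *\<^sub>R z) - t * q z"
    have "?h x = q x"
    proof (rule minimal[OF sublinear_on_tilt(1)[OF E q z] _ x])
      fix y assume "y \<in> E"
      then show "?h y \<le> q y" using sublinear_on_tilt(2)[OF E q z, of y 0] by simp
    qed
    then show "q x + q z \<le> q (x + z)"
      using sublinear_on_tilt(2)[OF E q z x, of 1] by simp
  qed
  have neg: "q (- x) = - q x" if "x \<in> E" for x
    using add[OF that subspace_neg[OF E that]] sublinear_on_zero[OF E q] by simp
  have "q (c *\<^sub>R x) = c * q x" if x: "x \<in> E" for x c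
  proof (cases "c < 0")
    case True
    have "q (- ((- c) *\<^sub>R x)) = - q ((- c) *\<^sub>R x)" using E x by (intro neg subspace_scale)
    also have "\<dots> = - ((- c) * q x)"
      using sublinear_on_scale[OF E q x, of "- c"] True by simp
    finally show ?thesis by simp
  next
    case False
    then show ?thesis
      using sublinear_on_scale[OF E q x, of c] sublinear_on_zero[OF E q] by (cases "c = 0") auto
  qed
  then show ?thesis unfolding linear_form_on_def using add by blast
qed

lemma sublinear_on_cong:
  assumes "subspace E" "\<And>x. x \<in> E \<Longrightarrow> q x = r x"
  shows "sublinear_on E q \<longleftrightarrow> sublinear_on E r"
  unfolding sublinear_on_def
  by (simp add: assms(2) subspace_add[OF assms(1)] subspace_scale[OF assms(1)])

text \<open>
  The form of the Hahn--Banach theorem that needs no extension of partially defined forms: a minimal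
  sublinear function below \<open>S\<close> exists by Zorn's lemma and is linear.
\<close>
theorem Hahn_Banach_dominated:
  assumes E: "subspace E" and S: "sublinear_on E S"
  obtains l where "linear_form_on E l" "\<And>x. x \<in> E \<Longrightarrow> l x \<le> S x"
proof -
  (* Values outside E are normalised to 0, so that the pointwise order on functions is
     antisymmetric on the candidates and minimality can be stated as an equation. *)
  define R where "R q = (\<lambda>x. if x \<in> E then q x else (0::real))" for q :: "'a \<Rightarrow> real"
  have R: "sublinear_on E (R q) \<longleftrightarrow> sublinear_on E q" for q
    by (rule sublinear_on_cong[OF E]) (simp add: R_def)
  define F where "F = {q. sublinear_on E q \<and> (\<forall>x\<in>E. q x \<le> S x) \<and> (\<forall>x. x \<notin> E \<longrightarrow> q x = 0)}"
  have RF: "R q \<in> F" if "sublinear_on E q" "\<And>x. x \<in> E \<Longrightarrow> q x \<le> S x" for q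
    unfolding F_def using that R[of q] by (auto simp: R_def[of q])
  define P where "P = (\<lambda>q r :: 'a \<Rightarrow> real. r \<le> q)"
  have "\<exists>m\<in>F. \<forall>a\<in>F. P m a \<longrightarrow> a = m"
  proof (rule predicate_Zorn)
    show "partial_order_on F (relation_of P F)"
      by (auto simp: P_def partial_order_on_def preorder_on_def refl_on_def trans_def antisym_def
            relation_of_def)
    fix C assume C: "C \<in> Chains (relation_of P F)"
    then have CF: "C \<subseteq> F" and chain: "\<And>q r. q \<in> C \<Longrightarrow> r \<in> C \<Longrightarrow> q \<le> r \<or> r \<le> q"
      by (auto simp: Chains_def relation_of_def P_def)
    show "\<exists>u\<in>F. \<forall>a\<in>C. P a u"
    proof (cases "C = {}")
      case True
      then show ?thesis using RF[OF S] by auto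
    next
      case False
      let ?m = "\<lambda>x. INF q\<in>C. q x"
      note m = sublinear_on_chain_Inf[OF E False _ chain, of S]
      have sub: "sublinear_on E ?m" using CF by (intro m) (auto simp: F_def)
      have low: "?m x \<le> q x" if "q \<in> C" "x \<in> E" for q x
        using CF that by (intro m) (auto simp: F_def)
      have le: "?m x \<le> S x" if "x \<in> E" for x
      proof -
        obtain q where "q \<in> C" using False by blast
        then show ?thesis using low[OF \<open>q \<in> C\<close> that] CF that by (force simp: F_def)
      qed
      have "P q (R ?m)" if "q \<in> C" for q
        using low[OF that] CF that by (auto simp: P_def le_fun_def R_def F_def)
      then show ?thesis using RF[OF sub le] by blast
    qed
  qed
  then obtain m where m: "m \<in> F" and min: "\<And>a. a \<in> F \<Longrightarrow> a \<le> m \<Longrightarrow> a = m"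
    unfolding P_def by blast
  have "linear_form_on E m"
  proof (rule minimal_sublinear_on_linear[OF E])
    show "sublinear_on E m" using m by (simp add: F_def)
    fix r x assume r: "sublinear_on E r" "\<And>x. x \<in> E \<Longrightarrow> r x \<le> m x" and x: "x \<in> E"
    have "r x \<le> S x" if "x \<in> E" for x
      using r(2)[OF that] m that by (force simp: F_def)
    then have "R r \<in> F" using r(1) by (intro RF)
    moreover have "R r \<le> m" using r(2) m by (auto simp: le_fun_def R_def F_def)
    ultimately have "R r = m" by (rule min)
    then show "r x = m x" using x by (auto simp: R_def fun_eq_iff split: if_splits)
  qed
  then show thesis using m by (intro that) (auto simp: F_def)
qed

text \<open>
  The lower boundary \<open>y \<mapsto> Inf {r. (y, r) \<in> Q}\<close> of a convex cone is sublinear, and it is finite at \<open>y\<close>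
  because \<open>(y, r)\<close> and \<open>(- y, s)\<close> in the cone force \<open>r + s \<ge> 0\<close>. A linear form below it is a
  separating hyperplane; in the duality proof it supplies the Lagrange multipliers.
\<close>
theorem linear_form_below_convex_cone:
  fixes Q :: "('v::real_vector \<times> real) set"
  assumes E: "subspace E"
    and add: "\<And>y z r s. (y, r) \<in> Q \<Longrightarrow> (z, s) \<in> Q \<Longrightarrow> (y + z, r + s) \<in> Q"
    and scale: "\<And>y r c. (y, r) \<in> Q \<Longrightarrow> c > 0 \<Longrightarrow> (c *\<^sub>R y, c * r) \<in> Q"
    and full: "\<And>y. y \<in> E \<Longrightarrow> \<exists>r. (y, r) \<in> Q"
    and nonneg: "\<And>r. (0, r) \<in> Q \<Longrightarrow> 0 \<le> r"
  shows "\<exists>l. linear_form_on E l \<and> (\<forall>y r. y \<in> E \<longrightarrow> (y, r) \<in> Q \<longrightarrow> l y \<le> r)"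
proof -
  define S where "S y = Inf {r. (y, r) \<in> Q}" for y
  have bdd: "bdd_below {r. (y, r) \<in> Q}" if y: "y \<in> E" for y
  proof -
    obtain s where "(- y, s) \<in> Q" using full[OF subspace_neg[OF E y]] by blast
    then have "- s \<le> r" if "(y, r) \<in> Q" for r
      using nonneg[of "r + s"] add[OF that] by force
    then show ?thesis by (auto simp: bdd_below_def)
  qed
  have lower: "S y \<le> r" if "y \<in> E" "(y, r) \<in> Q" for y r
    unfolding S_def using that by (intro cInf_lower bdd) auto
  have greatest: "a \<le> S y" if "y \<in> E" "\<And>r. (y, r) \<in> Q \<Longrightarrow> a \<le> r" for y a
    unfolding S_def using that full by (intro cInf_greatest) auto
  have "sublinear_on E S"
    unfolding sublinear_on_def
  proof (intro conjI ballI allI impI)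
    fix x y assume xy: "x \<in> E" "y \<in> E"
    have *: "S (x + y) \<le> r + s" if "(x, r) \<in> Q" "(y, s) \<in> Q" for r s
      using that xy E add by (intro lower) (auto intro: subspace_add)
    have "S (x + y) - r \<le> S y" if "(x, r) \<in> Q" for r
      using *[OF that] by (intro greatest[OF xy(2)]) (auto simp: algebra_simps)
    then have "S (x + y) - S y \<le> S x"
      by (intro greatest[OF xy(1)]) (auto simp: algebra_simps)
    then show "S (x + y) \<le> S x + S y" by simp
  next
    fix x and c :: real assume x: "x \<in> E" and "c > 0"
    have "S (c *\<^sub>R x) / c \<le> S x"
    proof (rule greatest[OF x])
      fix r assume "(x, r) \<in> Q"
      then have "S (c *\<^sub>R x) \<le> c * r"
        using x \<open>c > 0\<close> E scale by (intro lower) (auto intro: subspace_scale)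
      then show "S (c *\<^sub>R x) / c \<le> r" using \<open>c > 0\<close> by (simp add: field_simps)
    qed
    then show "S (c *\<^sub>R x) \<le> c * S x" using \<open>c > 0\<close> by (simp add: field_simps)
  qed
  from Hahn_Banach_dominated[OF E this] obtain l
    where "linear_form_on E l" "\<And>x. x \<in> E \<Longrightarrow> l x \<le> S x" by blast
  then show ?thesis using lower order_trans by blast
qed

section \<open>The spaces of integrable and of essentially bounded functions\<close>

lemma Linf_norm_le_iff:
  assumes "g \<in> borel_measurable (lebesgue_on \<Omega>)"
  shows "Linf_norm \<Omega> g \<le> ereal k \<longleftrightarrow> (AE x in lebesgue_on \<Omega>. \<bar>g x\<bar> \<le> k)"
proof
  assume le: "Linf_norm \<Omega> g \<le> ereal k"
  show "AE x in lebesgue_on \<Omega>. \<bar>g x\<bar> \<le> k"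
    using esssup_AE[of "\<lambda>x. ereal \<bar>g x\<bar>" "lebesgue_on \<Omega>"]
  proof eventually_elim
    case (elim x)
    then have "ereal \<bar>g x\<bar> \<le> ereal k" using le unfolding Linf_norm_def by (rule order_trans)
    then show ?case by simp
  qed
next
  assume "AE x in lebesgue_on \<Omega>. \<bar>g x\<bar> \<le> k"
  then show "Linf_norm \<Omega> g \<le> ereal k"
    unfolding Linf_norm_def using assms by (intro esssup_I) auto
qed

lemma Linf_iff:
  "g \<in> Linf \<Omega> \<longleftrightarrow>
     g \<in> borel_measurable (lebesgue_on \<Omega>) \<and> (\<exists>K. AE x in lebesgue_on \<Omega>. \<bar>g x\<bar> \<le> K)"
proof (cases "g \<in> borel_measurable (lebesgue_on \<Omega>)")
  case True
  have "Linf_norm \<Omega> g < \<infinity> \<longleftrightarrow> (\<exists>K. Linf_norm \<Omega> g \<le> ereal K)"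
    by (cases "Linf_norm \<Omega> g") auto
  then show ?thesis using True by (simp add: Linf_def Linf_norm_le_iff)
qed (simp add: Linf_def)

lemma LinfI:
  "g \<in> borel_measurable (lebesgue_on \<Omega>) \<Longrightarrow> AE x in lebesgue_on \<Omega>. \<bar>g x\<bar> \<le> K \<Longrightarrow> g \<in> Linf \<Omega>"
  by (auto simp: Linf_iff)

lemma LinfE:
  assumes "g \<in> Linf \<Omega>"
  obtains K where "0 \<le> K" "AE x in lebesgue_on \<Omega>. \<bar>g x\<bar> \<le> K"
proof -
  from assms obtain K where K: "AE x in lebesgue_on \<Omega>. \<bar>g x\<bar> \<le> K" by (auto simp: Linf_iff)
  have "AE x in lebesgue_on \<Omega>. \<bar>g x\<bar> \<le> max 0 K" using K by eventually_elim auto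
  then show thesis by (intro that[of "max 0 K"]) auto
qed

lemma Linf_measurable: "g \<in> Linf \<Omega> \<Longrightarrow> g \<in> borel_measurable (lebesgue_on \<Omega>)"
  by (simp add: Linf_iff)

lemma Linf_zero: "(\<lambda>x. 0) \<in> Linf \<Omega>"
  by (auto simp: Linf_iff)

lemma Linf_add:
  assumes "g \<in> Linf \<Omega>" "h \<in> Linf \<Omega>"
  shows "(\<lambda>x. g x + h x) \<in> Linf \<Omega>"
proof -
  obtain K where K: "AE x in lebesgue_on \<Omega>. \<bar>g x\<bar> \<le> K" using assms by (auto simp: Linf_iff)
  obtain L where L: "AE x in lebesgue_on \<Omega>. \<bar>h x\<bar> \<le> L" using assms by (auto simp: Linf_iff)
  have "AE x in lebesgue_on \<Omega>. \<bar>g x + h x\<bar> \<le> K + L" using K L by eventually_elim auto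
  then show ?thesis using assms by (intro LinfI) (auto simp: Linf_iff)
qed

lemma Linf_cmult:
  assumes "g \<in> Linf \<Omega>"
  shows "(\<lambda>x. c * g x) \<in> Linf \<Omega>"
proof -
  obtain K where K: "AE x in lebesgue_on \<Omega>. \<bar>g x\<bar> \<le> K" using assms by (auto simp: Linf_iff)
  have "AE x in lebesgue_on \<Omega>. \<bar>c * g x\<bar> \<le> \<bar>c\<bar> * K"
    using K by eventually_elim (simp add: abs_mult mult_left_mono)
  then show ?thesis using assms by (intro LinfI) (auto simp: Linf_iff)
qed

lemma Linf_uminus: "g \<in> Linf \<Omega> \<Longrightarrow> (\<lambda>x. - g x) \<in> Linf \<Omega>"
  using Linf_cmult[of g \<Omega> "-1"] by simp

lemma Linf_diff: "g \<in> Linf \<Omega> \<Longrightarrow> h \<in> Linf \<Omega> \<Longrightarrow> (\<lambda>x. g x - h x) \<in> Linf \<Omega>"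
  using Linf_add[of g \<Omega> "\<lambda>x. - h x"] Linf_uminus[of h \<Omega>] by simp

lemma L1_zero: "(\<lambda>x. 0) \<in> L1 \<Omega>"
  by (simp add: L1_def)

lemma L1_add: "u \<in> L1 \<Omega> \<Longrightarrow> v \<in> L1 \<Omega> \<Longrightarrow> (\<lambda>x. u x + v x) \<in> L1 \<Omega>"
  by (simp add: L1_def)

lemma L1_diff: "u \<in> L1 \<Omega> \<Longrightarrow> v \<in> L1 \<Omega> \<Longrightarrow> (\<lambda>x. u x - v x) \<in> L1 \<Omega>"
  by (simp add: L1_def)

lemma L1_cmult: "u \<in> L1 \<Omega> \<Longrightarrow> (\<lambda>x. c * u x) \<in> L1 \<Omega>"
  by (simp add: L1_def)

lemma L1_abs: "u \<in> L1 \<Omega> \<Longrightarrow> (\<lambda>x. \<bar>u x\<bar>) \<in> L1 \<Omega>"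
  by (simp add: L1_def)

lemma L1_norm_nonneg: "0 \<le> L1_norm \<Omega> u"
  by (simp add: L1_norm_def)

lemma L1_norm_zero: "L1_norm \<Omega> (\<lambda>x. 0) = 0"
  by (simp add: L1_norm_def)

lemma L1_norm_cmult: "L1_norm \<Omega> (\<lambda>x. c * u x) = \<bar>c\<bar> * L1_norm \<Omega> u"
  by (simp add: L1_norm_def abs_mult)

lemma L1_norm_mono:
  assumes "u \<in> L1 \<Omega>" "v \<in> L1 \<Omega>" "AE x in lebesgue_on \<Omega>. \<bar>u x\<bar> \<le> \<bar>v x\<bar>"
  shows "L1_norm \<Omega> u \<le> L1_norm \<Omega> v"
  unfolding L1_norm_def using assms by (intro integral_mono_AE) (auto simp: L1_def)

lemma L1_norm_add:
  assumes "u \<in> L1 \<Omega>" "v \<in> L1 \<Omega>"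
  shows "L1_norm \<Omega> (\<lambda>x. u x + v x) \<le> L1_norm \<Omega> u + L1_norm \<Omega> v"
proof -
  have "(\<integral>x. \<bar>u x + v x\<bar> \<partial>lebesgue_on \<Omega>) \<le> (\<integral>x. \<bar>u x\<bar> + \<bar>v x\<bar> \<partial>lebesgue_on \<Omega>)"
    using assms by (intro integral_mono) (auto simp: L1_def)
  then show ?thesis using assms by (simp add: L1_norm_def L1_def)
qed

lemma L1_norm_eq_0:
  assumes "u \<in> L1 \<Omega>" "L1_norm \<Omega> u = 0"
  shows "AE x in lebesgue_on \<Omega>. u x = 0"
  using assms integral_nonneg_eq_0_iff_AE[of "lebesgue_on \<Omega>" "\<lambda>x. \<bar>u x\<bar>"]
  by (simp add: L1_def L1_norm_def)

lemma L1_norm_cong: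
  assumes "u \<in> L1 \<Omega>" "v \<in> L1 \<Omega>" "ae_eq \<Omega> u v"
  shows "L1_norm \<Omega> u = L1_norm \<Omega> v"
  unfolding L1_norm_def using assms by (intro integral_cong_AE) (auto simp: L1_def ae_eq_def)

lemma Linf_L1_integrable:
  assumes "p \<in> Linf \<Omega>" "u \<in> L1 \<Omega>"
  shows "integrable (lebesgue_on \<Omega>) (\<lambda>x. p x * u x)"
proof -
  obtain K where "AE x in lebesgue_on \<Omega>. \<bar>p x\<bar> \<le> K" using assms by (auto simp: Linf_iff)
  then have bd: "AE x in lebesgue_on \<Omega>. norm (p x * u x) \<le> norm (K * u x)"
    by eventually_elim (auto simp: abs_mult intro!: mult_right_mono)
  show ?thesis
  proof (rule Bochner_Integration.integrable_bound[OF _ _ bd])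
    show "integrable (lebesgue_on \<Omega>) (\<lambda>x. K * u x)" using assms by (simp add: L1_def)
    show "(\<lambda>x. p x * u x) \<in> borel_measurable (lebesgue_on \<Omega>)"
      using assms by (auto simp: L1_def Linf_iff)
  qed
qed

lemma pairing_add:
  "p \<in> Linf \<Omega> \<Longrightarrow> u \<in> L1 \<Omega> \<Longrightarrow> v \<in> L1 \<Omega> \<Longrightarrow>
     pairing \<Omega> p (\<lambda>x. u x + v x) = pairing \<Omega> p u + pairing \<Omega> p v"
  by (simp add: pairing_def distrib_left Linf_L1_integrable)

lemma pairing_diff:
  "p \<in> Linf \<Omega> \<Longrightarrow> u \<in> L1 \<Omega> \<Longrightarrow> v \<in> L1 \<Omega> \<Longrightarrow>
     pairing \<Omega> p (\<lambda>x. u x - v x) = pairing \<Omega> p u - pairing \<Omega> p v"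
  by (simp add: pairing_def right_diff_distrib Linf_L1_integrable)

lemma pairing_diff_left:
  "p \<in> Linf \<Omega> \<Longrightarrow> q \<in> Linf \<Omega> \<Longrightarrow> u \<in> L1 \<Omega> \<Longrightarrow>
     pairing \<Omega> (\<lambda>x. p x - q x) u = pairing \<Omega> p u - pairing \<Omega> q u"
  by (simp add: pairing_def left_diff_distrib Linf_L1_integrable)

lemma pairing_bound:
  assumes "p \<in> Linf \<Omega>"
  obtains K where "0 \<le> K" "\<And>u. u \<in> L1 \<Omega> \<Longrightarrow> \<bar>pairing \<Omega> p u\<bar> \<le> K * L1_norm \<Omega> u"
proof -
  obtain K where K: "0 \<le> K" "AE x in lebesgue_on \<Omega>. \<bar>p x\<bar> \<le> K" using LinfE[OF assms] .
  have "\<bar>pairing \<Omega> p u\<bar> \<le> K * L1_norm \<Omega> u" if u: "u \<in> L1 \<Omega>" for u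
  proof -
    have "\<bar>pairing \<Omega> p u\<bar> \<le> (\<integral>x. \<bar>p x * u x\<bar> \<partial>lebesgue_on \<Omega>)"
      unfolding pairing_def by (rule integral_abs_bound)
    also have "\<dots> \<le> (\<integral>x. K * \<bar>u x\<bar> \<partial>lebesgue_on \<Omega>)"
    proof (rule integral_mono_AE)
      show "integrable (lebesgue_on \<Omega>) (\<lambda>x. \<bar>p x * u x\<bar>)"
        using Linf_L1_integrable[OF assms u] by (rule integrable_abs)
      show "integrable (lebesgue_on \<Omega>) (\<lambda>x. K * \<bar>u x\<bar>)" using u by (simp add: L1_def)
      show "AE x in lebesgue_on \<Omega>. \<bar>p x * u x\<bar> \<le> K * \<bar>u x\<bar>"
        using K(2) by eventually_elim (auto simp: abs_mult intro!: mult_right_mono)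
    qed
    also have "\<dots> = K * L1_norm \<Omega> u" by (simp add: L1_norm_def)
    finally show ?thesis .
  qed
  then show thesis using K by (intro that) auto
qed

section \<open>Automatic continuity of regular operators\<close>

lemma linear_Linf: "linear_L1_Linf \<Omega> S \<Longrightarrow> u \<in> L1 \<Omega> \<Longrightarrow> S u \<in> Linf \<Omega>"
  by (simp add: linear_L1_Linf_def)

lemma linear_cong:
  "linear_L1_Linf \<Omega> S \<Longrightarrow> u \<in> L1 \<Omega> \<Longrightarrow> v \<in> L1 \<Omega> \<Longrightarrow> AE x in lebesgue_on \<Omega>. u x = v x \<Longrightarrow>
     AE x in lebesgue_on \<Omega>. S u x = S v x"
  by (simp add: linear_L1_Linf_def ae_eq_def)

lemma linear_add:
  "linear_L1_Linf \<Omega> S \<Longrightarrow> u \<in> L1 \<Omega> \<Longrightarrow> v \<in> L1 \<Omega> \<Longrightarrow>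
     AE x in lebesgue_on \<Omega>. S (\<lambda>x. u x + v x) x = S u x + S v x"
  by (simp add: linear_L1_Linf_def ae_eq_def)

lemma linear_scale:
  "linear_L1_Linf \<Omega> S \<Longrightarrow> u \<in> L1 \<Omega> \<Longrightarrow> AE x in lebesgue_on \<Omega>. S (\<lambda>x. c * u x) x = c * S u x"
  by (simp add: linear_L1_Linf_def ae_eq_def)

lemma linear_zero:
  assumes "linear_L1_Linf \<Omega> S"
  shows "AE x in lebesgue_on \<Omega>. S (\<lambda>x. 0) x = 0"
  using linear_scale[OF assms L1_zero, of 0] by simp

lemma linear_null:
  assumes "linear_L1_Linf \<Omega> S" "u \<in> L1 \<Omega>" "AE x in lebesgue_on \<Omega>. u x = 0"
  shows "AE x in lebesgue_on \<Omega>. S u x = 0"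
  using linear_cong[OF assms(1,2) L1_zero assms(3)] linear_zero[OF assms(1)]
  by eventually_elim simp

lemma linear_diff:
  assumes "linear_L1_Linf \<Omega> S" "u \<in> L1 \<Omega>" "v \<in> L1 \<Omega>"
  shows "AE x in lebesgue_on \<Omega>. S (\<lambda>x. u x - v x) x = S u x - S v x"
  using linear_add[OF assms(1,2) L1_cmult[OF assms(3)], of "-1"] linear_scale[OF assms(1,3), of "-1"]
  by eventually_elim simp

definition bounded_L1_Linf :: "'a::euclidean_space set \<Rightarrow> 'a operator \<Rightarrow> bool" where
  "bounded_L1_Linf \<Omega> S \<longleftrightarrow> linear_L1_Linf \<Omega> S \<and>
     (\<exists>K\<ge>0. \<forall>u\<in>L1 \<Omega>. AE x in lebesgue_on \<Omega>. \<bar>S u x\<bar> \<le> K * L1_norm \<Omega> u)"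

lemma bounded_linear_L1: "bounded_L1_Linf \<Omega> S \<Longrightarrow> linear_L1_Linf \<Omega> S"
  by (simp add: bounded_L1_Linf_def)

lemma bounded_L1_LinfE:
  assumes "bounded_L1_Linf \<Omega> S"
  obtains K where "0 \<le> K" "\<And>u. u \<in> L1 \<Omega> \<Longrightarrow> AE x in lebesgue_on \<Omega>. \<bar>S u x\<bar> \<le> K * L1_norm \<Omega> u"
  using assms unfolding bounded_L1_Linf_def by blast

text \<open>
  The majorant is \<open>\<Sum>k. (1 / 2) ^ k * u k\<close>, whose integral is at most \<open>2\<close>. It turns a sequence of
  functions in the unit ball into a single integrable function that dominates all of them up to
  geometric factors.
\<close>
lemma L1_geometric_majorant:
  assumes u: "\<And>k. u k \<in> L1 \<Omega>" "\<And>k::nat. AE x in lebesgue_on \<Omega>. 0 \<le> u k x" "\<And>k. L1_norm \<Omega> (u k) \<le> 1"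
  obtains U where "U \<in> L1 \<Omega>" "AE x in lebesgue_on \<Omega>. 0 \<le> U x"
    "\<And>k. AE x in lebesgue_on \<Omega>. (1 / 2) ^ k * u k x \<le> U x"
proof -
  let ?M = "lebesgue_on \<Omega>"
  define G where "G x = (\<Sum>k. ennreal ((1 / 2) ^ k * u k x))" for x
  have [measurable]: "u k \<in> borel_measurable ?M" for k using u(1)[of k] by (auto simp: L1_def)
  have G[measurable]: "G \<in> borel_measurable ?M" unfolding G_def by measurable
  have "(\<integral>\<^sup>+x. G x \<partial>?M) = (\<Sum>k. \<integral>\<^sup>+x. ennreal ((1 / 2) ^ k * u k x) \<partial>?M)"
    unfolding G_def by (rule nn_integral_suminf) measurable
  also have "\<dots> \<le> (\<Sum>k. ennreal ((1 / 2) ^ k))"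
  proof (intro suminf_le allI)
    fix k
    have "(\<integral>\<^sup>+x. ennreal ((1 / 2) ^ k * u k x) \<partial>?M) = ennreal (\<integral>x. (1 / 2) ^ k * u k x \<partial>?M)"
      using u(1)[of k] u(2)[of k] by (intro nn_integral_eq_integral) (auto simp: L1_def elim: eventually_mono)
    also have "(\<integral>x. (1 / 2) ^ k * u k x \<partial>?M) = (1 / 2) ^ k * L1_norm \<Omega> (u k)"
      unfolding L1_norm_def using u(2)[of k]
      by (subst integral_mult_right_zero, intro arg_cong[where f = "\<lambda>y. _ * y"] integral_cong_AE)
        (auto elim: eventually_mono)
    also have "\<dots> \<le> (1 / 2) ^ k" using u(3)[of k] by (simp add: mult_left_le)
    finally show "(\<integral>\<^sup>+x. ennreal ((1 / 2) ^ k * u k x) \<partial>?M) \<le> ennreal ((1 / 2) ^ k)"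
      by (simp add: ennreal_leI)
  qed auto
  also have "\<dots> = ennreal (\<Sum>k. (1 / 2) ^ k)" by (intro suminf_ennreal2) auto
  also have "\<dots> < \<infinity>" by simp
  finally have fin: "(\<integral>\<^sup>+x. G x \<partial>?M) < \<infinity>" .
  then have AE_fin: "AE x in ?M. G x \<noteq> \<infinity>" by (intro nn_integral_PInf_AE) auto
  define U where "U x = enn2real (G x)" for x
  have "U \<in> borel_measurable ?M" unfolding U_def by measurable
  have "(\<integral>\<^sup>+x. ennreal (U x) \<partial>?M) = (\<integral>\<^sup>+x. G x \<partial>?M)"
    using AE_fin by (intro nn_integral_cong_AE) (auto simp: U_def less_top elim!: eventually_mono)
  then have "integrable ?M U"
    using fin \<open>U \<in> borel_measurable ?M\<close> by (intro integrableI_nonneg) (auto simp: U_def)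
  moreover have "AE x in ?M. (1 / 2) ^ k * u k x \<le> U x" for k
    using AE_fin
  proof eventually_elim
    case (elim x)
    have "ennreal ((1 / 2) ^ k * u k x) \<le> G x"
      unfolding G_def using sum_le_suminf[of "\<lambda>k. ennreal ((1 / 2) ^ k * u k x)" "{k}"] by simp
    then have "ennreal ((1 / 2) ^ k * u k x) \<le> ennreal (U x)"
      using elim by (simp add: U_def less_top)
    then show ?case by (simp add: U_def)
  qed
  ultimately show thesis by (intro that[of U]) (auto simp: L1_def U_def)
qed

lemma positive_mono:
  assumes P: "positive_L1_Linf \<Omega> P" and "u \<in> L1 \<Omega>" "v \<in> L1 \<Omega>" "AE x in lebesgue_on \<Omega>. u x \<le> v x"
  shows "AE x in lebesgue_on \<Omega>. P u x \<le> P v x"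
proof -
  have lin: "linear_L1_Linf \<Omega> P" using P by (simp add: positive_L1_Linf_def)
  have "AE x in lebesgue_on \<Omega>. 0 \<le> P (\<lambda>x. v x - u x) x"
    using P assms(4) L1_diff[OF assms(3,2)] by (auto simp: positive_L1_Linf_def op_le_def ae_le_def)
  then show ?thesis using linear_diff[OF lin assms(3,2)] by eventually_elim simp
qed

text \<open>
  Positivity alone forces boundedness. If \<open>P (u k)\<close> were not bounded by \<open>4 ^ k * L1_norm \<Omega> (u k)\<close>
  for non-negative functions \<open>u k\<close>, then \<open>P U\<close> for the geometric majorant \<open>U\<close> of the normalised \<open>u k\<close>
  would exceed \<open>2 ^ k\<close> on a set of positive measure for every \<open>k\<close>, and so would not be essentially
  bounded.
\<close>
lemma positive_bounded:
  assumes P: "positive_L1_Linf \<Omega> P"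
  shows "bounded_L1_Linf \<Omega> P"
proof -
  let ?M = "lebesgue_on \<Omega>"
  have lin: "linear_L1_Linf \<Omega> P" using P by (simp add: positive_L1_Linf_def)
  have "\<exists>K\<ge>0. \<forall>u\<in>L1 \<Omega>. (AE x in ?M. 0 \<le> u x) \<longrightarrow> (AE x in ?M. P u x \<le> K * L1_norm \<Omega> u)"
  proof (rule ccontr)
    assume "\<not> ?thesis"
    then have "\<forall>K\<ge>0. \<exists>u\<in>L1 \<Omega>. (AE x in ?M. 0 \<le> u x) \<and> \<not> (AE x in ?M. P u x \<le> K * L1_norm \<Omega> u)"
      by blast
    then have "\<forall>k::nat. \<exists>u\<in>L1 \<Omega>. (AE x in ?M. 0 \<le> u x) \<and> \<not> (AE x in ?M. P u x \<le> 4 ^ k * L1_norm \<Omega> u)"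
      by simp
    then obtain u where u: "\<And>k::nat. u k \<in> L1 \<Omega>" "\<And>k. AE x in ?M. 0 \<le> u k x"
      and not: "\<And>k. \<not> (AE x in ?M. P (u k) x \<le> 4 ^ k * L1_norm \<Omega> (u k))" by metis
    have pos: "0 < L1_norm \<Omega> (u k)" for k
    proof (rule ccontr)
      assume "\<not> 0 < L1_norm \<Omega> (u k)"
      then have 0: "L1_norm \<Omega> (u k) = 0" using L1_norm_nonneg[of \<Omega> "u k"] by simp
      have "AE x in ?M. P (u k) x = 0" using linear_null[OF lin u(1) L1_norm_eq_0[OF u(1) 0]] .
      then have "AE x in ?M. P (u k) x \<le> 4 ^ k * L1_norm \<Omega> (u k)"
        by eventually_elim (simp add: 0)
      then show False using not[of k] by blast
    qed
    define v where "v k = (\<lambda>x. (1 / L1_norm \<Omega> (u k)) * u k x)" for k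
    have v: "v k \<in> L1 \<Omega>" "AE x in ?M. 0 \<le> v k x" "L1_norm \<Omega> (v k) \<le> 1" for k
    proof -
      show "v k \<in> L1 \<Omega>" unfolding v_def using u(1) by (rule L1_cmult)
      show "AE x in ?M. 0 \<le> v k x" unfolding v_def using u(2)[of k] pos[of k]
        by (auto elim!: eventually_mono)
      show "L1_norm \<Omega> (v k) \<le> 1" unfolding v_def L1_norm_cmult using pos[of k] by simp
    qed
    obtain U where U: "U \<in> L1 \<Omega>" "AE x in ?M. 0 \<le> U x" "\<And>k. AE x in ?M. (1 / 2) ^ k * v k x \<le> U x"
      using L1_geometric_majorant[of v \<Omega>] v by blast
    obtain K where K: "AE x in ?M. \<bar>P U x\<bar> \<le> K" using linear_Linf[OF lin U(1)] by (auto simp: Linf_iff)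
    obtain k where k: "K < 2 ^ k" using real_arch_pow[of 2 K] by auto
    have "AE x in ?M. P (\<lambda>x. (1 / 2) ^ k * v k x) x \<le> P U x"
      using L1_cmult[OF v(1)] U(1,3) by (intro positive_mono[OF P])
    with K linear_scale[OF lin v(1)[of k], of "(1 / 2) ^ k"]
      linear_scale[OF lin u(1)[of k], of "1 / L1_norm \<Omega> (u k)", folded v_def]
    have "AE x in ?M. P (u k) x \<le> 4 ^ k * L1_norm \<Omega> (u k)"
    proof eventually_elim
      case (elim x)
      then have "(1 / 2) ^ k * (P (u k) x / L1_norm \<Omega> (u k)) \<le> 2 ^ k" using k by simp
      then have "(P (u k) x / L1_norm \<Omega> (u k)) / 2 ^ k \<le> 2 ^ k" by (simp add: power_one_over mult.commute)
      then have "P (u k) x / L1_norm \<Omega> (u k) \<le> 2 ^ k * 2 ^ k" by (subst (asm) pos_divide_le_eq) auto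
      also have "(2 ^ k * 2 ^ k :: real) = 4 ^ k" by (simp flip: power_mult_distrib)
      finally show ?case using pos[of k] by (simp add: field_simps)
    qed
    then show False using not by blast
  qed
  then obtain K where K: "K \<ge> 0"
    "\<And>u. u \<in> L1 \<Omega> \<Longrightarrow> AE x in ?M. 0 \<le> u x \<Longrightarrow> AE x in ?M. P u x \<le> K * L1_norm \<Omega> u" by blast
  have "AE x in ?M. \<bar>P u x\<bar> \<le> K * L1_norm \<Omega> u" if u: "u \<in> L1 \<Omega>" for u
  proof -
    have au: "(\<lambda>x. \<bar>u x\<bar>) \<in> L1 \<Omega>" using u by (rule L1_abs)
    have mu: "(\<lambda>x. - 1 * u x) \<in> L1 \<Omega>" using u by (rule L1_cmult)
    have "AE x in ?M. P u x \<le> P (\<lambda>x. \<bar>u x\<bar>) x" using u au by (intro positive_mono[OF P]) auto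
    moreover have "AE x in ?M. P (\<lambda>x. - 1 * u x) x \<le> P (\<lambda>x. \<bar>u x\<bar>) x"
      using mu au by (intro positive_mono[OF P]) auto
    moreover have "AE x in ?M. P (\<lambda>x. \<bar>u x\<bar>) x \<le> K * L1_norm \<Omega> u"
      using K(2)[OF au] by (simp add: L1_norm_def)
    moreover note linear_scale[OF lin u, of "- 1"]
    ultimately show ?thesis by eventually_elim auto
  qed
  then show ?thesis using lin K(1) by (auto simp: bounded_L1_Linf_def)
qed

lemma bounded_L1_Linf_add:
  assumes S: "bounded_L1_Linf \<Omega> S" and T: "bounded_L1_Linf \<Omega> T" and R: "linear_L1_Linf \<Omega> R"
    and eq: "\<And>u. u \<in> L1 \<Omega> \<Longrightarrow> AE x in lebesgue_on \<Omega>. R u x = S u x + T u x"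
  shows "bounded_L1_Linf \<Omega> R"
proof -
  obtain K where K: "0 \<le> K" "\<And>u. u \<in> L1 \<Omega> \<Longrightarrow> AE x in lebesgue_on \<Omega>. \<bar>S u x\<bar> \<le> K * L1_norm \<Omega> u"
    using bounded_L1_LinfE[OF S] by blast
  obtain L where L: "0 \<le> L" "\<And>u. u \<in> L1 \<Omega> \<Longrightarrow> AE x in lebesgue_on \<Omega>. \<bar>T u x\<bar> \<le> L * L1_norm \<Omega> u"
    using bounded_L1_LinfE[OF T] by blast
  have "AE x in lebesgue_on \<Omega>. \<bar>R u x\<bar> \<le> (K + L) * L1_norm \<Omega> u" if "u \<in> L1 \<Omega>" for u
    using K(2)[OF that] L(2)[OF that] eq[OF that] by eventually_elim (auto simp: algebra_simps)
  then show ?thesis unfolding bounded_L1_Linf_def using K L R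
    by (intro conjI exI[of _ "K + L"]) auto
qed

lemma linear_uminus:
  assumes "linear_L1_Linf \<Omega> S"
  shows "linear_L1_Linf \<Omega> (\<lambda>u x. - S u x)"
  unfolding linear_L1_Linf_def ae_eq_def
proof (intro conjI ballI allI impI)
  fix u assume u: "u \<in> L1 \<Omega>"
  show "(\<lambda>x. - S u x) \<in> Linf \<Omega>" using u assms by (intro Linf_uminus linear_Linf)
  show "AE x in lebesgue_on \<Omega>. - S (\<lambda>x. c * u x) x = c * - S u x" for c
    using linear_scale[OF assms u, of c] by eventually_elim simp
next
  fix u v assume uv: "u \<in> L1 \<Omega>" "v \<in> L1 \<Omega>"
  show "AE x in lebesgue_on \<Omega>. - S (\<lambda>x. u x + v x) x = - S u x + - S v x"
    using linear_add[OF assms uv] by eventually_elim simp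
  assume "AE x in lebesgue_on \<Omega>. u x = v x"
  from linear_cong[OF assms uv this] show "AE x in lebesgue_on \<Omega>. - S u x = - S v x"
    by eventually_elim simp
qed

lemma bounded_L1_Linf_uminus:
  "bounded_L1_Linf \<Omega> S \<Longrightarrow> bounded_L1_Linf \<Omega> (\<lambda>u x. - S u x)"
  by (simp add: bounded_L1_Linf_def linear_uminus)

lemma regular_bounded:
  assumes "regular_L1_Linf \<Omega> S"
  shows "bounded_L1_Linf \<Omega> S"
proof -
  from assms obtain P Q where PQ: "positive_L1_Linf \<Omega> P" "positive_L1_Linf \<Omega> Q"
    "\<And>u. u \<in> L1 \<Omega> \<Longrightarrow> AE x in lebesgue_on \<Omega>. S u x = P u x - Q u x" and S: "linear_L1_Linf \<Omega> S"
    by (auto simp: regular_L1_Linf_def ae_eq_def)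
  show ?thesis
    using bounded_L1_Linf_add[OF positive_bounded[OF PQ(1)]
        bounded_L1_Linf_uminus[OF positive_bounded[OF PQ(2)]] S] PQ(3) by simp
qed

lemma linear_op_diff:
  assumes S: "linear_L1_Linf \<Omega> S" and T: "linear_L1_Linf \<Omega> T"
  shows "linear_L1_Linf \<Omega> (\<lambda>u x. S u x - T u x)"
  unfolding linear_L1_Linf_def ae_eq_def
proof (intro conjI ballI allI impI)
  fix u assume u: "u \<in> L1 \<Omega>"
  show "(\<lambda>x. S u x - T u x) \<in> Linf \<Omega>" using u S T by (intro Linf_diff linear_Linf)
  fix c
  show "AE x in lebesgue_on \<Omega>. S (\<lambda>x. c * u x) x - T (\<lambda>x. c * u x) x = c * (S u x - T u x)"
    using linear_scale[OF S u, of c] linear_scale[OF T u, of c]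
    by eventually_elim (simp add: algebra_simps)
next
  fix u v assume uv: "u \<in> L1 \<Omega>" "v \<in> L1 \<Omega>"
  show "AE x in lebesgue_on \<Omega>. S (\<lambda>x. u x + v x) x - T (\<lambda>x. u x + v x) x
      = S u x - T u x + (S v x - T v x)"
    using linear_add[OF S uv] linear_add[OF T uv] by eventually_elim simp
  assume eq: "AE x in lebesgue_on \<Omega>. u x = v x"
  show "AE x in lebesgue_on \<Omega>. S u x - T u x = S v x - T v x"
    using linear_cong[OF S uv eq] linear_cong[OF T uv eq] by eventually_elim simp
qed

text \<open>
  The exact operator is only known to be linear and to lie between regular operators. Above a regular
  operator \<open>T\<close> it is \<open>T\<close> plus a positive operator, so it inherits continuity.
\<close>
lemma bounded_of_regular_minorant:
  assumes S: "linear_L1_Linf \<Omega> S" and T: "regular_L1_Linf \<Omega> T" and le: "op_le \<Omega> T S"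
  shows "bounded_L1_Linf \<Omega> S"
proof -
  have T': "linear_L1_Linf \<Omega> T" using T by (simp add: regular_L1_Linf_def)
  have "positive_L1_Linf \<Omega> (\<lambda>u x. S u x - T u x)"
    using linear_op_diff[OF S T'] le by (simp add: positive_L1_Linf_def op_le_def)
  then show ?thesis
    using bounded_L1_Linf_add[OF regular_bounded[OF T] positive_bounded S] by simp
qed

text \<open>
  Pointwise constraints survive \<open>L\<^sup>1\<close> limits because a bounded operator turns \<open>L\<^sup>1\<close> convergence into
  uniform convergence almost everywhere; no subsequence is needed.
\<close>
lemma bounded_op_limit_le:
  assumes S: "bounded_L1_Linf \<Omega> S" and u: "\<And>k. u k \<in> L1 \<Omega>" and w: "w \<in> L1 \<Omega>"
    and conv: "(\<lambda>k. L1_norm \<Omega> (\<lambda>x. u k x - w x)) \<longlonglongrightarrow> 0"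
    and le: "\<And>e. e > 0 \<Longrightarrow> \<forall>\<^sub>F k in sequentially. AE x in lebesgue_on \<Omega>. S (u k) x \<le> g x + e"
  shows "AE x in lebesgue_on \<Omega>. S w x \<le> g x"
proof -
  obtain K where K: "0 \<le> K" "\<And>u. u \<in> L1 \<Omega> \<Longrightarrow> AE x in lebesgue_on \<Omega>. \<bar>S u x\<bar> \<le> K * L1_norm \<Omega> u"
    using bounded_L1_LinfE[OF S] by blast
  have "AE x in lebesgue_on \<Omega>. S w x \<le> g x + 2 * inverse (real (Suc j))" for j
  proof -
    define e where "e = inverse (real (Suc j))"
    have e: "e > 0" by (simp add: e_def)
    have "(\<lambda>k. K * L1_norm \<Omega> (\<lambda>x. u k x - w x)) \<longlonglongrightarrow> 0"
      using tendsto_mult_right_zero[OF conv] by simp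
    then have "\<forall>\<^sub>F k in sequentially. K * L1_norm \<Omega> (\<lambda>x. u k x - w x) < e"
      using e by (rule order_tendstoD)
    with le[OF e] have "\<forall>\<^sub>F k in sequentially. K * L1_norm \<Omega> (\<lambda>x. u k x - w x) < e \<and>
        (AE x in lebesgue_on \<Omega>. S (u k) x \<le> g x + e)" by eventually_elim auto
    then obtain k where k: "K * L1_norm \<Omega> (\<lambda>x. u k x - w x) < e"
      "AE x in lebesgue_on \<Omega>. S (u k) x \<le> g x + e" by (auto simp: eventually_sequentially)
    show ?thesis unfolding e_def[symmetric]
      using k(2) K(2)[OF L1_diff[OF u w], of k] linear_diff[OF bounded_linear_L1[OF S] u w, of k]
      by eventually_elim (use k(1) in auto)
  qed
  then have "AE x in lebesgue_on \<Omega>. \<forall>j. S w x \<le> g x + 2 * inverse (real (Suc j))"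
    by (subst AE_all_countable) auto
  then show ?thesis
  proof eventually_elim
    case (elim x)
    have "(\<lambda>j. g x + 2 * inverse (real (Suc j))) \<longlonglongrightarrow> g x + 2 * 0"
      by (intro tendsto_intros LIMSEQ_inverse_real_of_nat)
    then show ?case using elim by (intro LIMSEQ_le_const) auto
  qed
qed

lemma op_norm_bound:
  assumes T: "linear_L1_Linf \<Omega> T" and le: "op_norm \<Omega> T \<le> ereal k" and v: "v \<in> L1 \<Omega>"
  shows "AE x in lebesgue_on \<Omega>. \<bar>T v x\<bar> \<le> k * L1_norm \<Omega> v"
proof (cases "L1_norm \<Omega> v = 0")
  case True
  have "AE x in lebesgue_on \<Omega>. T v x = 0" using linear_null[OF T v L1_norm_eq_0[OF v True]] .
  then show ?thesis using True by (auto elim: eventually_mono)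
next
  case False
  then have pos: "L1_norm \<Omega> v > 0" using L1_norm_nonneg[of \<Omega> v] by simp
  let ?w = "\<lambda>x. (1 / L1_norm \<Omega> v) * v x"
  have w: "?w \<in> L1 \<Omega>" using v by (rule L1_cmult)
  have "L1_norm \<Omega> ?w \<le> 1" unfolding L1_norm_cmult using pos by simp
  then have "Linf_norm \<Omega> (T ?w) \<le> op_norm \<Omega> T"
    unfolding op_norm_def using w by (intro SUP_upper) auto
  then have "AE x in lebesgue_on \<Omega>. \<bar>T ?w x\<bar> \<le> k"
    using le Linf_norm_le_iff[OF Linf_measurable[OF linear_Linf[OF T w]]] order_trans by blast
  with linear_scale[OF T v, of "1 / L1_norm \<Omega> v"] show ?thesis
  proof eventually_elim
    case (elim x)
    then have "\<bar>T v x\<bar> / L1_norm \<Omega> v \<le> k" using pos by (simp add: abs_mult)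
    then show ?case using pos by (simp only: pos_divide_le_eq)
  qed
qed

section \<open>Densities of positive functionals\<close>

lemma integrable_bounded_functional_limit:
  fixes M :: "'b measure" and F :: "('b \<Rightarrow> real) \<Rightarrow> real"
  assumes diff: "\<And>u v. integrable M u \<Longrightarrow> integrable M v \<Longrightarrow> F (\<lambda>x. u x - v x) = F u - F v"
    and bound: "\<And>u. integrable M u \<Longrightarrow> \<bar>F u\<bar> \<le> K * (\<integral>x. \<bar>u x\<bar> \<partial>M)"
    and s: "\<And>i. integrable M (s i)" and u: "integrable M u"
    and conv: "\<And>x. x \<in> space M \<Longrightarrow> (\<lambda>i. s i x) \<longlonglongrightarrow> u x"
    and dom: "\<And>i x. x \<in> space M \<Longrightarrow> norm (s i x) \<le> 2 * norm (u x)"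
  shows "(\<lambda>i. F (s i)) \<longlonglongrightarrow> F u"
proof -
  have [measurable]: "u \<in> borel_measurable M" "\<And>i. s i \<in> borel_measurable M" using s u by auto
  have "(\<lambda>i. \<integral>x. \<bar>s i x - u x\<bar> \<partial>M) \<longlonglongrightarrow> (\<integral>x. 0 \<partial>M)"
  proof (rule integral_dominated_convergence[where w = "\<lambda>x. 3 * \<bar>u x\<bar>"])
    show "AE x in M. (\<lambda>i. \<bar>s i x - u x\<bar>) \<longlonglongrightarrow> 0"
    proof (rule AE_I2)
      fix x assume "x \<in> space M"
      from LIM_zero[OF conv[OF this]] show "(\<lambda>i. \<bar>s i x - u x\<bar>) \<longlonglongrightarrow> 0"
        by (rule tendsto_rabs_zero)
    qed
    show "AE x in M. norm \<bar>s i x - u x\<bar> \<le> 3 * \<bar>u x\<bar>" for i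
    proof (rule AE_I2)
      fix x assume "x \<in> space M"
      from dom[OF this, of i] show "norm \<bar>s i x - u x\<bar> \<le> 3 * \<bar>u x\<bar>" by simp
    qed
  qed (use u in auto)
  then have lim: "(\<lambda>i. K * (\<integral>x. \<bar>s i x - u x\<bar> \<partial>M)) \<longlonglongrightarrow> 0"
    using tendsto_mult_right_zero by force
  have "(\<lambda>i. F (s i) - F u) \<longlonglongrightarrow> 0"
  proof (rule Lim_null_comparison[OF _ lim])
    show "\<forall>\<^sub>F i in sequentially. norm (F (s i) - F u) \<le> K * (\<integral>x. \<bar>s i x - u x\<bar> \<partial>M)"
      using bound[OF Bochner_Integration.integrable_diff[OF s u]] diff[OF s u]
      by (intro always_eventually) auto
  qed
  then show ?thesis by (rule LIM_zero_cancel)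
qed

text \<open>
  The positive part of the duality between \<open>L\<^sup>1\<close> and \<open>L\<^sup>\<infinity>\<close>. The set function \<open>A \<mapsto> F (indicator A)\<close> is a
  measure: the bound \<open>K * measure M A\<close> makes it countably additive and absolutely continuous. Its
  Radon--Nikodym density is the representing function, first for indicators and then, both sides
  being continuous, for all integrable functions.
\<close>
theorem positive_L1_functional_density:
  fixes M :: "'b measure" and F :: "('b \<Rightarrow> real) \<Rightarrow> real"
  assumes M: "finite_measure M" and K: "0 \<le> K"
    and add: "\<And>u v. integrable M u \<Longrightarrow> integrable M v \<Longrightarrow> F (\<lambda>x. u x + v x) = F u + F v"
    and scale: "\<And>u c. integrable M u \<Longrightarrow> F (\<lambda>x. c * u x) = c * F u"
    and pos: "\<And>u. integrable M u \<Longrightarrow> AE x in M. 0 \<le> u x \<Longrightarrow> 0 \<le> F u"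
    and bound: "\<And>u. integrable M u \<Longrightarrow> \<bar>F u\<bar> \<le> K * (\<integral>x. \<bar>u x\<bar> \<partial>M)"
  shows "\<exists>h\<in>borel_measurable M. (AE x in M. 0 \<le> h x \<and> h x \<le> K) \<and>
    (\<forall>u. integrable M u \<longrightarrow> F u = (\<integral>x. h x * u x \<partial>M))"
proof -
  interpret finite_measure M by fact
  have diff: "F (\<lambda>x. u x - v x) = F u - F v" if "integrable M u" "integrable M v" for u v
    using add[OF that(1), of "\<lambda>x. - 1 * v x"] scale[OF that(2), of "- 1"] that by simp
  have int_ind[simp]: "integrable M (indicator A :: 'b \<Rightarrow> real)" if "A \<in> sets M" for A
    using that by (simp add: emeasure_eq_measure)
  define m where "m A = F (indicator A)" for A :: "'b set"
  have m_nonneg: "0 \<le> m A" if "A \<in> sets M" for A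
    unfolding m_def using that by (intro pos) auto
  have m_le: "m A \<le> K * measure M A" if "A \<in> sets M" for A
    using bound[OF int_ind[OF that]] that by (simp add: m_def)
  have "indicator {} = (\<lambda>x::'b. 0::real)" by (simp add: fun_eq_iff)
  then have m_0: "m {} = 0" using scale[of "\<lambda>x. 0" 0] by (simp add: m_def)
  have m_disj: "m (A \<union> B) = m A + m B" if "A \<in> sets M" "B \<in> sets M" "A \<inter> B = {}" for A B
    unfolding m_def using add[of "indicator A" "indicator B"] that
    by (simp add: indicator_add)
  have ca: "countably_additive (sets M) (\<lambda>A. ennreal (m A))"
  proof (rule countably_additiveI)
    fix A :: "nat \<Rightarrow> 'b set"
    assume A: "range A \<subseteq> sets M" "disjoint_family A" "(\<Union>i. A i) \<in> sets M"
    have part: "(\<Sum>i<n. m (A i)) = m (\<Union>i<n. A i)" for n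
    proof (induction n)
      case 0
      show ?case by (simp add: m_0)
    next
      case (Suc n)
      have "A i \<inter> A n = {}" if "i < n" for i
        using disjoint_family_onD[OF A(2), of i n] that by simp
      then have "(\<Union>i<n. A i) \<inter> A n = {}" by blast
      then have "m ((\<Union>i<n. A i) \<union> A n) = m (\<Union>i<n. A i) + m (A n)"
        using A(1) by (intro m_disj) blast+
      then show ?case using Suc by (simp add: lessThan_Suc Un_commute)
    qed
    have "(\<lambda>n. m (\<Union>i. A i) - m (\<Union>i<n. A i)) \<longlonglongrightarrow> 0"
    proof (rule Lim_null_comparison[OF always_eventually])
      show "\<forall>n. norm (m (\<Union>i. A i) - m (\<Union>i<n. A i))
          \<le> K * (measure M (\<Union>i. A i) - measure M (\<Union>i<n. A i))"
      proof
        fix n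
        let ?D = "(\<Union>i. A i) - (\<Union>i<n. A i)"
        have s: "(\<Union>i<n. A i) \<in> sets M" "?D \<in> sets M" using A by auto
        have "(\<Union>i<n. A i) \<union> ?D = (\<Union>i. A i)" by auto
        with m_disj[OF s Diff_disjoint] have "m (\<Union>i. A i) = m (\<Union>i<n. A i) + m ?D" by (simp only:)
        moreover have "measure M ?D = measure M (\<Union>i. A i) - measure M (\<Union>i<n. A i)"
          using s A(3) by (intro finite_measure_Diff) auto
        ultimately show "norm (m (\<Union>i. A i) - m (\<Union>i<n. A i))
          \<le> K * (measure M (\<Union>i. A i) - measure M (\<Union>i<n. A i))"
          using m_le[OF s(2)] m_nonneg[OF s(2)] by simp
      qed
      have "(\<lambda>n. measure M (\<Union>i<n. A i)) \<longlonglongrightarrow> measure M (\<Union>n. \<Union>i<n. A i)"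
      proof (rule finite_Lim_measure_incseq)
        show "range (\<lambda>n. \<Union>i<n. A i) \<subseteq> sets M" using A(1) by auto
        show "incseq (\<lambda>n. \<Union>i<n. A i)" by (intro monoI UN_mono) auto
      qed
      moreover have "(\<Union>n. \<Union>i<n. A i) = (\<Union>i. A i)" by auto
      ultimately have "(\<lambda>n. K * (measure M (\<Union>i. A i) - measure M (\<Union>i<n. A i)))
          \<longlonglongrightarrow> K * (measure M (\<Union>i. A i) - measure M (\<Union>i. A i))"
        by (intro tendsto_intros) auto
      then show "(\<lambda>n. K * (measure M (\<Union>i. A i) - measure M (\<Union>i<n. A i))) \<longlonglongrightarrow> 0" by simp
    qed
    from tendsto_diff[OF tendsto_const this, of "m (\<Union>i. A i)"]
    have "(\<lambda>i. m (A i)) sums m (\<Union>i. A i)" by (simp add: sums_def part)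
    then have "(\<lambda>i. ennreal (m (A i))) sums ennreal (m (\<Union>i. A i))"
      using A by (subst sums_ennreal) (auto intro!: m_nonneg)
    then show "(\<Sum>i. ennreal (m (A i))) = ennreal (m (\<Union>i. A i))" by (rule sums_unique[symmetric])
  qed
  define N where "N = measure_of (space M) (sets M) (\<lambda>A. ennreal (m A))"
  have sets_N: "sets N = sets M" by (simp add: N_def)
  have N: "emeasure N A = ennreal (m A)" if "A \<in> sets M" for A
    unfolding N_def using that ca m_0
    by (intro emeasure_measure_of_sigma) (auto simp: positive_def sets.sigma_algebra_axioms)
  have "absolutely_continuous M N"
    unfolding absolutely_continuous_def
  proof
    fix A assume A: "A \<in> null_sets M"
    then have "m A \<le> 0" using m_le[of A] by (simp add: null_sets_def measure_def)
    then show "A \<in> null_sets N" using A by (auto simp: null_sets_def sets_N N ennreal_neg)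
  qed
  from Radon_Nikodym[OF this sets_N] obtain g
    where g[measurable]: "g \<in> borel_measurable M" and "density M g = N" by blast
  then have mg: "ennreal (m A) = (\<integral>\<^sup>+x. g x * indicator A x \<partial>M)" if "A \<in> sets M" for A
    using N[OF that] that by (auto simp: emeasure_density)
  (* The density exceeds K by a fixed amount only on a null set, since there the measure
     would violate its bound m_le. *)
  have "AE x in M. \<not> ennreal (K + inverse (real (Suc j))) \<le> g x" for j
  proof -
    define e where "e = inverse (real (Suc j))"
    have e: "e > 0" by (simp add: e_def)
    define A where "A = {x \<in> space M. ennreal (K + e) \<le> g x}"
    have A: "A \<in> sets M" unfolding A_def by measurable
    have "ennreal ((K + e) * measure M A) = ennreal (K + e) * emeasure M A"
      using K e by (simp add: emeasure_eq_measure ennreal_mult)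
    also have "\<dots> = (\<integral>\<^sup>+x. ennreal (K + e) * indicator A x \<partial>M)"
      using A by (simp add: nn_integral_cmult_indicator)
    also have "\<dots> \<le> (\<integral>\<^sup>+x. g x * indicator A x \<partial>M)"
      by (intro nn_integral_mono) (auto simp: indicator_def A_def)
    also have "\<dots> = ennreal (m A)" using mg[OF A] by (simp only:)
    also have "\<dots> \<le> ennreal (K * measure M A)" using m_le[OF A] by (rule ennreal_leI)
    finally have "(K + e) * measure M A \<le> K * measure M A"
      using K by (subst (asm) ennreal_le_iff) auto
    then have "e * measure M A \<le> 0" by (simp add: algebra_simps)
    then have "measure M A = 0"
      using e measure_nonneg[of M A] by (simp only: mult_le_0_iff) linarith
    then have "A \<in> null_sets M" using A by (simp add: null_sets_def emeasure_eq_measure)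
    then show ?thesis by (rule AE_I') (auto simp: A_def e_def)
  qed
  then have "AE x in M. \<forall>j. \<not> ennreal (K + inverse (real (Suc j))) \<le> g x"
    by (subst AE_all_countable) auto
  then have g_le: "AE x in M. g x \<le> ennreal K"
  proof eventually_elim
    case (elim x)
    have "(\<lambda>j. ennreal (K + inverse (real (Suc j)))) \<longlonglongrightarrow> ennreal (K + 0)"
      by (intro tendsto_ennrealI tendsto_intros LIMSEQ_inverse_real_of_nat)
    then show ?case using elim by (intro LIMSEQ_le_const[of _ _ "g x"]) (auto intro: less_imp_le simp: not_le)
  qed
  define h where "h x = enn2real (g x)" for x
  have [measurable]: "h \<in> borel_measurable M" unfolding h_def by measurable
  have h_eq: "AE x in M. ennreal (h x) = g x"
    using g_le by eventually_elim (simp add: h_def le_less_trans[OF _ ennreal_less_top])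
  have h_bd: "AE x in M. 0 \<le> h x \<and> h x \<le> K"
    using g_le by eventually_elim (use K in \<open>auto simp: h_def enn2real_leI\<close>)
  have int_h: "integrable M (\<lambda>x. h x * u x)" if u: "integrable M u" for u
  proof (rule Bochner_Integration.integrable_bound[of _ "\<lambda>x. K * u x"])
    show "AE x in M. norm (h x * u x) \<le> norm (K * u x)"
      using h_bd by eventually_elim (use K in \<open>auto simp: abs_mult intro!: mult_right_mono\<close>)
  qed (use u in auto)
  define G where "G u = (\<integral>x. h x * u x \<partial>M)" for u
  have G_diff: "G (\<lambda>x. u x - v x) = G u - G v" if "integrable M u" "integrable M v" for u v
    unfolding G_def using int_h[OF that(1)] int_h[OF that(2)] by (simp add: right_diff_distrib)
  have G_bound: "\<bar>G u\<bar> \<le> K * (\<integral>x. \<bar>u x\<bar> \<partial>M)" if u: "integrable M u" for u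
  proof -
    have "\<bar>G u\<bar> \<le> (\<integral>x. \<bar>h x * u x\<bar> \<partial>M)" unfolding G_def by (rule integral_abs_bound)
    also have "\<dots> \<le> (\<integral>x. K * \<bar>u x\<bar> \<partial>M)"
    proof (rule integral_mono_AE)
      show "integrable M (\<lambda>x. \<bar>h x * u x\<bar>)" using int_h[OF u] by (rule integrable_abs)
      show "integrable M (\<lambda>x. K * \<bar>u x\<bar>)" using u by simp
      show "AE x in M. \<bar>h x * u x\<bar> \<le> K * \<bar>u x\<bar>"
        using h_bd by eventually_elim (auto simp: abs_mult intro!: mult_right_mono)
    qed
    finally show ?thesis by simp
  qed
  have G_ind: "G (indicator A) = m A" if A: "A \<in> sets M" for A
  proof -
    have "G (indicator A) = enn2real (\<integral>\<^sup>+x. ennreal (h x * indicator A x) \<partial>M)"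
      unfolding G_def using A h_bd
      by (intro integral_eq_nn_integral) (auto elim!: eventually_mono)
    also have "(\<integral>\<^sup>+x. ennreal (h x * indicator A x) \<partial>M) = (\<integral>\<^sup>+x. g x * indicator A x \<partial>M)"
      using h_eq by (intro nn_integral_cong_AE) (auto simp: indicator_def elim!: eventually_mono)
    finally show ?thesis using m_nonneg[OF A] by (simp flip: mg[OF A])
  qed
  have "F u = G u" if "integrable M u" for u
    using that
  proof (induction rule: integrable_induct)
    case (base A c)
    have "G (\<lambda>x. c * indicator A x) = c * G (indicator A)"
      unfolding G_def by (simp add: mult.left_commute)
    then show ?case using scale[OF int_ind[OF base(1)], of c] G_ind[OF base(1)]
      by (simp add: m_def mult.commute)
  next
    case (add u v)
    have "G (\<lambda>x. u x + v x) = G u + G v"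
      unfolding G_def using int_h[OF add(1)] int_h[OF add(2)] by (simp add: distrib_left)
    then show ?case using add assms(3)[OF add(1,2)] by simp
  next
    case (lim u s)
    have "(\<lambda>i. F (s i)) \<longlonglongrightarrow> F u"
      using lim by (intro integrable_bounded_functional_limit[OF diff bound]) auto
    moreover have "(\<lambda>i. G (s i)) \<longlonglongrightarrow> G u"
      using lim by (intro integrable_bounded_functional_limit[OF G_diff G_bound]) auto
    ultimately show ?case using lim(5) by (auto intro: LIMSEQ_unique)
  qed
  then show ?thesis using h_bd by (intro bexI[of _ h] conjI allI impI) (simp_all add: G_def)
qed

section \<open>Convergence in \<open>L\<^sup>1\<close> and total variation\<close>

lemma L1_norm_tendsto_imp_pairing_tendsto:
  assumes p: "p \<in> Linf \<Omega>" and u: "\<And>k. u k \<in> L1 \<Omega>" and w: "w \<in> L1 \<Omega>"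
    and conv: "(\<lambda>k. L1_norm \<Omega> (\<lambda>x. u k x - w x)) \<longlonglongrightarrow> 0"
  shows "(\<lambda>k. pairing \<Omega> p (u k)) \<longlonglongrightarrow> pairing \<Omega> p w"
proof -
  obtain K where K: "\<And>u. u \<in> L1 \<Omega> \<Longrightarrow> \<bar>pairing \<Omega> p u\<bar> \<le> K * L1_norm \<Omega> u"
    using pairing_bound[OF p] by blast
  have lim: "(\<lambda>k. K * L1_norm \<Omega> (\<lambda>x. u k x - w x)) \<longlonglongrightarrow> 0"
    using tendsto_mult_right_zero[OF conv] by simp
  have "(\<lambda>k. pairing \<Omega> p (u k) - pairing \<Omega> p w) \<longlonglongrightarrow> 0"
    by (rule Lim_null_comparison[OF always_eventually lim])
      (use K[OF L1_diff[OF u w]] pairing_diff[OF p u w] in simp)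
  then show ?thesis by (rule LIM_zero_cancel)
qed

lemma L1_norm_tendsto:
  assumes u: "\<And>k. u k \<in> L1 \<Omega>" and w: "w \<in> L1 \<Omega>"
    and conv: "(\<lambda>k. L1_norm \<Omega> (\<lambda>x. u k x - w x)) \<longlonglongrightarrow> 0"
  shows "(\<lambda>k. L1_norm \<Omega> (u k)) \<longlonglongrightarrow> L1_norm \<Omega> w"
proof -
  have "norm (L1_norm \<Omega> (u k) - L1_norm \<Omega> w) \<le> L1_norm \<Omega> (\<lambda>x. u k x - w x)" for k
  proof -
    have "L1_norm \<Omega> (\<lambda>x. (u k x - w x) + w x) \<le> L1_norm \<Omega> (\<lambda>x. u k x - w x) + L1_norm \<Omega> w"
      using u w by (intro L1_norm_add L1_diff)
    moreover have "L1_norm \<Omega> (\<lambda>x. (w x - u k x) + u k x) \<le> L1_norm \<Omega> (\<lambda>x. w x - u k x) + L1_norm \<Omega> (u k)"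
      using u w by (intro L1_norm_add L1_diff)
    moreover have "L1_norm \<Omega> (\<lambda>x. w x - u k x) = L1_norm \<Omega> (\<lambda>x. u k x - w x)"
      by (simp add: L1_norm_def abs_minus_commute)
    ultimately show ?thesis by simp
  qed
  then have "(\<lambda>k. L1_norm \<Omega> (u k) - L1_norm \<Omega> w) \<longlonglongrightarrow> 0"
    by (intro Lim_null_comparison[OF always_eventually conv]) auto
  then show ?thesis by (rule LIM_zero_cancel)
qed

text \<open>
  The correction \<open>a k\<close> is the amount by which \<open>u k\<close> may violate non-negativity; it has to vanish only in
  the limit. This is needed for the relaxed constraints of the penalty argument.
\<close>
lemma L1_limit_nonneg:
  assumes u: "\<And>k. u k \<in> L1 \<Omega>" and a: "\<And>k. a k \<in> L1 \<Omega>" and w: "w \<in> L1 \<Omega>"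
    and conv: "(\<lambda>k. L1_norm \<Omega> (\<lambda>x. u k x - w x)) \<longlonglongrightarrow> 0" "(\<lambda>k. L1_norm \<Omega> (a k)) \<longlonglongrightarrow> 0"
    and nonneg: "\<And>k. AE x in lebesgue_on \<Omega>. 0 \<le> u k x + a k x"
  shows "AE x in lebesgue_on \<Omega>. 0 \<le> w x"
proof -
  let ?n = "\<lambda>x. max 0 (- w x)"
  have n: "?n \<in> L1 \<Omega>" using w by (simp add: L1_def)
  have le: "L1_norm \<Omega> ?n \<le> L1_norm \<Omega> (\<lambda>x. u k x - w x) + L1_norm \<Omega> (a k)" for k
  proof -
    have s: "(\<lambda>x. (u k x - w x) + a k x) \<in> L1 \<Omega>" using u w a by (intro L1_add L1_diff)
    have "L1_norm \<Omega> ?n \<le> L1_norm \<Omega> (\<lambda>x. (u k x - w x) + a k x)"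
      using nonneg[of k] by (intro L1_norm_mono n s) (auto elim!: eventually_mono)
    also have "\<dots> \<le> L1_norm \<Omega> (\<lambda>x. u k x - w x) + L1_norm \<Omega> (a k)"
      using u w a by (intro L1_norm_add L1_diff)
    finally show ?thesis .
  qed
  have "(\<lambda>k. L1_norm \<Omega> (\<lambda>x. u k x - w x) + L1_norm \<Omega> (a k)) \<longlonglongrightarrow> 0"
    using tendsto_add[OF conv] by simp
  then have "L1_norm \<Omega> ?n \<le> 0" using le by (intro LIMSEQ_le_const) auto
  then have "AE x in lebesgue_on \<Omega>. ?n x = 0"
    using L1_norm_nonneg[of \<Omega> ?n] by (intro L1_norm_eq_0 n) simp
  then show ?thesis by eventually_elim simp
qed

text \<open>
  The divergence of a test field is continuous and vanishes off a compact set, so pairing with it is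
  continuous on \<open>L\<^sup>1\<close>. This makes the total variation a supremum of \<open>L\<^sup>1\<close>-continuous functionals.
\<close>
lemma divergence_Linf:
  assumes "\<psi> \<in> test_fields \<Omega>"
  shows "divergence \<psi> \<in> Linf \<Omega>"
proof -
  have eq: "divergence \<psi> = (\<lambda>x. \<Sum>b\<in>Basis. frechet_derivative \<psi> (at x) b \<bullet> b)"
    by (rule ext) (simp add: divergence_def)
  have cont: "continuous_on UNIV (divergence \<psi>)"
    unfolding eq using assms by (intro continuous_intros) (auto simp: test_fields_def)
  obtain K where K: "compact K" "\<And>x. x \<notin> K \<Longrightarrow> \<psi> x = 0"
    using assms by (auto simp: test_fields_def)
  have zero: "divergence \<psi> x = 0" if x: "x \<notin> K" for x
  proof -
    have "(\<psi> has_derivative (\<lambda>_. 0)) (at x)"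
    proof (rule has_derivative_transform_within_open[of "\<lambda>_. 0"])
      show "open (- K)" using K(1) by (intro open_Compl compact_imp_closed)
    qed (use x K in auto)
    from frechet_derivative_at[OF this, symmetric] show ?thesis by (simp add: divergence_def)
  qed
  have "compact (divergence \<psi> ` K)"
    using K(1) by (intro compact_continuous_image continuous_on_subset[OF cont]) auto
  then obtain L where "\<forall>y\<in>divergence \<psi> ` K. norm y \<le> L"
    using compact_imp_bounded bounded_iff by metis
  then have L: "\<bar>divergence \<psi> x\<bar> \<le> L" if "x \<in> K" for x using that by auto
  show ?thesis
  proof (rule LinfI)
    have "divergence \<psi> \<in> borel_measurable borel" using cont by (rule borel_measurable_continuous_onI)
    then show "divergence \<psi> \<in> borel_measurable (lebesgue_on \<Omega>)"
      by (intro measurable_restrict_space1 measurable_completion) simp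
    have "\<bar>divergence \<psi> x\<bar> \<le> max 0 L" for x
      using L[of x] zero[of x] by (cases "x \<in> K") auto
    then show "AE x in lebesgue_on \<Omega>. \<bar>divergence \<psi> x\<bar> \<le> max 0 L" by simp
  qed
qed

lemma zero_test_field: "(\<lambda>x. 0) \<in> test_fields \<Omega>"
  by (auto simp: test_fields_def intro!: exI[of _ "{}"])

lemma pairing_divergence_zero: "pairing \<Omega> (divergence (\<lambda>x. 0)) u = 0"
  by (simp add: pairing_def divergence_def)

text \<open>
  Sublevel sets of the energy are described by real inequalities, one for each test field. Convexity,
  homogeneity and lower semicontinuity can then be read off without arithmetic in \<open>ereal\<close>.
\<close>
lemma TV_L1_le_iff:
  "TV_L1 \<Omega> \<gamma> u \<le> ereal c \<longleftrightarrow>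
     (\<forall>\<psi>\<in>test_fields \<Omega>. pairing \<Omega> (divergence \<psi>) u + \<gamma> * L1_norm \<Omega> u \<le> c)"
proof -
  have "TV_L1 \<Omega> \<gamma> u \<le> ereal c \<longleftrightarrow> TV \<Omega> u \<le> ereal (c - \<gamma> * L1_norm \<Omega> u)"
    unfolding TV_L1_def by (cases "TV \<Omega> u") (auto simp: algebra_simps)
  also have "\<dots> \<longleftrightarrow> (\<forall>\<psi>\<in>test_fields \<Omega>. pairing \<Omega> (divergence \<psi>) u \<le> c - \<gamma> * L1_norm \<Omega> u)"
    by (simp add: TV_def SUP_le_iff pairing_def mult.commute)
  finally show ?thesis by (simp add: algebra_simps)
qed

lemma TV_L1_norm_le: "TV_L1 \<Omega> \<gamma> u \<le> ereal c \<Longrightarrow> \<gamma> * L1_norm \<Omega> u \<le> c"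
  using zero_test_field[of \<Omega>] by (force simp: TV_L1_le_iff pairing_divergence_zero)

lemma TV_nonneg: "0 \<le> TV \<Omega> u"
proof -
  have "ereal (\<integral>x. u x * divergence (\<lambda>x. 0) x \<partial>lebesgue_on \<Omega>) \<le> TV \<Omega> u"
    unfolding TV_def by (intro SUP_upper zero_test_field)
  then show ?thesis by (simp add: divergence_def zero_ereal_def)
qed

lemma TV_L1_nonneg: "0 \<le> \<gamma> \<Longrightarrow> 0 \<le> TV_L1 \<Omega> \<gamma> u"
  by (simp add: TV_L1_def TV_nonneg L1_norm_nonneg)

lemma TV_L1_zero: "TV_L1 \<Omega> \<gamma> (\<lambda>x. 0) \<le> ereal 0"
  unfolding TV_L1_le_iff by (simp add: pairing_def L1_norm_zero)

lemma TV_L1_add: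
  assumes "u \<in> L1 \<Omega>" "v \<in> L1 \<Omega>" "0 \<le> \<gamma>" "TV_L1 \<Omega> \<gamma> u \<le> ereal a" "TV_L1 \<Omega> \<gamma> v \<le> ereal b"
  shows "TV_L1 \<Omega> \<gamma> (\<lambda>x. u x + v x) \<le> ereal (a + b)"
  unfolding TV_L1_le_iff
proof
  fix \<psi> assume \<psi>: "\<psi> \<in> test_fields \<Omega>"
  have "\<gamma> * L1_norm \<Omega> (\<lambda>x. u x + v x) \<le> \<gamma> * (L1_norm \<Omega> u + L1_norm \<Omega> v)"
    using assms by (intro mult_left_mono L1_norm_add)
  moreover have "pairing \<Omega> (divergence \<psi>) u + \<gamma> * L1_norm \<Omega> u \<le> a"
    "pairing \<Omega> (divergence \<psi>) v + \<gamma> * L1_norm \<Omega> v \<le> b"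
    using assms \<psi> by (auto simp: TV_L1_le_iff)
  ultimately show "pairing \<Omega> (divergence \<psi>) (\<lambda>x. u x + v x) + \<gamma> * L1_norm \<Omega> (\<lambda>x. u x + v x) \<le> a + b"
    using pairing_add[OF divergence_Linf[OF \<psi>] assms(1,2)] by (simp add: algebra_simps)
qed

lemma TV_L1_scale:
  assumes "u \<in> L1 \<Omega>" "0 \<le> c" "TV_L1 \<Omega> \<gamma> u \<le> ereal a"
  shows "TV_L1 \<Omega> \<gamma> (\<lambda>x. c * u x) \<le> ereal (c * a)"
  unfolding TV_L1_le_iff
proof
  fix \<psi> assume \<psi>: "\<psi> \<in> test_fields \<Omega>"
  have "pairing \<Omega> (divergence \<psi>) (\<lambda>x. c * u x) = c * pairing \<Omega> (divergence \<psi>) u"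
    by (simp add: pairing_def mult.left_commute)
  moreover have "c * (pairing \<Omega> (divergence \<psi>) u + \<gamma> * L1_norm \<Omega> u) \<le> c * a"
    using assms \<psi> by (intro mult_left_mono) (auto simp: TV_L1_le_iff)
  ultimately show "pairing \<Omega> (divergence \<psi>) (\<lambda>x. c * u x) + \<gamma> * L1_norm \<Omega> (\<lambda>x. c * u x) \<le> c * a"
    using \<open>0 \<le> c\<close> by (simp add: L1_norm_cmult algebra_simps)
qed

lemma TV_L1_cong:
  assumes "u \<in> L1 \<Omega>" "v \<in> L1 \<Omega>" "ae_eq \<Omega> u v"
  shows "TV_L1 \<Omega> \<gamma> u = TV_L1 \<Omega> \<gamma> v"
proof -
  have "(\<integral>x. u x * divergence \<psi> x \<partial>lebesgue_on \<Omega>) = (\<integral>x. v x * divergence \<psi> x \<partial>lebesgue_on \<Omega>)"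
    if "\<psi> \<in> test_fields \<Omega>" for \<psi>
    using assms Linf_measurable[OF divergence_Linf[OF that]]
    by (intro integral_cong_AE) (auto simp: L1_def ae_eq_def elim: eventually_mono)
  then have "TV \<Omega> u = TV \<Omega> v" unfolding TV_def by (intro SUP_cong) auto
  then show ?thesis using L1_norm_cong[OF assms] by (simp add: TV_L1_def)
qed

lemma TV_L1_lsc:
  assumes u: "\<And>k. u k \<in> L1 \<Omega>" and w: "w \<in> L1 \<Omega>"
    and conv: "(\<lambda>k. L1_norm \<Omega> (\<lambda>x. u k x - w x)) \<longlonglongrightarrow> 0"
    and le: "\<And>k. TV_L1 \<Omega> \<gamma> (u k) \<le> ereal (b k)" and b: "b \<longlonglongrightarrow> c"
  shows "TV_L1 \<Omega> \<gamma> w \<le> ereal c"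
  unfolding TV_L1_le_iff
proof
  fix \<psi> assume \<psi>: "\<psi> \<in> test_fields \<Omega>"
  have "(\<lambda>k. pairing \<Omega> (divergence \<psi>) (u k) + \<gamma> * L1_norm \<Omega> (u k))
      \<longlonglongrightarrow> pairing \<Omega> (divergence \<psi>) w + \<gamma> * L1_norm \<Omega> w"
    by (intro tendsto_intros L1_norm_tendsto_imp_pairing_tendsto[OF divergence_Linf[OF \<psi>]]
        L1_norm_tendsto u w conv)
  then show "pairing \<Omega> (divergence \<psi>) w + \<gamma> * L1_norm \<Omega> w \<le> c"
    by (rule LIMSEQ_le[OF _ b]) (use le \<psi> in \<open>auto simp: TV_L1_le_iff\<close>)
qed

lemma TV_L1_sublevel_compact:
  assumes emb: "BV_compactly_embedded \<Omega>" and \<gamma>: "\<gamma> > 0"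
    and u: "\<And>k. u k \<in> L1 \<Omega>" and le: "\<And>k. TV_L1 \<Omega> \<gamma> (u k) \<le> ereal c"
  obtains r w where "strict_mono (r :: nat \<Rightarrow> nat)" "w \<in> L1 \<Omega>"
    "(\<lambda>k. L1_norm \<Omega> (\<lambda>x. u (r k) x - w x)) \<longlonglongrightarrow> 0" "TV_L1 \<Omega> \<gamma> w \<le> ereal c"
proof -
  have "TV \<Omega> (u k) + ereal (L1_norm \<Omega> (u k)) \<le> ereal (c + c / \<gamma>)" for k
  proof -
    have "TV \<Omega> (u k) \<le> TV_L1 \<Omega> \<gamma> (u k)"
      unfolding TV_L1_def using \<gamma> L1_norm_nonneg[of \<Omega> "u k"]
      by (intro add_increasing2) auto
    then have "TV \<Omega> (u k) \<le> ereal c" using le order_trans by blast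
    moreover have "L1_norm \<Omega> (u k) \<le> c / \<gamma>"
      using TV_L1_norm_le[OF le] \<gamma> by (simp add: pos_le_divide_eq mult.commute)
    ultimately have "TV \<Omega> (u k) + ereal (L1_norm \<Omega> (u k)) \<le> ereal c + ereal (c / \<gamma>)"
      by (intro add_mono) auto
    then show ?thesis by simp
  qed
  then have "\<forall>k. u k \<in> L1 \<Omega> \<and> TV \<Omega> (u k) + ereal (L1_norm \<Omega> (u k)) \<le> ereal (c + c / \<gamma>)"
    using u by blast
  with emb obtain r w where rw: "strict_mono (r :: nat \<Rightarrow> nat)" "w \<in> L1 \<Omega>"
    "(\<lambda>k. L1_norm \<Omega> (\<lambda>x. u (r k) x - w x)) \<longlonglongrightarrow> 0"
    unfolding BV_compactly_embedded_def by blast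
  moreover have "TV_L1 \<Omega> \<gamma> w \<le> ereal c"
    by (rule TV_L1_lsc[OF u rw(2,3) le tendsto_const])
  ultimately show thesis by (rule that)
qed

section \<open>The dual of the essentially bounded functions\<close>

lemma Linf_dual_add:
  assumes "m \<in> Linf_dual \<Omega>" "g \<in> Linf \<Omega>" "h \<in> Linf \<Omega>"
  shows "m (\<lambda>x. g x + h x) = m g + m h"
proof -
  from assms(1) have "\<forall>g\<in>Linf \<Omega>. \<forall>h\<in>Linf \<Omega>. m (\<lambda>x. g x + h x) = m g + m h"
    unfolding Linf_dual_def mem_Collect_eq by (elim conjE)
  from bspec[OF bspec[OF this assms(2)] assms(3)] show ?thesis .
qed

lemma Linf_dual_scale:
  assumes "m \<in> Linf_dual \<Omega>" "g \<in> Linf \<Omega>"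
  shows "m (\<lambda>x. c * g x) = c * m g"
proof -
  from assms(1) have "\<forall>g\<in>Linf \<Omega>. \<forall>c. m (\<lambda>x. c * g x) = c * m g"
    unfolding Linf_dual_def mem_Collect_eq by (elim conjE)
  from spec[OF bspec[OF this assms(2)]] show ?thesis .
qed

lemma Linf_dual_uminus:
  assumes "m \<in> Linf_dual \<Omega>" "g \<in> Linf \<Omega>"
  shows "m (\<lambda>x. - g x) = - m g"
  using Linf_dual_scale[OF assms, of "-1"] by simp

lemma Linf_dual_diff:
  assumes "m \<in> Linf_dual \<Omega>" "g \<in> Linf \<Omega>" "h \<in> Linf \<Omega>"
  shows "m (\<lambda>x. g x - h x) = m g - m h"
  using Linf_dual_add[OF assms(1,2) Linf_uminus[OF assms(3)]] Linf_dual_uminus[OF assms(1,3)]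
  by simp

lemma Linf_dual_bound:
  assumes "m \<in> Linf_dual \<Omega>"
  shows "\<exists>K\<ge>0. \<forall>g k. g \<in> Linf \<Omega> \<longrightarrow> (AE x in lebesgue_on \<Omega>. \<bar>g x\<bar> \<le> k) \<longrightarrow> \<bar>m g\<bar> \<le> K * k"
proof -
  from assms have "\<exists>K\<ge>0. \<forall>g\<in>Linf \<Omega>. ereal \<bar>m g\<bar> \<le> ereal K * Linf_norm \<Omega> g"
    unfolding Linf_dual_def mem_Collect_eq by (elim conjE)
  then obtain K where K: "0 \<le> K" "\<And>g. g \<in> Linf \<Omega> \<Longrightarrow> ereal \<bar>m g\<bar> \<le> ereal K * Linf_norm \<Omega> g"
    by blast
  have "\<bar>m g\<bar> \<le> K * k" if g: "g \<in> Linf \<Omega>" "AE x in lebesgue_on \<Omega>. \<bar>g x\<bar> \<le> k" for g k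
  proof -
    have "Linf_norm \<Omega> g \<le> ereal k" using g by (simp add: Linf_norm_le_iff Linf_measurable)
    then have "ereal K * Linf_norm \<Omega> g \<le> ereal K * ereal k"
      using K(1) by (intro ereal_mult_left_mono) auto
    with K(2)[OF g(1)] have "ereal \<bar>m g\<bar> \<le> ereal K * ereal k" by (rule order_trans)
    then show ?thesis by simp
  qed
  then show ?thesis using K(1) by (intro exI[of _ K] conjI allI impI)
qed

lemma Linf_dual_cong:
  assumes m: "m \<in> Linf_dual \<Omega>" and gh: "g \<in> Linf \<Omega>" "h \<in> Linf \<Omega>"
    and eq: "AE x in lebesgue_on \<Omega>. g x = h x"
  shows "m g = m h"
proof -
  from Linf_dual_bound[OF m] obtain K where
    K: "\<forall>g k. g \<in> Linf \<Omega> \<longrightarrow> (AE x in lebesgue_on \<Omega>. \<bar>g x\<bar> \<le> k) \<longrightarrow> \<bar>m g\<bar> \<le> K * k"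
    by (elim exE conjE) (rule that)
  have "AE x in lebesgue_on \<Omega>. \<bar>g x - h x\<bar> \<le> 0" using eq by eventually_elim simp
  from K[rule_format, OF Linf_diff[OF gh] this] show ?thesis unfolding Linf_dual_diff[OF m gh] by simp
qed

lemma nonneg_functional_mono:
  assumes m: "m \<in> Linf_dual \<Omega>" "nonneg_functional \<Omega> m" and gh: "g \<in> Linf \<Omega>" "h \<in> Linf \<Omega>"
    and le: "AE x in lebesgue_on \<Omega>. g x \<le> h x"
  shows "m g \<le> m h"
proof -
  have "ae_le \<Omega> (\<lambda>x. 0) (\<lambda>x. h x - g x)" unfolding ae_le_def using le by eventually_elim simp
  then have "0 \<le> m (\<lambda>x. h x - g x)"
    by (rule m(2)[unfolded nonneg_functional_def, THEN bspec, THEN mp, OF Linf_diff[OF gh(2,1)]])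
  then show ?thesis unfolding Linf_dual_diff[OF m(1) gh(2,1)] by simp
qed

text \<open>
  On a null set the essential supremum would be \<open>-\<infinity>\<close>; a non-empty open set has positive measure.
\<close>
lemma Linf_norm_nonneg:
  assumes "open \<Omega>" "\<Omega> \<noteq> {}"
  shows "0 \<le> Linf_norm \<Omega> g"
proof -
  have "\<not> negligible \<Omega>" using assms by (rule open_not_negligible)
  then have "emeasure lebesgue \<Omega> \<noteq> 0"
    using assms by (auto simp: negligible_iff_null_sets null_sets_def)
  then have "emeasure (lebesgue_on \<Omega>) (space (lebesgue_on \<Omega>)) \<noteq> 0"
    using assms by (simp add: emeasure_restrict_space)
  then have "0 = esssup (lebesgue_on \<Omega>) (\<lambda>x. 0 :: ereal)" by (simp add: esssup_const)
  also have "\<dots> \<le> Linf_norm \<Omega> g" unfolding Linf_norm_def by (rule esssup_mono) auto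
  finally show ?thesis .
qed

text \<open>
  A one-sided bound suffices, since it can be applied to \<open>g\<close> and to \<open>- g\<close>.
\<close>
lemma Linf_dualI:
  assumes \<Omega>: "open \<Omega>" "\<Omega> \<noteq> {}"
    and add: "\<And>g h. g \<in> Linf \<Omega> \<Longrightarrow> h \<in> Linf \<Omega> \<Longrightarrow> m (\<lambda>x. g x + h x) = m g + m h"
    and scale: "\<And>g c. g \<in> Linf \<Omega> \<Longrightarrow> m (\<lambda>x. c * g x) = c * m g"
    and K: "0 \<le> K"
    and bound: "\<And>g k. g \<in> Linf \<Omega> \<Longrightarrow> 0 \<le> k \<Longrightarrow> AE x in lebesgue_on \<Omega>. \<bar>g x\<bar> \<le> k \<Longrightarrow> m g \<le> K * k"
  shows "m \<in> Linf_dual \<Omega>"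
proof -
  have "ereal \<bar>m g\<bar> \<le> ereal K * Linf_norm \<Omega> g" if g: "g \<in> Linf \<Omega>" for g
  proof -
    obtain k where k: "Linf_norm \<Omega> g = ereal k" "0 \<le> k"
      using g Linf_norm_nonneg[OF \<Omega>, of g] by (cases "Linf_norm \<Omega> g") (auto simp: Linf_def)
    have bd: "AE x in lebesgue_on \<Omega>. \<bar>g x\<bar> \<le> k"
      using Linf_norm_le_iff[OF Linf_measurable[OF g], of k] k by simp
    have "m g \<le> K * k" using bd k g by (intro bound)
    moreover have "m (\<lambda>x. - 1 * g x) \<le> K * k" using bd k Linf_cmult[OF g, of "- 1"] by (intro bound) auto
    ultimately show ?thesis using scale[OF g, of "- 1"] k by simp
  qed
  then show ?thesis
    unfolding Linf_dual_def mem_Collect_eq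
    by (intro conjI ballI allI exI[of _ K] add scale K) auto
qed

section \<open>Adjoints\<close>

lemma finite_measure_lebesgue_on_open:
  "open \<Omega> \<Longrightarrow> bounded \<Omega> \<Longrightarrow> finite_measure (lebesgue_on \<Omega>)"
  by (intro finite_measure_lebesgue_on lmeasurable_open)

text \<open>
  A positive functional composed with a positive operator is a positive bounded functional on \<open>L\<^sup>1\<close>,
  so it has a density although the functional itself may be a purely finitely additive measure.
\<close>
lemma positive_op_functional_density:
  assumes \<Omega>: "open \<Omega>" "bounded \<Omega>" and P: "positive_L1_Linf \<Omega> P"
    and m: "m \<in> Linf_dual \<Omega>" "nonneg_functional \<Omega> m"
  shows "\<exists>h\<in>Linf \<Omega>. \<forall>u\<in>L1 \<Omega>. pairing \<Omega> h u = m (P u)"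
proof -
  let ?M = "lebesgue_on \<Omega>"
  have lin: "linear_L1_Linf \<Omega> P" using P by (simp add: positive_L1_Linf_def)
  from Linf_dual_bound[OF m(1)] obtain K where K: "0 \<le> K"
    "\<forall>g k. g \<in> Linf \<Omega> \<longrightarrow> (AE x in ?M. \<bar>g x\<bar> \<le> k) \<longrightarrow> \<bar>m g\<bar> \<le> K * k"
    by (elim exE conjE) (rule that)
  obtain L where L: "0 \<le> L" "\<And>u. u \<in> L1 \<Omega> \<Longrightarrow> AE x in ?M. \<bar>P u x\<bar> \<le> L * L1_norm \<Omega> u"
    using bounded_L1_LinfE[OF positive_bounded[OF P]] by blast
  have "\<exists>h\<in>borel_measurable ?M. (AE x in ?M. 0 \<le> h x \<and> h x \<le> K * L) \<and>
    (\<forall>u. integrable ?M u \<longrightarrow> m (P u) = (\<integral>x. h x * u x \<partial>?M))"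
  proof (rule positive_L1_functional_density[of ?M "K * L" "\<lambda>u. m (P u)"])
    show "finite_measure ?M" using \<Omega> by (rule finite_measure_lebesgue_on_open)
    show "0 \<le> K * L" using K(1) L(1) by simp
    fix u v :: "'a \<Rightarrow> real" and c :: real
    assume u: "integrable ?M u"
    then have u': "u \<in> L1 \<Omega>" by (simp add: L1_def)
    show "m (P (\<lambda>x. c * u x)) = c * m (P u)"
      using Linf_dual_cong[OF m(1) linear_Linf[OF lin L1_cmult[OF u']]
          Linf_cmult[OF linear_Linf[OF lin u']] linear_scale[OF lin u']]
        Linf_dual_scale[OF m(1) linear_Linf[OF lin u']] by simp
    show "0 \<le> m (P u)" if "AE x in ?M. 0 \<le> u x"
      using m(2) P u' that linear_Linf[OF lin u']
      by (auto simp: nonneg_functional_def positive_L1_Linf_def op_le_def ae_le_def)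
    show "\<bar>m (P u)\<bar> \<le> K * L * (\<integral>x. \<bar>u x\<bar> \<partial>?M)"
      using K(2)[rule_format, OF linear_Linf[OF lin u'] L(2)[OF u']] by (simp add: L1_norm_def)
    assume "integrable ?M v"
    then have v': "v \<in> L1 \<Omega>" by (simp add: L1_def)
    show "m (P (\<lambda>x. u x + v x)) = m (P u) + m (P v)"
      using Linf_dual_cong[OF m(1) linear_Linf[OF lin L1_add[OF u' v']]
          Linf_add[OF linear_Linf[OF lin u'] linear_Linf[OF lin v']] linear_add[OF lin u' v']]
        Linf_dual_add[OF m(1) linear_Linf[OF lin u'] linear_Linf[OF lin v']] by simp
  qed
  then obtain h where h: "h \<in> borel_measurable ?M" "AE x in ?M. 0 \<le> h x \<and> h x \<le> K * L"
    "\<forall>u. integrable ?M u \<longrightarrow> m (P u) = (\<integral>x. h x * u x \<partial>?M)"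
    by (elim bexE conjE) (rule that)
  have "AE x in ?M. \<bar>h x\<bar> \<le> K * L" using h(2) by eventually_elim auto
  then have "h \<in> Linf \<Omega>" using h(1) by (intro LinfI)
  then show ?thesis using h(3) by (intro bexI[of _ h]) (simp_all add: pairing_def L1_def)
qed

lemma regular_op_functional_density:
  assumes \<Omega>: "open \<Omega>" "bounded \<Omega>" and S: "regular_L1_Linf \<Omega> S"
    and m: "m \<in> Linf_dual \<Omega>" "nonneg_functional \<Omega> m"
  shows "\<exists>h\<in>Linf \<Omega>. \<forall>u\<in>L1 \<Omega>. pairing \<Omega> h u = m (S u)"
proof -
  from S obtain P Q where P: "positive_L1_Linf \<Omega> P" and Q: "positive_L1_Linf \<Omega> Q"
    and eq: "\<And>u. u \<in> L1 \<Omega> \<Longrightarrow> AE x in lebesgue_on \<Omega>. S u x = P u x - Q u x"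
    and lin: "linear_L1_Linf \<Omega> S"
    by (auto simp: regular_L1_Linf_def ae_eq_def)
  have lins: "linear_L1_Linf \<Omega> P" "linear_L1_Linf \<Omega> Q" using P Q by (auto simp: positive_L1_Linf_def)
  from positive_op_functional_density[OF \<Omega> P m]
  obtain g where g: "g \<in> Linf \<Omega>" "\<forall>u\<in>L1 \<Omega>. pairing \<Omega> g u = m (P u)"
    by (elim bexE) (rule that)
  from positive_op_functional_density[OF \<Omega> Q m]
  obtain h where h: "h \<in> Linf \<Omega>" "\<forall>u\<in>L1 \<Omega>. pairing \<Omega> h u = m (Q u)"
    by (elim bexE) (rule that)
  have "pairing \<Omega> (\<lambda>x. g x - h x) u = m (S u)" if u: "u \<in> L1 \<Omega>" for u
  proof -
    note PQ = linear_Linf[OF lins(1) u] linear_Linf[OF lins(2) u]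
    have "m (S u) = m (\<lambda>x. P u x - Q u x)"
      by (rule Linf_dual_cong[OF m(1) linear_Linf[OF lin u] Linf_diff[OF PQ] eq[OF u]])
    then show ?thesis
      using pairing_diff_left[OF g(1) h(1) u] bspec[OF g(2) u] bspec[OF h(2) u] Linf_dual_diff[OF m(1) PQ]
      by simp
  qed
  then show ?thesis by (intro bexI[of _ "\<lambda>x. g x - h x"] ballI Linf_diff g(1) h(1))
qed

text \<open>
  The density of a regular operator is a difference of two densities of positive operators. Since a
  representing function exists, the choice made in the definition of \<open>adjoint_rep\<close> picks one.
\<close>
lemma adjoint_rep_pair_op:
  assumes \<Omega>: "open \<Omega>" "bounded \<Omega>" and S: "regular_L1_Linf \<Omega> Al" "regular_L1_Linf \<Omega> Au"
    and m1: "fst m \<in> Linf_dual \<Omega>" "nonneg_functional \<Omega> (fst m)"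
    and m2: "snd m \<in> Linf_dual \<Omega>" "nonneg_functional \<Omega> (snd m)"
  shows "adjoint_rep \<Omega> (pair_op Al Au) m \<in> Linf \<Omega>"
    and "\<And>u. u \<in> L1 \<Omega> \<Longrightarrow>
      pairing \<Omega> (adjoint_rep \<Omega> (pair_op Al Au) m) u = fst m (Al u) - snd m (Au u)"
proof -
  from regular_op_functional_density[OF \<Omega> S(1) m1]
  obtain g where g: "g \<in> Linf \<Omega>" "\<forall>u\<in>L1 \<Omega>. pairing \<Omega> g u = fst m (Al u)"
    by (elim bexE) (rule that)
  from regular_op_functional_density[OF \<Omega> S(2) m2]
  obtain h where h: "h \<in> Linf \<Omega>" "\<forall>u\<in>L1 \<Omega>. pairing \<Omega> h u = snd m (Au u)"
    by (elim bexE) (rule that)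
  have dual: "dual_pairing m (pair_op Al Au u) = fst m (Al u) - snd m (Au u)" if "u \<in> L1 \<Omega>" for u
    using Linf_dual_uminus[OF m2(1) linear_Linf[OF _ that, of Au]] S(2)
    by (simp add: dual_pairing_def pair_op_def regular_L1_Linf_def)
  have "\<exists>h. h \<in> Linf \<Omega> \<and> (\<forall>u\<in>L1 \<Omega>. pairing \<Omega> h u = dual_pairing m (pair_op Al Au u))"
    using g h by (intro exI[of _ "\<lambda>x. g x - h x"]) (auto simp: dual pairing_diff_left intro: Linf_diff)
  from someI_ex[OF this]
  have *: "adjoint_rep \<Omega> (pair_op Al Au) m \<in> Linf \<Omega> \<and>
    (\<forall>u\<in>L1 \<Omega>. pairing \<Omega> (adjoint_rep \<Omega> (pair_op Al Au) m) u = dual_pairing m (pair_op Al Au u))"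
    unfolding adjoint_rep_def .
  then show "adjoint_rep \<Omega> (pair_op Al Au) m \<in> Linf \<Omega>" by blast
  show "pairing \<Omega> (adjoint_rep \<Omega> (pair_op Al Au) m) u = fst m (Al u) - snd m (Au u)"
    if "u \<in> L1 \<Omega>" for u
    using * that dual by simp
qed

section \<open>Exact penalty\<close>

text \<open>
  The constraints \<open>u \<ge> 0\<close>, \<open>S1 u \<le> \<phi>1\<close> and \<open>S2 u \<le> \<phi>2\<close> may be violated by \<open>a\<close>, \<open>k1\<close> and \<open>k2\<close>, measured
  in the norms whose duals contain the multipliers: an integrable function for non-negativity, a
  constant for the two constraints in \<open>L\<^sup>\<infinity>\<close>.
\<close>
definition relaxed_feasible ::
  "'a::euclidean_space set \<Rightarrow> 'a operator \<Rightarrow> 'a operator \<Rightarrow> ('a \<Rightarrow> real) \<Rightarrow> ('a \<Rightarrow> real) \<Rightarrow>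
     ('a \<Rightarrow> real) \<Rightarrow> ('a \<Rightarrow> real) \<Rightarrow> real \<Rightarrow> real \<Rightarrow> bool" where
  "relaxed_feasible \<Omega> S1 S2 \<phi>1 \<phi>2 u a k1 k2 \<longleftrightarrow>
     u \<in> L1 \<Omega> \<and> a \<in> L1 \<Omega> \<and> 0 \<le> k1 \<and> 0 \<le> k2 \<and>
     (AE x in lebesgue_on \<Omega>. 0 \<le> u x + a x) \<and>
     (AE x in lebesgue_on \<Omega>. S1 u x \<le> \<phi>1 x + k1) \<and>
     (AE x in lebesgue_on \<Omega>. S2 u x \<le> \<phi>2 x + k2)"

text \<open>
  Every value \<open>c\<close> strictly below the constrained minimum is also a lower bound for the penalised problem,
  once the penalty \<open>K\<close> is large. Otherwise the penalties \<open>n = 1, 2, \<dots>\<close> would produce points of energy at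
  most \<open>c\<close> whose violations are at most \<open>c / n\<close>; by compactness of the energy sublevel sets a limit point
  is feasible with energy at most \<open>c\<close>. This replaces a Slater condition: lower semicontinuity of the
  value function at the unperturbed problem comes from compactness.
\<close>
lemma exact_penalty:
  assumes emb: "BV_compactly_embedded \<Omega>" and \<gamma>: "\<gamma> > 0"
    and S: "bounded_L1_Linf \<Omega> S1" "bounded_L1_Linf \<Omega> S2"
    and above: "\<forall>w. relaxed_feasible \<Omega> S1 S2 \<phi>1 \<phi>2 w (\<lambda>x. 0) 0 0 \<longrightarrow> ereal c < TV_L1 \<Omega> \<gamma> w"
  shows "\<exists>K\<ge>0. \<forall>u a k1 k2 j. relaxed_feasible \<Omega> S1 S2 \<phi>1 \<phi>2 u a k1 k2 \<longrightarrow>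
    TV_L1 \<Omega> \<gamma> u \<le> ereal j \<longrightarrow> c \<le> j + K * (L1_norm \<Omega> a + k1 + k2)"
proof (rule ccontr)
  assume not: "\<not> ?thesis"
  have "\<exists>u a k1 k2 j. relaxed_feasible \<Omega> S1 S2 \<phi>1 \<phi>2 u a k1 k2 \<and>
      TV_L1 \<Omega> \<gamma> u \<le> ereal j \<and> j + real n * (L1_norm \<Omega> a + k1 + k2) < c" for n
  proof (rule ccontr)
    assume "\<not> ?thesis"
    then have "\<forall>u a k1 k2 j. relaxed_feasible \<Omega> S1 S2 \<phi>1 \<phi>2 u a k1 k2 \<longrightarrow>
        TV_L1 \<Omega> \<gamma> u \<le> ereal j \<longrightarrow> c \<le> j + real n * (L1_norm \<Omega> a + k1 + k2)"
      by (simp add: not_less)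
    then have "\<exists>K\<ge>0. \<forall>u a k1 k2 j. relaxed_feasible \<Omega> S1 S2 \<phi>1 \<phi>2 u a k1 k2 \<longrightarrow>
        TV_L1 \<Omega> \<gamma> u \<le> ereal j \<longrightarrow> c \<le> j + K * (L1_norm \<Omega> a + k1 + k2)"
      by (intro exI[of _ "real n"] conjI of_nat_0_le_iff)
    with not show False by (rule notE)
  qed
  then obtain u a k1 k2 j where R: "\<And>n. relaxed_feasible \<Omega> S1 S2 \<phi>1 \<phi>2 (u n) (a n) (k1 n) (k2 n)"
    and Jj: "\<And>n. TV_L1 \<Omega> \<gamma> (u n) \<le> ereal (j n)"
    and lt: "\<And>n. j n + real n * (L1_norm \<Omega> (a n) + k1 n + k2 n) < c" by metis
  define s where "s n = L1_norm \<Omega> (a n) + k1 n + k2 n" for n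
  have k: "0 \<le> k1 n" "0 \<le> k2 n" "0 \<le> L1_norm \<Omega> (a n)" for n
    using R[of n] by (auto simp: relaxed_feasible_def L1_norm_nonneg)
  have s: "0 \<le> s n" for n using k[of n] by (simp add: s_def)
  have j: "0 \<le> j n" for n
  proof -
    have "0 \<le> TV_L1 \<Omega> \<gamma> (u n)" using \<gamma> by (intro TV_L1_nonneg) simp
    also have "\<dots> \<le> ereal (j n)" using Jj[of n] .
    finally show ?thesis by simp
  qed
  have jc: "j n \<le> c" for n
    using lt[of n, folded s_def] mult_nonneg_nonneg[OF of_nat_0_le_iff s[of n], of n] by linarith
  have le: "TV_L1 \<Omega> \<gamma> (u n) \<le> ereal c" for n
    using order_trans[OF Jj[of n], of "ereal c"] jc[of n] by simp
  have u: "u n \<in> L1 \<Omega>" for n using R[of n] by (simp add: relaxed_feasible_def)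
  obtain r w where r: "strict_mono r" and w: "w \<in> L1 \<Omega>"
    and conv: "(\<lambda>k. L1_norm \<Omega> (\<lambda>x. u (r k) x - w x)) \<longlonglongrightarrow> 0" and Jw: "TV_L1 \<Omega> \<gamma> w \<le> ereal c"
    using TV_L1_sublevel_compact[OF emb \<gamma> u le] .
  have "s \<longlonglongrightarrow> 0"
  proof (rule Lim_null_comparison[OF _ lim_const_over_n[of c]])
    show "\<forall>\<^sub>F n in sequentially. norm (s n) \<le> c / real n"
    proof (rule eventually_mono[OF eventually_gt_at_top[of 0]])
      fix n :: nat assume "0 < n"
      have "real n * s n \<le> c" using lt[of n] j[of n] by (simp add: s_def)
      then show "norm (s n) \<le> c / real n"
        using \<open>0 < n\<close> s[of n] by (simp add: pos_le_divide_eq mult.commute)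
    qed
  qed
  from LIMSEQ_subseq_LIMSEQ[OF this r] have sr: "(\<lambda>k. s (r k)) \<longlonglongrightarrow> 0" by (simp add: o_def)
  have small: "\<forall>\<^sub>F k in sequentially. s (r k) < e" if "e > 0" for e
    using sr that by (rule order_tendstoD)
  have "AE x in lebesgue_on \<Omega>. 0 \<le> w x"
  proof (rule L1_limit_nonneg[OF u _ w conv])
    show "a (r k) \<in> L1 \<Omega>" for k using R[of "r k"] by (simp add: relaxed_feasible_def)
    show "AE x in lebesgue_on \<Omega>. 0 \<le> u (r k) x + a (r k) x" for k
      using R[of "r k"] by (simp add: relaxed_feasible_def)
    show "(\<lambda>n. L1_norm \<Omega> (a (r n))) \<longlonglongrightarrow> 0"
    proof (rule Lim_null_comparison[OF always_eventually sr])
      have "norm (L1_norm \<Omega> (a (r n))) \<le> s (r n)" for n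
        using k[of "r n"] by (simp add: s_def)
      then show "\<forall>n. norm (L1_norm \<Omega> (a (r n))) \<le> s (r n)" ..
    qed
  qed
  moreover have "AE x in lebesgue_on \<Omega>. S1 w x \<le> \<phi>1 x"
  proof (rule bounded_op_limit_le[OF S(1) u w conv])
    fix e :: real assume "e > 0"
    from small[OF this] show "\<forall>\<^sub>F n in sequentially. AE x in lebesgue_on \<Omega>. S1 (u (r n)) x \<le> \<phi>1 x + e"
    proof eventually_elim
      case (elim n)
      have "AE x in lebesgue_on \<Omega>. S1 (u (r n)) x \<le> \<phi>1 x + k1 (r n)"
        using R[of "r n"] by (simp add: relaxed_feasible_def)
      then show ?case
        by eventually_elim (use elim k[of "r n"] in \<open>simp add: s_def\<close>)
    qed
  qed
  moreover have "AE x in lebesgue_on \<Omega>. S2 w x \<le> \<phi>2 x"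
  proof (rule bounded_op_limit_le[OF S(2) u w conv])
    fix e :: real assume "e > 0"
    from small[OF this] show "\<forall>\<^sub>F n in sequentially. AE x in lebesgue_on \<Omega>. S2 (u (r n)) x \<le> \<phi>2 x + e"
    proof eventually_elim
      case (elim n)
      have "AE x in lebesgue_on \<Omega>. S2 (u (r n)) x \<le> \<phi>2 x + k2 (r n)"
        using R[of "r n"] by (simp add: relaxed_feasible_def)
      then show ?case
        by eventually_elim (use elim k[of "r n"] in \<open>simp add: s_def\<close>)
    qed
  qed
  ultimately have "relaxed_feasible \<Omega> S1 S2 \<phi>1 \<phi>2 w (\<lambda>x. 0) 0 0"
    using w by (simp add: relaxed_feasible_def L1_zero)
  from above[rule_format, OF this] Jw show False by simp
qed

section \<open>Strong duality\<close>

text \<open>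
  The epigraph of the penalised perturbation function, homogenised by the factor \<open>t\<close> that scales the
  right-hand sides and the level \<open>c\<close>. For \<open>t = 1\<close> the triple \<open>(a, b1, b2)\<close> is a tightening of the three
  constraints and \<open>r\<close> bounds the penalised energy minus \<open>c\<close>. The inequality for \<open>r\<close> (instead of an
  equation) makes the set closed under addition.
\<close>
definition perturbation_cone ::
  "'a::euclidean_space set \<Rightarrow> real \<Rightarrow> 'a operator \<Rightarrow> 'a operator \<Rightarrow> ('a \<Rightarrow> real) \<Rightarrow> ('a \<Rightarrow> real) \<Rightarrow>
     real \<Rightarrow> real \<Rightarrow> ((('a \<Rightarrow> real) \<times> ('a \<Rightarrow> real) \<times> ('a \<Rightarrow> real)) \<times> real) set" where
  "perturbation_cone \<Omega> \<gamma> S1 S2 \<phi>1 \<phi>2 c K = {((a, b1, b2), r). \<exists>u t a' k1 k2 j.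
     u \<in> L1 \<Omega> \<and> a' \<in> L1 \<Omega> \<and> 0 \<le> t \<and> 0 \<le> k1 \<and> 0 \<le> k2 \<and>
     TV_L1 \<Omega> \<gamma> u \<le> ereal j \<and>
     (AE x in lebesgue_on \<Omega>. a x \<le> u x + a' x) \<and>
     (AE x in lebesgue_on \<Omega>. b1 x \<le> t * \<phi>1 x - S1 u x + k1) \<and>
     (AE x in lebesgue_on \<Omega>. b2 x \<le> t * \<phi>2 x - S2 u x + k2) \<and>
     j - c * t + K * (L1_norm \<Omega> a' + k1 + k2) \<le> r}"

lemma perturbation_coneI:
  assumes "u \<in> L1 \<Omega>" "a' \<in> L1 \<Omega>" "0 \<le> t" "0 \<le> k1" "0 \<le> k2" "TV_L1 \<Omega> \<gamma> u \<le> ereal j"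
    "AE x in lebesgue_on \<Omega>. a x \<le> u x + a' x"
    "AE x in lebesgue_on \<Omega>. b1 x \<le> t * \<phi>1 x - S1 u x + k1"
    "AE x in lebesgue_on \<Omega>. b2 x \<le> t * \<phi>2 x - S2 u x + k2"
    "j - c * t + K * (L1_norm \<Omega> a' + k1 + k2) \<le> r"
  shows "((a, b1, b2), r) \<in> perturbation_cone \<Omega> \<gamma> S1 S2 \<phi>1 \<phi>2 c K"
  using assms unfolding perturbation_cone_def by fast

lemma perturbation_coneE:
  assumes "((a, b1, b2), r) \<in> perturbation_cone \<Omega> \<gamma> S1 S2 \<phi>1 \<phi>2 c K"
  obtains u t a' k1 k2 j where
    "u \<in> L1 \<Omega>" "a' \<in> L1 \<Omega>" "0 \<le> t" "0 \<le> k1" "0 \<le> k2" "TV_L1 \<Omega> \<gamma> u \<le> ereal j"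
    "AE x in lebesgue_on \<Omega>. a x \<le> u x + a' x"
    "AE x in lebesgue_on \<Omega>. b1 x \<le> t * \<phi>1 x - S1 u x + k1"
    "AE x in lebesgue_on \<Omega>. b2 x \<le> t * \<phi>2 x - S2 u x + k2"
    "j - c * t + K * (L1_norm \<Omega> a' + k1 + k2) \<le> r"
  using assms unfolding perturbation_cone_def by fast

lemma perturbation_cone_add:
  assumes S: "linear_L1_Linf \<Omega> S1" "linear_L1_Linf \<Omega> S2" and K: "0 \<le> K" and \<gamma>: "0 \<le> \<gamma>"
    and y: "(y, r) \<in> perturbation_cone \<Omega> \<gamma> S1 S2 \<phi>1 \<phi>2 c K"
    and z: "(z, s) \<in> perturbation_cone \<Omega> \<gamma> S1 S2 \<phi>1 \<phi>2 c K"
  shows "(y + z, r + s) \<in> perturbation_cone \<Omega> \<gamma> S1 S2 \<phi>1 \<phi>2 c K"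
proof -
  obtain a b1 b2 where y_eq: "y = (a, b1, b2)" by (cases y) auto
  obtain a' b1' b2' where z_eq: "z = (a', b1', b2')" by (cases z) auto
  from y[unfolded y_eq] obtain u t d k1 k2 j where 1:
    "u \<in> L1 \<Omega>" "d \<in> L1 \<Omega>" "0 \<le> t" "0 \<le> k1" "0 \<le> k2" "TV_L1 \<Omega> \<gamma> u \<le> ereal j"
    "AE x in lebesgue_on \<Omega>. a x \<le> u x + d x"
    "AE x in lebesgue_on \<Omega>. b1 x \<le> t * \<phi>1 x - S1 u x + k1"
    "AE x in lebesgue_on \<Omega>. b2 x \<le> t * \<phi>2 x - S2 u x + k2"
    "j - c * t + K * (L1_norm \<Omega> d + k1 + k2) \<le> r"
    by (rule perturbation_coneE)
  from z[unfolded z_eq] obtain u' t' d' k1' k2' j' where 2: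
    "u' \<in> L1 \<Omega>" "d' \<in> L1 \<Omega>" "0 \<le> t'" "0 \<le> k1'" "0 \<le> k2'" "TV_L1 \<Omega> \<gamma> u' \<le> ereal j'"
    "AE x in lebesgue_on \<Omega>. a' x \<le> u' x + d' x"
    "AE x in lebesgue_on \<Omega>. b1' x \<le> t' * \<phi>1 x - S1 u' x + k1'"
    "AE x in lebesgue_on \<Omega>. b2' x \<le> t' * \<phi>2 x - S2 u' x + k2'"
    "j' - c * t' + K * (L1_norm \<Omega> d' + k1' + k2') \<le> s"
    by (rule perturbation_coneE)
  have "((\<lambda>x. a x + a' x, \<lambda>x. b1 x + b1' x, \<lambda>x. b2 x + b2' x), r + s)
      \<in> perturbation_cone \<Omega> \<gamma> S1 S2 \<phi>1 \<phi>2 c K"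
  proof (rule perturbation_coneI)
    show "(\<lambda>x. u x + u' x) \<in> L1 \<Omega>" "(\<lambda>x. d x + d' x) \<in> L1 \<Omega>"
      using 1 2 by (auto intro: L1_add)
    show "0 \<le> t + t'" "0 \<le> k1 + k1'" "0 \<le> k2 + k2'" using 1 2 by auto
    show "TV_L1 \<Omega> \<gamma> (\<lambda>x. u x + u' x) \<le> ereal (j + j')"
      using 1 2 \<gamma> by (intro TV_L1_add)
    show "AE x in lebesgue_on \<Omega>. a x + a' x \<le> u x + u' x + (d x + d' x)"
      using 1(7) 2(7) by eventually_elim simp
    show "AE x in lebesgue_on \<Omega>.
        b1 x + b1' x \<le> (t + t') * \<phi>1 x - S1 (\<lambda>x. u x + u' x) x + (k1 + k1')"
      using 1(8) 2(8) linear_add[OF S(1) 1(1) 2(1)] by eventually_elim (simp add: algebra_simps)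
    show "AE x in lebesgue_on \<Omega>.
        b2 x + b2' x \<le> (t + t') * \<phi>2 x - S2 (\<lambda>x. u x + u' x) x + (k2 + k2')"
      using 1(9) 2(9) linear_add[OF S(2) 1(1) 2(1)] by eventually_elim (simp add: algebra_simps)
    have "K * L1_norm \<Omega> (\<lambda>x. d x + d' x) \<le> K * (L1_norm \<Omega> d + L1_norm \<Omega> d')"
      using 1 2 K by (intro mult_left_mono L1_norm_add)
    then show "j + j' - c * (t + t') + K * (L1_norm \<Omega> (\<lambda>x. d x + d' x) + (k1 + k1') + (k2 + k2')) \<le> r + s"
      using 1(10) 2(10) by (simp add: algebra_simps)
  qed
  then show ?thesis by (simp add: y_eq z_eq plus_fun_def)
qed

lemma perturbation_cone_scale:
  assumes S: "linear_L1_Linf \<Omega> S1" "linear_L1_Linf \<Omega> S2" and e: "0 < e"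
    and y: "(y, r) \<in> perturbation_cone \<Omega> \<gamma> S1 S2 \<phi>1 \<phi>2 c K"
  shows "(e *\<^sub>R y, e * r) \<in> perturbation_cone \<Omega> \<gamma> S1 S2 \<phi>1 \<phi>2 c K"
proof -
  obtain a b1 b2 where y_eq: "y = (a, b1, b2)" by (cases y) auto
  from y[unfolded y_eq] obtain u t d k1 k2 j where 1:
    "u \<in> L1 \<Omega>" "d \<in> L1 \<Omega>" "0 \<le> t" "0 \<le> k1" "0 \<le> k2" "TV_L1 \<Omega> \<gamma> u \<le> ereal j"
    "AE x in lebesgue_on \<Omega>. a x \<le> u x + d x"
    "AE x in lebesgue_on \<Omega>. b1 x \<le> t * \<phi>1 x - S1 u x + k1"
    "AE x in lebesgue_on \<Omega>. b2 x \<le> t * \<phi>2 x - S2 u x + k2"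
    "j - c * t + K * (L1_norm \<Omega> d + k1 + k2) \<le> r"
    by (rule perturbation_coneE)
  have "((\<lambda>x. e * a x, \<lambda>x. e * b1 x, \<lambda>x. e * b2 x), e * r)
      \<in> perturbation_cone \<Omega> \<gamma> S1 S2 \<phi>1 \<phi>2 c K"
  proof (rule perturbation_coneI)
    show "(\<lambda>x. e * u x) \<in> L1 \<Omega>" "(\<lambda>x. e * d x) \<in> L1 \<Omega>"
      using 1 by (auto intro: L1_cmult)
    show "0 \<le> e * t" "0 \<le> e * k1" "0 \<le> e * k2" using 1 e by auto
    show "TV_L1 \<Omega> \<gamma> (\<lambda>x. e * u x) \<le> ereal (e * j)"
      using 1 e by (intro TV_L1_scale) auto
    show "AE x in lebesgue_on \<Omega>. e * a x \<le> e * u x + e * d x"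
      using 1(7) by eventually_elim (use e in \<open>simp flip: distrib_left\<close>)
    show "AE x in lebesgue_on \<Omega>. e * b1 x \<le> (e * t) * \<phi>1 x - S1 (\<lambda>x. e * u x) x + e * k1"
      using 1(8) linear_scale[OF S(1) 1(1), of e]
    proof eventually_elim
      case (elim x)
      then have "e * b1 x \<le> e * (t * \<phi>1 x - S1 u x + k1)" using e by (intro mult_left_mono) auto
      then show ?case using elim by (simp add: algebra_simps)
    qed
    show "AE x in lebesgue_on \<Omega>. e * b2 x \<le> (e * t) * \<phi>2 x - S2 (\<lambda>x. e * u x) x + e * k2"
      using 1(9) linear_scale[OF S(2) 1(1), of e]
    proof eventually_elim
      case (elim x)
      then have "e * b2 x \<le> e * (t * \<phi>2 x - S2 u x + k2)" using e by (intro mult_left_mono) auto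
      then show ?case using elim by (simp add: algebra_simps)
    qed
    have "e * (j - c * t + K * (L1_norm \<Omega> d + k1 + k2)) \<le> e * r"
      using 1(10) e by (intro mult_left_mono) auto
    then show "e * j - c * (e * t) + K * (L1_norm \<Omega> (\<lambda>x. e * d x) + e * k1 + e * k2) \<le> e * r"
      using e by (simp add: L1_norm_cmult algebra_simps)
  qed
  then show ?thesis by (simp add: y_eq scaleR_fun_def)
qed

text \<open>
  For \<open>t > 0\<close> dividing by \<open>t\<close> reduces the claim to the exact penalty inequality; for \<open>t = 0\<close> only
  non-negative terms remain.
\<close>
lemma perturbation_cone_nonneg:
  assumes S: "linear_L1_Linf \<Omega> S1" "linear_L1_Linf \<Omega> S2" and K: "0 \<le> K" and \<gamma>: "0 \<le> \<gamma>"
    and pen: "\<forall>u a k1 k2 j. relaxed_feasible \<Omega> S1 S2 \<phi>1 \<phi>2 u a k1 k2 \<longrightarrow>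
      TV_L1 \<Omega> \<gamma> u \<le> ereal j \<longrightarrow> c \<le> j + K * (L1_norm \<Omega> a + k1 + k2)"
    and r: "(0, r) \<in> perturbation_cone \<Omega> \<gamma> S1 S2 \<phi>1 \<phi>2 c K"
  shows "0 \<le> r"
proof -
  have "((\<lambda>x. 0, \<lambda>x. 0, \<lambda>x. 0), r) \<in> perturbation_cone \<Omega> \<gamma> S1 S2 \<phi>1 \<phi>2 c K"
    using r by (simp add: zero_prod_def zero_fun_def)
  then obtain u t d k1 k2 j where 1:
    "u \<in> L1 \<Omega>" "d \<in> L1 \<Omega>" "0 \<le> t" "0 \<le> k1" "0 \<le> k2" "TV_L1 \<Omega> \<gamma> u \<le> ereal j"
    "AE x in lebesgue_on \<Omega>. 0 \<le> u x + d x"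
    "AE x in lebesgue_on \<Omega>. 0 \<le> t * \<phi>1 x - S1 u x + k1"
    "AE x in lebesgue_on \<Omega>. 0 \<le> t * \<phi>2 x - S2 u x + k2"
    "j - c * t + K * (L1_norm \<Omega> d + k1 + k2) \<le> r"
    by (rule perturbation_coneE)
  show ?thesis
  proof (cases "t = 0")
    case True
    have "ereal 0 \<le> ereal j"
      using order_trans[OF TV_L1_nonneg[OF \<gamma>] 1(6)] by (simp add: zero_ereal_def)
    moreover have "0 \<le> K * (L1_norm \<Omega> d + k1 + k2)"
      using K 1(4,5) L1_norm_nonneg[of \<Omega> d] by (intro mult_nonneg_nonneg) auto
    ultimately show ?thesis using 1(10) True by simp
  next
    case False
    then have t: "t > 0" using 1(3) by simp
    define e where "e = 1 / t"
    have e: "e > 0" "e * t = 1" using t by (auto simp: e_def)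
    have "relaxed_feasible \<Omega> S1 S2 \<phi>1 \<phi>2 (\<lambda>x. e * u x) (\<lambda>x. e * d x) (e * k1) (e * k2)"
      unfolding relaxed_feasible_def
    proof (intro conjI)
      show "(\<lambda>x. e * u x) \<in> L1 \<Omega>" "(\<lambda>x. e * d x) \<in> L1 \<Omega>" using 1 by (auto intro: L1_cmult)
      show "0 \<le> e * k1" "0 \<le> e * k2" using 1 e by auto
      show "AE x in lebesgue_on \<Omega>. 0 \<le> e * u x + e * d x"
        using 1(7) by eventually_elim (use e in \<open>simp flip: distrib_left\<close>)
      show "AE x in lebesgue_on \<Omega>. S1 (\<lambda>x. e * u x) x \<le> \<phi>1 x + e * k1"
        using 1(8) linear_scale[OF S(1) 1(1), of e]
      proof eventually_elim
        case (elim x)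
        then have "0 \<le> e * (t * \<phi>1 x - S1 u x + k1)" using e by (intro mult_nonneg_nonneg) auto
        also have "\<dots> = (e * t) * \<phi>1 x - e * S1 u x + e * k1" by (simp add: algebra_simps)
        finally show ?case using elim e by simp
      qed
      show "AE x in lebesgue_on \<Omega>. S2 (\<lambda>x. e * u x) x \<le> \<phi>2 x + e * k2"
        using 1(9) linear_scale[OF S(2) 1(1), of e]
      proof eventually_elim
        case (elim x)
        then have "0 \<le> e * (t * \<phi>2 x - S2 u x + k2)" using e by (intro mult_nonneg_nonneg) auto
        also have "\<dots> = (e * t) * \<phi>2 x - e * S2 u x + e * k2" by (simp add: algebra_simps)
        finally show ?case using elim e by simp
      qed
    qed
    moreover have "TV_L1 \<Omega> \<gamma> (\<lambda>x. e * u x) \<le> ereal (e * j)"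
      using 1 e by (intro TV_L1_scale) auto
    ultimately have "c \<le> e * j + K * (L1_norm \<Omega> (\<lambda>x. e * d x) + e * k1 + e * k2)"
      using pen by blast
    then have "c \<le> e * (j + K * (L1_norm \<Omega> d + k1 + k2))"
      using e by (simp add: L1_norm_cmult algebra_simps)
    then have "t * c \<le> t * (e * (j + K * (L1_norm \<Omega> d + k1 + k2)))"
      using t by (intro mult_left_mono) auto
    also have "\<dots> = (e * t) * (j + K * (L1_norm \<Omega> d + k1 + k2))" by (simp add: algebra_simps)
    finally show ?thesis using 1(10) e by (simp add: algebra_simps)
  qed
qed

text \<open>
  The points of the cone with \<open>u = 0\<close> and \<open>t = 0\<close>. They show that the cone projects onto the whole
  perturbation space, and they bound any linear form below the cone by \<open>K\<close> times the size of the
  positive part of its argument, which gives positivity and continuity of the multipliers.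
\<close>
lemma perturbation_cone_zero_point:
  assumes S: "linear_L1_Linf \<Omega> S1" "linear_L1_Linf \<Omega> S2"
    and d: "d \<in> L1 \<Omega>" and k: "0 \<le> k1" "0 \<le> k2"
    and le: "AE x in lebesgue_on \<Omega>. a x \<le> d x" "AE x in lebesgue_on \<Omega>. b1 x \<le> k1"
      "AE x in lebesgue_on \<Omega>. b2 x \<le> k2"
  shows "((a, b1, b2), K * (L1_norm \<Omega> d + k1 + k2)) \<in> perturbation_cone \<Omega> \<gamma> S1 S2 \<phi>1 \<phi>2 c K"
proof (rule perturbation_coneI[OF L1_zero d order_refl k TV_L1_zero])
  show "AE x in lebesgue_on \<Omega>. a x \<le> 0 + d x" using le(1) by simp
  show "AE x in lebesgue_on \<Omega>. b1 x \<le> 0 * \<phi>1 x - S1 (\<lambda>x. 0) x + k1"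
    using le(2) linear_zero[OF S(1)] by eventually_elim simp
  show "AE x in lebesgue_on \<Omega>. b2 x \<le> 0 * \<phi>2 x - S2 (\<lambda>x. 0) x + k2"
    using le(3) linear_zero[OF S(2)] by eventually_elim simp
qed simp

text \<open>
  A linear form below the perturbation cone splits into three components, one for each constraint. The
  points with \<open>u = 0\<close> and \<open>t = 0\<close> make them positive and bounded, the points with \<open>t = 0\<close> give the
  subgradient inequality, and the point with \<open>u = 0\<close>, \<open>t = 1\<close> gives the dual value. The component that
  belongs to \<open>u \<ge> 0\<close> is a functional on \<open>L\<^sup>1\<close> and hence a function.
\<close>
lemma approximate_dual_multipliers:
  assumes \<Omega>: "open \<Omega>" "\<Omega> \<noteq> {}" "bounded \<Omega>"
    and emb: "BV_compactly_embedded \<Omega>" and \<gamma>: "\<gamma> > 0"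
    and S: "bounded_L1_Linf \<Omega> S1" "bounded_L1_Linf \<Omega> S2" and \<phi>: "\<phi>1 \<in> Linf \<Omega>" "\<phi>2 \<in> Linf \<Omega>"
    and above: "\<forall>w. relaxed_feasible \<Omega> S1 S2 \<phi>1 \<phi>2 w (\<lambda>x. 0) 0 0 \<longrightarrow> ereal c < TV_L1 \<Omega> \<gamma> w"
  shows "\<exists>l m1 m2. l \<in> Linf \<Omega> \<and> ae_le \<Omega> (\<lambda>x. 0) l \<and>
    m1 \<in> Linf_dual \<Omega> \<and> nonneg_functional \<Omega> m1 \<and> m2 \<in> Linf_dual \<Omega> \<and> nonneg_functional \<Omega> m2 \<and>
    (\<forall>v\<in>L1 \<Omega>. \<forall>j. TV_L1 \<Omega> \<gamma> v \<le> ereal j \<longrightarrow> pairing \<Omega> l v - m1 (S1 v) - m2 (S2 v) \<le> j) \<and>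
    m1 \<phi>1 + m2 \<phi>2 \<le> - c"
proof -
  let ?M = "lebesgue_on \<Omega>"
  have lin: "linear_L1_Linf \<Omega> S1" "linear_L1_Linf \<Omega> S2" using S by (auto simp: bounded_linear_L1)
  from exact_penalty[OF emb \<gamma> S above] obtain K where K: "0 \<le> K"
    and pen: "\<forall>u a k1 k2 j. relaxed_feasible \<Omega> S1 S2 \<phi>1 \<phi>2 u a k1 k2 \<longrightarrow>
      TV_L1 \<Omega> \<gamma> u \<le> ereal j \<longrightarrow> c \<le> j + K * (L1_norm \<Omega> a + k1 + k2)"
    by (elim exE conjE) (rule that)
  define Q where "Q = perturbation_cone \<Omega> \<gamma> S1 S2 \<phi>1 \<phi>2 c K"
  define E where "E = L1 \<Omega> \<times> Linf \<Omega> \<times> Linf \<Omega>"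
  have E: "subspace E"
    unfolding subspace_def
  proof (intro conjI ballI allI)
    show "0 \<in> E" by (simp add: E_def zero_prod_def zero_fun_def L1_zero Linf_zero)
    fix y and e :: real assume y: "y \<in> E"
    obtain a b1 b2 where y_eq: "y = (a, b1, b2)" by (cases y) auto
    show "e *\<^sub>R y \<in> E"
      using y by (simp add: y_eq E_def scaleR_fun_def L1_cmult Linf_cmult)
    fix z assume z: "z \<in> E"
    obtain a' b1' b2' where z_eq: "z = (a', b1', b2')" by (cases z) auto
    show "y + z \<in> E"
      using y z by (simp add: y_eq z_eq E_def plus_fun_def L1_add Linf_add)
  qed
  have point: "((a, b1, b2), K * (L1_norm \<Omega> d + k1 + k2)) \<in> Q"
    if "d \<in> L1 \<Omega>" "0 \<le> k1" "0 \<le> k2" "AE x in ?M. a x \<le> d x" "AE x in ?M. b1 x \<le> k1"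
      "AE x in ?M. b2 x \<le> k2" for a b1 b2 d k1 k2
    unfolding Q_def using that by (rule perturbation_cone_zero_point[OF lin])
  have "\<exists>l. linear_form_on E l \<and> (\<forall>y r. y \<in> E \<longrightarrow> (y, r) \<in> Q \<longrightarrow> l y \<le> r)"
  proof (rule linear_form_below_convex_cone[OF E])
    show "(y + z, r + s) \<in> Q" if "(y, r) \<in> Q" "(z, s) \<in> Q" for y z r s
      using that unfolding Q_def by (rule perturbation_cone_add[OF lin K less_imp_le[OF \<gamma>]])
    show "(e *\<^sub>R y, e * r) \<in> Q" if "(y, r) \<in> Q" "e > 0" for y r e
      using that(2,1) unfolding Q_def by (rule perturbation_cone_scale[OF lin])
    show "0 \<le> r" if "(0, r) \<in> Q" for r
      using that unfolding Q_def by (rule perturbation_cone_nonneg[OF lin K less_imp_le[OF \<gamma>] pen])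
    show "\<exists>r. (y, r) \<in> Q" if yE: "y \<in> E" for y
    proof -
      obtain a b1 b2 where y: "y = (a, b1, b2)" "a \<in> L1 \<Omega>" "b1 \<in> Linf \<Omega>" "b2 \<in> Linf \<Omega>"
        using yE by (auto simp: E_def)
      obtain k1 where k1: "0 \<le> k1" "AE x in ?M. \<bar>b1 x\<bar> \<le> k1" using LinfE[OF y(3)] .
      obtain k2 where k2: "0 \<le> k2" "AE x in ?M. \<bar>b2 x\<bar> \<le> k2" using LinfE[OF y(4)] .
      have "(y, K * (L1_norm \<Omega> (\<lambda>x. \<bar>a x\<bar>) + k1 + k2)) \<in> Q"
        unfolding y(1)
      proof (rule point[OF L1_abs[OF y(2)] k1(1) k2(1)])
        show "AE x in ?M. a x \<le> \<bar>a x\<bar>" by simp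
        show "AE x in ?M. b1 x \<le> k1" using k1(2) by eventually_elim simp
        show "AE x in ?M. b2 x \<le> k2" using k2(2) by eventually_elim simp
      qed
      then show ?thesis ..
    qed
  qed
  then obtain l where l: "linear_form_on E l" and lQ: "\<forall>y r. y \<in> E \<longrightarrow> (y, r) \<in> Q \<longrightarrow> l y \<le> r"
    by (elim exE conjE) (rule that)
  have l_le: "l (a, b1, b2) \<le> r"
    if "((a, b1, b2), r) \<in> Q" "a \<in> L1 \<Omega>" "b1 \<in> Linf \<Omega>" "b2 \<in> Linf \<Omega>" for a b1 b2 r
    using lQ[rule_format, of "(a, b1, b2)" r] that by (simp add: E_def)
  have l_add: "l (\<lambda>x. a x + a' x, \<lambda>x. b1 x + b1' x, \<lambda>x. b2 x + b2' x) = l (a, b1, b2) + l (a', b1', b2')"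
    if "a \<in> L1 \<Omega>" "b1 \<in> Linf \<Omega>" "b2 \<in> Linf \<Omega>" "a' \<in> L1 \<Omega>" "b1' \<in> Linf \<Omega>" "b2' \<in> Linf \<Omega>"
    for a b1 b2 a' b1' b2'
  proof -
    have "l ((a, b1, b2) + (a', b1', b2')) = l (a, b1, b2) + l (a', b1', b2')"
      by (rule linear_form_on_add[OF l]) (simp_all add: E_def that)
    then show ?thesis by (simp add: plus_fun_def)
  qed
  have l_scale: "l (\<lambda>x. e * a x, \<lambda>x. e * b1 x, \<lambda>x. e * b2 x) = e * l (a, b1, b2)"
    if "a \<in> L1 \<Omega>" "b1 \<in> Linf \<Omega>" "b2 \<in> Linf \<Omega>" for a b1 b2 e
  proof -
    have "l (e *\<^sub>R (a, b1, b2)) = e * l (a, b1, b2)"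
      by (rule linear_form_on_scale[OF l]) (simp add: E_def that)
    then show ?thesis by (simp add: scaleR_fun_def)
  qed
  define n :: "'a \<Rightarrow> real" where "n = (\<lambda>x. 0)"
  have n1: "n \<in> L1 \<Omega>" and ni: "n \<in> Linf \<Omega>" unfolding n_def by (rule L1_zero Linf_zero)+
  have n_add: "(\<lambda>x. n x + n x) = n" and n_scale: "(\<lambda>x. e * n x) = n" for e by (simp_all add: n_def)
  define F where "F a = l (a, n, n)" for a
  define m1 where "m1 b = l (n, b, n)" for b
  define m2 where "m2 b = l (n, n, b)" for b
  have split: "l (a, b1, b2) = F a + m1 b1 + m2 b2"
    if "a \<in> L1 \<Omega>" "b1 \<in> Linf \<Omega>" "b2 \<in> Linf \<Omega>" for a b1 b2
    using l_add[OF that(1) ni ni n1 that(2) ni] l_add[OF that(1,2) ni n1 ni that(3)]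
    by (simp add: F_def m1_def m2_def n_def)
  have F_le: "F a \<le> K * L1_norm \<Omega> d"
    if "a \<in> L1 \<Omega>" "d \<in> L1 \<Omega>" "AE x in ?M. a x \<le> d x" for a d
  proof -
    have "((a, n, n), K * (L1_norm \<Omega> d + 0 + 0)) \<in> Q" using that by (intro point) (auto simp: n_def)
    from l_le[OF this that(1) ni ni] show ?thesis by (simp add: F_def)
  qed
  have m1_le: "m1 b \<le> K * k" if "b \<in> Linf \<Omega>" "0 \<le> k" "AE x in ?M. b x \<le> k" for b k
  proof -
    have "((n, b, n), K * (L1_norm \<Omega> n + k + 0)) \<in> Q" using that n1 by (intro point) (auto simp: n_def)
    from l_le[OF this n1 that(1) ni] show ?thesis by (simp add: m1_def n_def L1_norm_zero)
  qed
  have m2_le: "m2 b \<le> K * k" if "b \<in> Linf \<Omega>" "0 \<le> k" "AE x in ?M. b x \<le> k" for b k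
  proof -
    have "((n, n, b), K * (L1_norm \<Omega> n + 0 + k)) \<in> Q" using that n1 by (intro point) (auto simp: n_def)
    from l_le[OF this n1 ni that(1)] show ?thesis by (simp add: m2_def n_def L1_norm_zero)
  qed
  have F_add: "F (\<lambda>x. a x + b x) = F a + F b" if "a \<in> L1 \<Omega>" "b \<in> L1 \<Omega>" for a b
    using l_add[OF that(1) ni ni that(2) ni ni, unfolded n_add] by (simp add: F_def)
  have F_scale: "F (\<lambda>x. e * a x) = e * F a" if "a \<in> L1 \<Omega>" for a e
    using l_scale[OF that ni ni, unfolded n_scale] by (simp add: F_def)
  have m1_add: "m1 (\<lambda>x. a x + b x) = m1 a + m1 b" if "a \<in> Linf \<Omega>" "b \<in> Linf \<Omega>" for a b
    using l_add[OF n1 that(1) ni n1 that(2) ni, unfolded n_add] by (simp add: m1_def)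
  have m1_scale: "m1 (\<lambda>x. e * a x) = e * m1 a" if "a \<in> Linf \<Omega>" for a e
    using l_scale[OF n1 that ni, unfolded n_scale] by (simp add: m1_def)
  have m2_add: "m2 (\<lambda>x. a x + b x) = m2 a + m2 b" if "a \<in> Linf \<Omega>" "b \<in> Linf \<Omega>" for a b
    using l_add[OF n1 ni that(1) n1 ni that(2), unfolded n_add] by (simp add: m2_def)
  have m2_scale: "m2 (\<lambda>x. e * a x) = e * m2 a" if "a \<in> Linf \<Omega>" for a e
    using l_scale[OF n1 ni that, unfolded n_scale] by (simp add: m2_def)
  have AE_le: "AE x in ?M. b x \<le> k" if "AE x in ?M. \<bar>b x\<bar> \<le> k" for b :: "'a \<Rightarrow> real" and k
    using that by eventually_elim simp
  have m1: "m1 \<in> Linf_dual \<Omega>"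
    by (rule Linf_dualI[OF \<Omega>(1,2) m1_add m1_scale K m1_le[OF _ _ AE_le]])
  have m2: "m2 \<in> Linf_dual \<Omega>"
    by (rule Linf_dualI[OF \<Omega>(1,2) m2_add m2_scale K m2_le[OF _ _ AE_le]])
  have m1_pos: "nonneg_functional \<Omega> m1"
    unfolding nonneg_functional_def ae_le_def
  proof (intro ballI impI)
    fix g assume g: "g \<in> Linf \<Omega>" "AE x in ?M. 0 \<le> g x"
    have "AE x in ?M. - g x \<le> 0" using g(2) by eventually_elim simp
    from m1_le[OF Linf_uminus[OF g(1)] order_refl this] show "0 \<le> m1 g"
      using Linf_dual_uminus[OF m1 g(1)] by simp
  qed
  have m2_pos: "nonneg_functional \<Omega> m2"
    unfolding nonneg_functional_def ae_le_def
  proof (intro ballI impI)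
    fix g assume g: "g \<in> Linf \<Omega>" "AE x in ?M. 0 \<le> g x"
    have "AE x in ?M. - g x \<le> 0" using g(2) by eventually_elim simp
    from m2_le[OF Linf_uminus[OF g(1)] order_refl this] show "0 \<le> m2 g"
      using Linf_dual_uminus[OF m2 g(1)] by simp
  qed
  have F_neg: "F (\<lambda>x. - a x) = - F a" if "a \<in> L1 \<Omega>" for a
    using F_scale[OF that, of "- 1"] by simp
  have "\<exists>h\<in>borel_measurable ?M. (AE x in ?M. 0 \<le> h x \<and> h x \<le> K) \<and>
    (\<forall>u. integrable ?M u \<longrightarrow> F u = (\<integral>x. h x * u x \<partial>?M))"
  proof (rule positive_L1_functional_density[OF finite_measure_lebesgue_on_open[OF \<Omega>(1,3)] K])
    fix u v :: "'a \<Rightarrow> real" and e :: real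
    assume "integrable ?M u"
    then have u: "u \<in> L1 \<Omega>" by (simp add: L1_def)
    have mu: "(\<lambda>x. - u x) \<in> L1 \<Omega>" using L1_cmult[OF u, of "- 1"] by simp
    show "F (\<lambda>x. e * u x) = e * F u" using u by (rule F_scale)
    show "0 \<le> F u" if "AE x in ?M. 0 \<le> u x"
    proof -
      have "AE x in ?M. - u x \<le> 0" using that by eventually_elim simp
      from F_le[OF mu L1_zero this] show ?thesis by (simp add: F_neg[OF u] L1_norm_zero)
    qed
    have "F u \<le> K * L1_norm \<Omega> (\<lambda>x. \<bar>u x\<bar>)" by (rule F_le[OF u L1_abs[OF u]]) auto
    moreover have "F (\<lambda>x. - u x) \<le> K * L1_norm \<Omega> (\<lambda>x. \<bar>u x\<bar>)" by (rule F_le[OF mu L1_abs[OF u]]) auto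
    ultimately show "\<bar>F u\<bar> \<le> K * (\<integral>x. \<bar>u x\<bar> \<partial>?M)" by (simp add: F_neg[OF u] L1_norm_def)
    assume "integrable ?M v"
    then have v: "v \<in> L1 \<Omega>" by (simp add: L1_def)
    show "F (\<lambda>x. u x + v x) = F u + F v" using u v by (rule F_add)
  qed
  then obtain h where h: "h \<in> borel_measurable ?M" "AE x in ?M. 0 \<le> h x \<and> h x \<le> K"
    and Fh: "\<forall>u. integrable ?M u \<longrightarrow> F u = (\<integral>x. h x * u x \<partial>?M)"
    by (elim bexE conjE) (rule that)
  have "AE x in ?M. \<bar>h x\<bar> \<le> K" using h(2) by eventually_elim auto
  then have h_Linf: "h \<in> Linf \<Omega>" using h(1) by (intro LinfI)
  have h_pos: "ae_le \<Omega> (\<lambda>x. 0) h" unfolding ae_le_def using h(2) by eventually_elim simp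
  have sub: "pairing \<Omega> h v - m1 (S1 v) - m2 (S2 v) \<le> j"
    if v: "v \<in> L1 \<Omega>" and j: "TV_L1 \<Omega> \<gamma> v \<le> ereal j" for v j
  proof -
    note S1v = linear_Linf[OF lin(1) v] and S2v = linear_Linf[OF lin(2) v]
    have "((v, \<lambda>x. - S1 v x, \<lambda>x. - S2 v x), j) \<in> Q"
      unfolding Q_def
      by (rule perturbation_coneI[OF v L1_zero order_refl order_refl order_refl j])
        (simp_all add: L1_norm_zero)
    from l_le[OF this v Linf_uminus[OF S1v] Linf_uminus[OF S2v]]
    have "F v + m1 (\<lambda>x. - S1 v x) + m2 (\<lambda>x. - S2 v x) \<le> j"
      using split[OF v Linf_uminus[OF S1v] Linf_uminus[OF S2v]] by simp
    then show ?thesis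
      using Fh v Linf_dual_uminus[OF m1 S1v] Linf_dual_uminus[OF m2 S2v]
      by (simp add: pairing_def L1_def)
  qed
  have val: "m1 \<phi>1 + m2 \<phi>2 \<le> - c"
  proof -
    have "((n, \<phi>1, \<phi>2), - c) \<in> Q"
      unfolding Q_def
    proof (rule perturbation_coneI[OF L1_zero L1_zero zero_le_one order_refl order_refl TV_L1_zero])
      show "AE x in ?M. n x \<le> 0 + 0" by (simp add: n_def)
      show "AE x in ?M. \<phi>1 x \<le> 1 * \<phi>1 x - S1 (\<lambda>x. 0) x + 0"
        using linear_zero[OF lin(1)] by eventually_elim simp
      show "AE x in ?M. \<phi>2 x \<le> 1 * \<phi>2 x - S2 (\<lambda>x. 0) x + 0"
        using linear_zero[OF lin(2)] by eventually_elim simp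
    qed (simp add: L1_norm_zero)
    moreover have "F n = 0" using F_scale[OF n1, of 0] by (simp add: n_def)
    moreover from calculation(1) have "l (n, \<phi>1, \<phi>2) \<le> - c" by (rule l_le[OF _ n1 \<phi>])
    ultimately show ?thesis using split[OF n1 \<phi>] by simp
  qed
  show ?thesis
    by (intro exI[of _ h] exI[of _ m1] exI[of _ m2] conjI ballI allI impI
        h_Linf h_pos m1 m1_pos m2 m2_pos sub val)
qed

text \<open>
  Strong duality. The approximate multipliers for \<open>c = j - e\<close> are dual feasible with value at least
  \<open>j - e\<close>, and a dual solution has at least that value for every \<open>e > 0\<close>.
\<close>
theorem dual_value_ge_primal_value:
  assumes \<Omega>: "open \<Omega>" "\<Omega> \<noteq> {}" "bounded \<Omega>"
    and emb: "BV_compactly_embedded \<Omega>" and \<gamma>: "\<gamma> > 0"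
    and reg: "regular_L1_Linf \<Omega> Al" "regular_L1_Linf \<Omega> Au"
    and \<phi>: "\<phi>1 \<in> Linf \<Omega>" "\<phi>2 \<in> Linf \<Omega>"
    and primal: "primal_solution \<Omega> (TV_L1 \<Omega> \<gamma>) (pair_op Al Au) (\<phi>1, \<phi>2) u"
    and val: "TV_L1 \<Omega> \<gamma> u = ereal j"
    and dual: "dual_solution \<Omega> (TV_L1 \<Omega> \<gamma>) (pair_op Al Au) (\<phi>1, \<phi>2) l m"
  shows "j \<le> - fst m \<phi>1 - snd m \<phi>2"
proof (rule field_le_epsilon)
  fix e :: real assume "e > 0"
  let ?S2 = "\<lambda>u x. - Au u x"
  have S: "bounded_L1_Linf \<Omega> Al" "bounded_L1_Linf \<Omega> ?S2"
    using regular_bounded[OF reg(1)] bounded_L1_Linf_uminus[OF regular_bounded[OF reg(2)]] .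
  have above: "\<forall>w. relaxed_feasible \<Omega> Al ?S2 \<phi>1 \<phi>2 w (\<lambda>x. 0) 0 0 \<longrightarrow> ereal (j - e) < TV_L1 \<Omega> \<gamma> w"
  proof (intro allI impI)
    fix w assume "relaxed_feasible \<Omega> Al ?S2 \<phi>1 \<phi>2 w (\<lambda>x. 0) 0 0"
    then have "w \<in> primal_feasible \<Omega> (pair_op Al Au) (\<phi>1, \<phi>2)"
      by (simp add: relaxed_feasible_def primal_feasible_def pair_op_def ae_le_def)
    then have "ereal j \<le> TV_L1 \<Omega> \<gamma> w" using primal val by (auto simp: primal_solution_def)
    moreover have "ereal (j - e) < ereal j" using \<open>e > 0\<close> by simp
    ultimately show "ereal (j - e) < TV_L1 \<Omega> \<gamma> w" by (rule less_le_trans[rotated])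
  qed
  from approximate_dual_multipliers[OF \<Omega> emb \<gamma> S \<phi> above] obtain l' m1 m2 where
    l': "l' \<in> Linf \<Omega>" "ae_le \<Omega> (\<lambda>x. 0) l'"
    and m1: "m1 \<in> Linf_dual \<Omega>" "nonneg_functional \<Omega> m1"
    and m2: "m2 \<in> Linf_dual \<Omega>" "nonneg_functional \<Omega> m2"
    and sub: "\<forall>v\<in>L1 \<Omega>. \<forall>j. TV_L1 \<Omega> \<gamma> v \<le> ereal j \<longrightarrow> pairing \<Omega> l' v - m1 (Al v) - m2 (?S2 v) \<le> j"
    and value': "m1 \<phi>1 + m2 \<phi>2 \<le> - (j - e)"
    by (elim exE conjE) (rule that)
  let ?h = "adjoint_rep \<Omega> (pair_op Al Au) (m1, m2)"
  have h: "?h \<in> Linf \<Omega>"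
    and hp: "\<And>v. v \<in> L1 \<Omega> \<Longrightarrow> pairing \<Omega> ?h v = m1 (Al v) - m2 (Au v)"
    using adjoint_rep_pair_op[OF \<Omega>(1,3) reg, of "(m1, m2)"] m1 m2 by auto
  have pair: "pairing \<Omega> (\<lambda>x. l' x - ?h x) v = pairing \<Omega> l' v - m1 (Al v) - m2 (?S2 v)"
    if v: "v \<in> L1 \<Omega>" for v
    using pairing_diff_left[OF l'(1) h v] hp[OF v] reg(2)
      Linf_dual_uminus[OF m2(1) linear_Linf[OF _ v, of Au]]
    by (simp add: regular_L1_Linf_def)
  have "(\<lambda>x. l' x - ?h x) \<in> subdifferential \<Omega> (TV_L1 \<Omega> \<gamma>) (\<lambda>x. 0)"
    unfolding subdifferential_def mem_Collect_eq
  proof (intro conjI ballI)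
    show "(\<lambda>x. l' x - ?h x) \<in> Linf \<Omega>" using l'(1) h by (rule Linf_diff)
    show "TV_L1 \<Omega> \<gamma> (\<lambda>x. 0) = ereal (pairing \<Omega> (\<lambda>x. l' x - ?h x) (\<lambda>x. 0))"
      using TV_L1_zero[of \<Omega> \<gamma>] TV_L1_nonneg[of \<gamma> \<Omega> "\<lambda>x. 0"] \<gamma>
      by (simp add: pairing_def zero_ereal_def)
    fix v assume v: "v \<in> L1 \<Omega>"
    show "ereal (pairing \<Omega> (\<lambda>x. l' x - ?h x) v) \<le> TV_L1 \<Omega> \<gamma> v"
    proof (cases "TV_L1 \<Omega> \<gamma> v")
      case (real i)
      then show ?thesis using bspec[OF sub v] by (simp add: pair[OF v])
    next
      case MInf
      then show ?thesis using TV_L1_nonneg[of \<gamma> \<Omega> v] \<gamma> by simp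
    qed simp
  qed
  then have "(l', m1, m2) \<in> dual_feasible \<Omega> (TV_L1 \<Omega> \<gamma>) (pair_op Al Au)"
    using l' m1 m2 by (simp add: dual_feasible_def)
  then have "dual_pairing (m1, m2) (\<lambda>x. - \<phi>1 x, \<lambda>x. - \<phi>2 x) \<le> dual_pairing m (\<lambda>x. - \<phi>1 x, \<lambda>x. - \<phi>2 x)"
    using dual by (auto simp: dual_solution_def)
  moreover have "fst m \<in> Linf_dual \<Omega>" "snd m \<in> Linf_dual \<Omega>"
    using dual by (auto simp: dual_solution_def dual_feasible_def)
  ultimately have "- m1 \<phi>1 - m2 \<phi>2 \<le> - fst m \<phi>1 - snd m \<phi>2"
    using Linf_dual_uminus[OF m1(1) \<phi>(1)] Linf_dual_uminus[OF m2(1) \<phi>(2)]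
      Linf_dual_uminus[OF _ \<phi>(1), of "fst m"] Linf_dual_uminus[OF _ \<phi>(2), of "snd m"]
    by (simp add: dual_pairing_def)
  then show "j \<le> - fst m \<phi>1 - snd m \<phi>2 + e" using value' by simp
qed

section \<open>Convergence to the exact solution\<close>

text \<open>
  For a non-negative \<open>v\<close> the chain \<open>fl \<le> Au v\<close>, \<open>Al v \<le> A v \<le> Au v\<close>, \<open>Al v \<le> fu\<close> traps \<open>A v\<close> in the interval
  \<open>[fl, fu]\<close> enlarged by \<open>Au v - Al v\<close>, and the same interval contains \<open>f\<close>.
\<close>
lemma feasible_residual_bound:
  assumes A: "op_le \<Omega> Al A" "op_le \<Omega> A Au" and lin: "linear_L1_Linf \<Omega> Al" "linear_L1_Linf \<Omega> Au"
    and f: "ae_le \<Omega> fl f" "ae_le \<Omega> f fu" "fl \<in> Linf \<Omega>" "fu \<in> Linf \<Omega>"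
    and d: "Linf_norm \<Omega> (\<lambda>x. fu x - fl x) \<le> ereal d"
    and e: "op_norm \<Omega> (\<lambda>v x. Au v x - Al v x) \<le> ereal e"
    and v: "v \<in> primal_feasible \<Omega> (pair_op Al Au) (fu, \<lambda>x. - fl x)"
  shows "AE x in lebesgue_on \<Omega>. \<bar>A v x - f x\<bar> \<le> d + e * L1_norm \<Omega> v"
proof -
  have v1: "v \<in> L1 \<Omega>" and v0: "ae_le \<Omega> (\<lambda>x. 0) v"
    and vl: "AE x in lebesgue_on \<Omega>. Al v x \<le> fu x" and vu: "AE x in lebesgue_on \<Omega>. fl x \<le> Au v x"
    using v by (auto simp: primal_feasible_def pair_op_def ae_le_def)
  have Al: "AE x in lebesgue_on \<Omega>. Al v x \<le> A v x" and Au: "AE x in lebesgue_on \<Omega>. A v x \<le> Au v x"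
    using A v1 v0 by (auto simp: op_le_def ae_le_def)
  have gap: "AE x in lebesgue_on \<Omega>. \<bar>Au v x - Al v x\<bar> \<le> e * L1_norm \<Omega> v"
    by (rule op_norm_bound[OF linear_op_diff[OF lin(2,1)] e v1])
  have "AE x in lebesgue_on \<Omega>. \<bar>fu x - fl x\<bar> \<le> d"
    using d Linf_norm_le_iff[OF Linf_measurable[OF Linf_diff[OF f(4,3)]]] by blast
  with Al Au gap vl vu f(1,2)[unfolded ae_le_def] show ?thesis
    by eventually_elim linarith
qed

lemma L1_norm_sub_cong:
  assumes "v \<in> L1 \<Omega>" "w \<in> L1 \<Omega>" "w' \<in> L1 \<Omega>" "ae_eq \<Omega> w w'"
  shows "L1_norm \<Omega> (\<lambda>x. v x - w x) = L1_norm \<Omega> (\<lambda>x. v x - w' x)"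
  using assms by (intro L1_norm_cong L1_diff) (auto simp: ae_eq_def elim: eventually_mono)

text \<open>
  Injectivity and compactness give a stable inverse on sublevel sets of the energy: every subsequence
  has a further subsequence with an \<open>L\<^sup>1\<close> limit, and each such limit has the same image under \<open>A\<close> as \<open>w\<close>.
\<close>
lemma residual_tendsto_imp_L1_tendsto:
  assumes emb: "BV_compactly_embedded \<Omega>" and \<gamma>: "\<gamma> > 0"
    and A: "bounded_L1_Linf \<Omega> A" "injective_L1 \<Omega> A"
    and w: "w \<in> L1 \<Omega>" "ae_eq \<Omega> (A w) f"
    and v: "\<And>n. v n \<in> L1 \<Omega>" "\<And>n. TV_L1 \<Omega> \<gamma> (v n) \<le> ereal c"
    and residual: "\<And>e. e > 0 \<Longrightarrow>
      \<forall>\<^sub>F n in sequentially. AE x in lebesgue_on \<Omega>. \<bar>A (v n) x - f x\<bar> \<le> e"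
  shows "(\<lambda>n. L1_norm \<Omega> (\<lambda>x. v n x - w x)) \<longlonglongrightarrow> 0"
proof (rule ccontr)
  assume "\<not> ?thesis"
  then obtain e where e: "e > 0" "\<not> (\<forall>\<^sub>F n in sequentially. dist (L1_norm \<Omega> (\<lambda>x. v n x - w x)) 0 < e)"
    unfolding tendsto_iff by blast
  from not_eventually_sequentiallyD[OF e(2)] obtain r :: "nat \<Rightarrow> nat" where r: "strict_mono r"
    and far: "\<And>k. e \<le> L1_norm \<Omega> (\<lambda>x. v (r k) x - w x)"
    by (auto simp: L1_norm_nonneg not_less)
  obtain s w' where s: "strict_mono (s :: nat \<Rightarrow> nat)" and w': "w' \<in> L1 \<Omega>"
    and conv: "(\<lambda>k. L1_norm \<Omega> (\<lambda>x. v (r (s k)) x - w' x)) \<longlonglongrightarrow> 0"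
    and "TV_L1 \<Omega> \<gamma> w' \<le> ereal c"
    using TV_L1_sublevel_compact[OF emb \<gamma> v(1) v(2)] .
  have rs: "strict_mono (\<lambda>k. r (s k))" using r s by (simp add: strict_mono_def)
  have res: "\<forall>\<^sub>F k in sequentially. AE x in lebesgue_on \<Omega>. \<bar>A (v (r (s k))) x - f x\<bar> \<le> e'"
    if "e' > 0" for e'
    using eventually_subseq[OF rs residual[OF that]] .
  have "AE x in lebesgue_on \<Omega>. A w' x \<le> f x"
  proof (rule bounded_op_limit_le[OF A(1) v(1) w' conv])
    fix e' :: real assume "e' > 0"
    from res[OF this]
    show "\<forall>\<^sub>F k in sequentially. AE x in lebesgue_on \<Omega>. A (v (r (s k))) x \<le> f x + e'"
    proof (rule eventually_mono)
      fix k assume "AE x in lebesgue_on \<Omega>. \<bar>A (v (r (s k))) x - f x\<bar> \<le> e'"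
      then show "AE x in lebesgue_on \<Omega>. A (v (r (s k))) x \<le> f x + e'"
        by eventually_elim linarith
    qed
  qed
  moreover have "AE x in lebesgue_on \<Omega>. - A w' x \<le> - f x"
  proof (rule bounded_op_limit_le[OF bounded_L1_Linf_uminus[OF A(1)] v(1) w' conv])
    fix e' :: real assume "e' > 0"
    from res[OF this]
    show "\<forall>\<^sub>F k in sequentially. AE x in lebesgue_on \<Omega>. - A (v (r (s k))) x \<le> - f x + e'"
    proof (rule eventually_mono)
      fix k assume "AE x in lebesgue_on \<Omega>. \<bar>A (v (r (s k))) x - f x\<bar> \<le> e'"
      then show "AE x in lebesgue_on \<Omega>. - A (v (r (s k))) x \<le> - f x + e'"
        by eventually_elim linarith
    qed
  qed
  moreover note w(2)[unfolded ae_eq_def]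
  ultimately have "ae_eq \<Omega> (A w) (A w')" unfolding ae_eq_def by eventually_elim linarith
  then have "ae_eq \<Omega> w w'" using A(2) w(1) w' by (simp add: injective_L1_def)
  then have "e \<le> L1_norm \<Omega> (\<lambda>x. v (r (s k)) x - w' x)" for k
    using far[of "s k"] L1_norm_sub_cong[OF v(1) w(1) w'] by simp
  then have "e \<le> 0" using conv by (intro LIMSEQ_le_const) auto
  then show False using e(1) by simp
qed

lemma TV_L1_eventually_gt:
  assumes v: "\<And>n. v n \<in> L1 \<Omega>" and w: "w \<in> L1 \<Omega>"
    and conv: "(\<lambda>n. L1_norm \<Omega> (\<lambda>x. v n x - w x)) \<longlonglongrightarrow> 0"
    and b: "ereal b < TV_L1 \<Omega> \<gamma> w"
  shows "\<forall>\<^sub>F n in sequentially. ereal b < TV_L1 \<Omega> \<gamma> (v n)"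
proof (rule ccontr)
  assume "\<not> ?thesis"
  from not_eventually_sequentiallyD[OF this] obtain r :: "nat \<Rightarrow> nat" where r: "strict_mono r"
    and le: "\<And>k. TV_L1 \<Omega> \<gamma> (v (r k)) \<le> ereal b" by (auto simp: not_less)
  from LIMSEQ_subseq_LIMSEQ[OF conv r]
  have "(\<lambda>k. L1_norm \<Omega> (\<lambda>x. v (r k) x - w x)) \<longlonglongrightarrow> 0" by (simp add: o_def)
  from TV_L1_lsc[OF v w this le tendsto_const] show False using b by simp
qed

section \<open>Compactness of the near-minimisers\<close>

text \<open>
  The first bound restates the Bregman-type condition of the set; with the cap \<open>C\<close> on the pairing it
  becomes a bound by a constant, so that the set lies in a compact sublevel set of the energy.
\<close>
lemma near_minimisers_TV_L1_le:
  assumes un: "un \<in> L1 \<Omega>" and p: "p \<in> subdifferential \<Omega> (TV_L1 \<Omega> \<gamma>) un"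
    and v: "v \<in> near_minimisers \<Omega> (TV_L1 \<Omega> \<gamma>) B \<phi> un p \<epsilon> C"
  shows "TV_L1 \<Omega> \<gamma> v \<le> ereal (\<epsilon> + pairing \<Omega> p v)"
    and "TV_L1 \<Omega> \<gamma> v \<le> ereal (\<epsilon> + C + pairing \<Omega> p un)"
proof -
  have v1: "v \<in> L1 \<Omega>" using v by (simp add: near_minimisers_def primal_feasible_def)
  have pL: "p \<in> Linf \<Omega>" using p by (simp add: subdifferential_def)
  have "TV_L1 \<Omega> \<gamma> v - ereal (pairing \<Omega> p v) \<le> ereal \<epsilon>" using v by (simp add: near_minimisers_def)
  then show *: "TV_L1 \<Omega> \<gamma> v \<le> ereal (\<epsilon> + pairing \<Omega> p v)"
    by (cases "TV_L1 \<Omega> \<gamma> v") auto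
  have "pairing \<Omega> p v - pairing \<Omega> p un \<le> C"
    using v pairing_diff[OF pL v1 un] by (simp add: near_minimisers_def)
  then have "ereal (\<epsilon> + pairing \<Omega> p v) \<le> ereal (\<epsilon> + C + pairing \<Omega> p un)" by simp
  with * show "TV_L1 \<Omega> \<gamma> v \<le> ereal (\<epsilon> + C + pairing \<Omega> p un)" by (rule order_trans)
qed

text \<open>
  Each defining condition is closed under \<open>L\<^sup>1\<close> convergence. In the Bregman-type condition the right-hand
  side \<open>\<epsilon> + pairing \<Omega> p v\<close> varies along the sequence, and for this the lower semicontinuity of the
  energy is stated with converging bounds.
\<close>
lemma near_minimisers_L1_compact:
  assumes emb: "BV_compactly_embedded \<Omega>" and \<gamma>: "\<gamma> > 0"
    and reg: "regular_L1_Linf \<Omega> Al" "regular_L1_Linf \<Omega> Au"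
    and un: "un \<in> L1 \<Omega>" and p: "p \<in> subdifferential \<Omega> (TV_L1 \<Omega> \<gamma>) un"
    and v: "\<And>k. v k \<in> near_minimisers \<Omega> (TV_L1 \<Omega> \<gamma>) (pair_op Al Au) \<phi> un p \<epsilon> C"
  obtains r w where "strict_mono (r :: nat \<Rightarrow> nat)"
    "w \<in> near_minimisers \<Omega> (TV_L1 \<Omega> \<gamma>) (pair_op Al Au) \<phi> un p \<epsilon> C"
    "(\<lambda>k. L1_norm \<Omega> (\<lambda>x. v (r k) x - w x)) \<longlonglongrightarrow> 0"
proof -
  have v1: "v k \<in> L1 \<Omega>" for k using v[of k] by (simp add: near_minimisers_def primal_feasible_def)
  have pL: "p \<in> Linf \<Omega>" using p by (simp add: subdifferential_def)
  obtain r w where r: "strict_mono (r :: nat \<Rightarrow> nat)" and w: "w \<in> L1 \<Omega>"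
    and conv: "(\<lambda>k. L1_norm \<Omega> (\<lambda>x. v (r k) x - w x)) \<longlonglongrightarrow> 0"
    and "TV_L1 \<Omega> \<gamma> w \<le> ereal (\<epsilon> + C + pairing \<Omega> p un)"
    using TV_L1_sublevel_compact[OF emb \<gamma> v1 near_minimisers_TV_L1_le(2)[OF un p v]] .
  have lim: "(\<lambda>k. pairing \<Omega> p (v (r k))) \<longlonglongrightarrow> pairing \<Omega> p w"
    by (rule L1_norm_tendsto_imp_pairing_tendsto[OF pL v1 w conv])
  have feas: "AE x in lebesgue_on \<Omega>. 0 \<le> v (r k) x" "AE x in lebesgue_on \<Omega>. Al (v (r k)) x \<le> fst \<phi> x"
    "AE x in lebesgue_on \<Omega>. - Au (v (r k)) x \<le> snd \<phi> x" for k
    using v[of "r k"] by (simp_all add: near_minimisers_def primal_feasible_def pair_op_def ae_le_def)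
  have "AE x in lebesgue_on \<Omega>. 0 \<le> w x"
    by (rule L1_limit_nonneg[OF v1 L1_zero w conv]) (simp_all add: L1_norm_zero feas(1))
  moreover have "AE x in lebesgue_on \<Omega>. Al w x \<le> fst \<phi> x"
  proof (rule bounded_op_limit_le[OF regular_bounded[OF reg(1)] v1 w conv])
    fix e :: real assume "e > 0"
    have "AE x in lebesgue_on \<Omega>. Al (v (r k)) x \<le> fst \<phi> x + e" for k
      using feas(2)[of k] by eventually_elim (use \<open>e > 0\<close> in simp)
    then show "\<forall>\<^sub>F k in sequentially. AE x in lebesgue_on \<Omega>. Al (v (r k)) x \<le> fst \<phi> x + e" by simp
  qed
  moreover have "AE x in lebesgue_on \<Omega>. - Au w x \<le> snd \<phi> x"
  proof (rule bounded_op_limit_le[OF bounded_L1_Linf_uminus[OF regular_bounded[OF reg(2)]] v1 w conv])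
    fix e :: real assume "e > 0"
    have "AE x in lebesgue_on \<Omega>. - Au (v (r k)) x \<le> snd \<phi> x + e" for k
      using feas(3)[of k] by eventually_elim (use \<open>e > 0\<close> in simp)
    then show "\<forall>\<^sub>F k in sequentially. AE x in lebesgue_on \<Omega>. - Au (v (r k)) x \<le> snd \<phi> x + e" by simp
  qed
  ultimately have w_feas: "w \<in> primal_feasible \<Omega> (pair_op Al Au) \<phi>"
    using w by (simp add: primal_feasible_def pair_op_def ae_le_def)
  have "TV_L1 \<Omega> \<gamma> w \<le> ereal (\<epsilon> + pairing \<Omega> p w)"
    by (rule TV_L1_lsc[OF v1 w conv near_minimisers_TV_L1_le(1)[OF un p v]])
      (intro tendsto_intros lim)
  then have gap: "TV_L1 \<Omega> \<gamma> w - ereal (pairing \<Omega> p w) \<le> ereal \<epsilon>"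
    by (cases "TV_L1 \<Omega> \<gamma> w") auto
  have "pairing \<Omega> p (v (r k)) - pairing \<Omega> p un \<le> C" for k
    using v[of "r k"] pairing_diff[OF pL v1 un] by (simp add: near_minimisers_def)
  then have "pairing \<Omega> p w - pairing \<Omega> p un \<le> C"
    by (intro LIMSEQ_le_const2[OF tendsto_diff[OF lim tendsto_const]]) auto
  then have "pairing \<Omega> p (\<lambda>x. w x - un x) \<le> C" by (simp add: pairing_diff[OF pL w un])
  then have "w \<in> near_minimisers \<Omega> (TV_L1 \<Omega> \<gamma>) (pair_op Al Au) \<phi> un p \<epsilon> C"
    using w_feas gap by (simp add: near_minimisers_def)
  with r show thesis using conv by (rule that)
qed

lemma indicator_Linf: "region \<Omega> \<omega> \<Longrightarrow> (indicator \<omega> :: 'a::euclidean_space \<Rightarrow> real) \<in> Linf \<Omega>"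
  unfolding region_def
  by (intro LinfI[of _ _ 1] measurable_restrict_space1 borel_measurable_indicator)
    (auto simp: indicator_def)

lemma pairing_commute: "pairing \<Omega> p u = pairing \<Omega> u p"
  by (simp add: pairing_def mult.commute)

lemma near_minimisers_mean_compact:
  assumes emb: "BV_compactly_embedded \<Omega>" and \<gamma>: "\<gamma> > 0"
    and reg: "regular_L1_Linf \<Omega> Al" "regular_L1_Linf \<Omega> Au"
    and un: "un \<in> L1 \<Omega>" and p: "p \<in> subdifferential \<Omega> (TV_L1 \<Omega> \<gamma>) un" and q: "q \<in> Linf \<Omega>"
  shows "compact ((\<lambda>v. pairing \<Omega> v q) ` near_minimisers \<Omega> (TV_L1 \<Omega> \<gamma>) (pair_op Al Au) \<phi> un p \<epsilon> C)"
    (is "compact (?g ` ?M)")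
  unfolding compact_eq_seq_compact_metric seq_compact_def
proof (intro allI impI)
  fix y :: "nat \<Rightarrow> real" assume "\<forall>k. y k \<in> ?g ` ?M"
  then have "\<forall>k. \<exists>v. v \<in> ?M \<and> y k = ?g v" by auto
  then obtain v where v: "\<And>k. v k \<in> ?M" and y: "\<And>k. y k = ?g (v k)" by metis
  obtain r w where r: "strict_mono (r :: nat \<Rightarrow> nat)" and w: "w \<in> ?M"
    and conv: "(\<lambda>k. L1_norm \<Omega> (\<lambda>x. v (r k) x - w x)) \<longlonglongrightarrow> 0"
    using near_minimisers_L1_compact[OF emb \<gamma> reg un p v] .
  have L: "v k \<in> L1 \<Omega>" "w \<in> L1 \<Omega>" for k
    using v[of k] w by (auto simp: near_minimisers_def primal_feasible_def)
  have "(\<lambda>k. pairing \<Omega> q (v (r k))) \<longlonglongrightarrow> pairing \<Omega> q w"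
    by (rule L1_norm_tendsto_imp_pairing_tendsto[OF q L(1) L(2) conv])
  then have "(y \<circ> r) \<longlonglongrightarrow> ?g w" by (simp add: o_def y pairing_commute[of \<Omega> q])
  then show "\<exists>l\<in>?g ` ?M. \<exists>r. strict_mono r \<and> (y \<circ> r) \<longlonglongrightarrow> l" using r w by blast
qed

text \<open>
  The least element in the definition of \<open>lower_value\<close> exists because the set of pairings is compact.
\<close>
lemma lower_value_attained:
  assumes "compact ((\<lambda>u. pairing \<Omega> u (indicator \<omega>)) ` M)" "M \<noteq> {}"
  shows "\<exists>v\<in>M. lower_value \<Omega> M \<omega> = region_mean \<Omega> v \<omega>"
    and "v \<in> M \<Longrightarrow> lower_value \<Omega> M \<omega> \<le> region_mean \<Omega> v \<omega>"
proof -
  let ?Y = "(\<lambda>u. pairing \<Omega> u (indicator \<omega>)) ` M"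
  obtain y where y: "y \<in> ?Y" "\<And>z. z \<in> ?Y \<Longrightarrow> y \<le> z"
    using compact_attains_inf[OF assms(1)] assms(2) by blast
  then have *: "lower_value \<Omega> M \<omega> = 1 / measure lebesgue \<omega> * y"
    unfolding lower_value_def by (subst Least_equality) auto
  show "\<exists>v\<in>M. lower_value \<Omega> M \<omega> = region_mean \<Omega> v \<omega>"
    using y(1) * by (auto simp: region_mean_def)
  show "lower_value \<Omega> M \<omega> \<le> region_mean \<Omega> v \<omega>" if "v \<in> M"
    unfolding * region_mean_def using that by (intro mult_left_mono y(2)) auto
qed

lemma upper_value_attained:
  assumes "compact ((\<lambda>u. pairing \<Omega> u (indicator \<omega>)) ` M)" "M \<noteq> {}"
  shows "\<exists>v\<in>M. upper_value \<Omega> M \<omega> = region_mean \<Omega> v \<omega>"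
    and "v \<in> M \<Longrightarrow> region_mean \<Omega> v \<omega> \<le> upper_value \<Omega> M \<omega>"
proof -
  let ?Y = "(\<lambda>u. pairing \<Omega> u (indicator \<omega>)) ` M"
  obtain y where y: "y \<in> ?Y" "\<And>z. z \<in> ?Y \<Longrightarrow> z \<le> y"
    using compact_attains_sup[OF assms(1)] assms(2) by blast
  then have *: "upper_value \<Omega> M \<omega> = 1 / measure lebesgue \<omega> * y"
    unfolding upper_value_def by (subst Greatest_equality) auto
  show "\<exists>v\<in>M. upper_value \<Omega> M \<omega> = region_mean \<Omega> v \<omega>"
    using y(1) * by (auto simp: region_mean_def)
  show "region_mean \<Omega> v \<omega> \<le> upper_value \<Omega> M \<omega>" if "v \<in> M"
    unfolding * region_mean_def using that by (intro mult_left_mono y(2)) auto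
qed

lemma region_mean_has_value:
  assumes \<Omega>: "\<Omega> \<in> sets lebesgue" and \<omega>: "region \<Omega> \<omega>" and u: "u \<in> L1 \<Omega>" and c: "has_value_on \<omega> u c"
  shows "region_mean \<Omega> u \<omega> = c"
proof -
  have w: "\<omega> \<in> sets lebesgue" "\<omega> \<subseteq> \<Omega>" "measure lebesgue \<omega> > 0" using \<omega> by (auto simp: region_def)
  have "AE x in lebesgue. x \<in> \<omega> \<longrightarrow> u x = c"
    using c w(1) by (simp add: has_value_on_def AE_restrict_space_iff)
  then have "AE x in lebesgue. x \<in> \<Omega> \<longrightarrow> u x * indicator \<omega> x = c * indicator \<omega> x"
    by eventually_elim (auto simp: indicator_def)
  then have eq: "AE x in lebesgue_on \<Omega>. u x * indicator \<omega> x = c * indicator \<omega> x"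
    using \<Omega> by (simp add: AE_restrict_space_iff)
  have [measurable]: "(indicator \<omega> :: 'a \<Rightarrow> real) \<in> borel_measurable (lebesgue_on \<Omega>)"
    "u \<in> borel_measurable (lebesgue_on \<Omega>)"
    using indicator_Linf[OF \<omega>] u by (auto simp: Linf_iff L1_def)
  have "pairing \<Omega> u (indicator \<omega>) = (\<integral>x. c * indicator \<omega> x \<partial>lebesgue_on \<Omega>)"
    unfolding pairing_def using eq by (intro integral_cong_AE) auto
  also have "\<dots> = c * measure (lebesgue_on \<Omega>) \<omega>" using w by (simp add: Int_absorb2)
  also have "measure (lebesgue_on \<Omega>) \<omega> = measure lebesgue \<omega>"
    using \<Omega> w by (intro measure_restrict_space) auto
  finally show ?thesis using w(3) by (simp add: region_mean_def)
qed

lemma region_mean_diff_le: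
  assumes \<omega>: "region \<Omega> \<omega>" and \<kappa>: "0 < \<kappa>" "\<kappa> \<le> measure lebesgue \<omega>"
    and uv: "u \<in> L1 \<Omega>" "v \<in> L1 \<Omega>" and w: "w \<in> L1 \<Omega>"
  shows "\<bar>region_mean \<Omega> u \<omega> - region_mean \<Omega> v \<omega>\<bar>
    \<le> (L1_norm \<Omega> (\<lambda>x. u x - w x) + L1_norm \<Omega> (\<lambda>x. v x - w x)) / \<kappa>"
proof -
  have m: "measure lebesgue \<omega> > 0" using \<kappa> by simp
  have le: "\<bar>pairing \<Omega> (\<lambda>x. z x - w x) (indicator \<omega>)\<bar> \<le> L1_norm \<Omega> (\<lambda>x. z x - w x)" if "z \<in> L1 \<Omega>" for z
  proof -
    have int: "integrable (lebesgue_on \<Omega>) (\<lambda>x. (z x - w x) * indicator \<omega> x)"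
      using Linf_L1_integrable[OF indicator_Linf[OF \<omega>] L1_diff[OF that w]] by (simp add: mult.commute)
    have "integrable (lebesgue_on \<Omega>) (\<lambda>x. \<bar>z x - w x\<bar>)"
      using L1_abs[OF L1_diff[OF that w]] by (simp add: L1_def)
    from integral_mono[OF integrable_abs[OF int] this] integral_abs_bound[of "lebesgue_on \<Omega>"
        "\<lambda>x. (z x - w x) * indicator \<omega> x"]
    show ?thesis
      unfolding pairing_def L1_norm_def by (fastforce simp: abs_mult indicator_def)
  qed
  have diff: "pairing \<Omega> (\<lambda>x. z x - w x) (indicator \<omega>)
      = pairing \<Omega> z (indicator \<omega>) - pairing \<Omega> w (indicator \<omega>)" if "z \<in> L1 \<Omega>" for z
    using pairing_diff[OF indicator_Linf[OF \<omega>] that w] by (simp add: pairing_commute[of _ "indicator \<omega>"])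
  let ?s = "L1_norm \<Omega> (\<lambda>x. u x - w x) + L1_norm \<Omega> (\<lambda>x. v x - w x)"
  have "\<bar>pairing \<Omega> u (indicator \<omega>) - pairing \<Omega> v (indicator \<omega>)\<bar> \<le> ?s"
    using le[OF uv(1)] le[OF uv(2)] unfolding diff[OF uv(1)] diff[OF uv(2)] by linarith
  then have "\<bar>region_mean \<Omega> u \<omega> - region_mean \<Omega> v \<omega>\<bar> \<le> ?s / measure lebesgue \<omega>"
    using m unfolding region_mean_def
    by (simp add: divide_right_mono flip: diff_divide_distrib)
  also have "\<dots> \<le> ?s / \<kappa>"
    using \<kappa> by (intro divide_left_mono add_nonneg_nonneg L1_norm_nonneg mult_pos_pos m) auto
  finally show ?thesis .
qed

theorem theorem26:
  fixes \<Omega> :: "'a::euclidean_space set"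
    and A :: "'a operator" and f :: "'a \<Rightarrow> real"
    and Al Au :: "nat \<Rightarrow> 'a operator" and fl fu :: "nat \<Rightarrow> 'a \<Rightarrow> real"
    and B :: "nat \<Rightarrow> ('a \<Rightarrow> real) \<Rightarrow> ('a \<Rightarrow> real) \<times> ('a \<Rightarrow> real)"
    and \<phi> :: "nat \<Rightarrow> ('a \<Rightarrow> real) \<times> ('a \<Rightarrow> real)"
    and J :: "('a \<Rightarrow> real) \<Rightarrow> ereal"
    and u p lam :: "nat \<Rightarrow> 'a \<Rightarrow> real" and mu :: "nat \<Rightarrow> 'a functional \<times> 'a functional"
    and ubar :: "'a \<Rightarrow> real" and M :: "nat \<Rightarrow> ('a \<Rightarrow> real) set" and \<omega> :: "nat \<Rightarrow> 'a set"
    and \<gamma> \<epsilon> C :: real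
  assumes domain: "open \<Omega>" "connected \<Omega>" "\<Omega> \<noteq> {}" "bounded \<Omega>"
    and domain_regular: "BV_compactly_embedded \<Omega>"
    and A_linear: "linear_L1_Linf \<Omega> A"
    and f_Linf: "f \<in> Linf \<Omega>"
    and solvable: "\<exists>v\<in>L1 \<Omega>. ae_le \<Omega> (\<lambda>x. 0) v \<and> ae_eq \<Omega> (A v) f \<and> J v < \<infinity>"
    and f_bounds_Linf: "\<And>n. fl n \<in> Linf \<Omega>" "\<And>n. fu n \<in> Linf \<Omega>"
    and f_bounds: "\<And>n. ae_le \<Omega> (fl n) f" "\<And>n. ae_le \<Omega> f (fu n)"
    and f_bounds_mono: "\<And>n. ae_le \<Omega> (fl n) (fl (Suc n))" "\<And>n. ae_le \<Omega> (fu (Suc n)) (fu n)"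
    and A_bounds_regular: "\<And>n. regular_L1_Linf \<Omega> (Al n)" "\<And>n. regular_L1_Linf \<Omega> (Au n)"
    and A_bounds: "\<And>n. op_le \<Omega> (Al n) A" "\<And>n. op_le \<Omega> A (Au n)"
    and A_bounds_mono: "\<And>n. op_le \<Omega> (Al n) (Al (Suc n))" "\<And>n. op_le \<Omega> (Au (Suc n)) (Au n)"
    and f_bounds_conv: "(\<lambda>n. Linf_norm \<Omega> (\<lambda>x. fu n x - fl n x)) \<longlonglongrightarrow> 0"
    and A_bounds_conv: "(\<lambda>n. op_norm \<Omega> (\<lambda>v x. Au n v x - Al n v x)) \<longlonglongrightarrow> 0"
    and B_def: "\<And>n. B n = pair_op (Al n) (Au n)"
    and \<phi>_def: "\<And>n. \<phi> n = (fu n, \<lambda>x. - fl n x)"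
    and \<gamma>_pos: "\<gamma> > 0"
    and J_def: "J = TV_L1 \<Omega> \<gamma>"
    and u_min: "\<And>n. primal_solution \<Omega> J (B n) (\<phi> n) (u n)"
    and dual_sol: "\<And>n. dual_solution \<Omega> J (B n) (\<phi> n) (lam n) (mu n)"
    and p_def: "\<And>n. p n = (\<lambda>x. lam n x - adjoint_rep \<Omega> (B n) (mu n) x)"
    and p_subgradient: "\<And>n. p n \<in> subdifferential \<Omega> J (u n)"
    and \<epsilon>_pos: "\<epsilon> > 0" and C_pos: "C > 0"
    and M_def: "\<And>n. M n = near_minimisers \<Omega> J (B n) (\<phi> n) (u n) (p n) \<epsilon> C"
    and A_injective: "injective_L1 \<Omega> A"
    and ubar: "ubar \<in> L1 \<Omega>" "ae_eq \<Omega> (A ubar) f"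
    and ubar_pc: "piecewise_constant \<Omega> ubar"
    and \<omega>_region: "\<And>n. region \<Omega> (\<omega> n)"
    and \<omega>_const: "\<And>n. \<exists>c. has_value_on (\<omega> n) (u n) c"
  shows "((\<exists>\<kappa>>0. \<forall>\<^sub>F n in sequentially. \<kappa> \<le> measure lebesgue (\<omega> n)) \<longrightarrow>
            (\<lambda>n. upper_value \<Omega> (M n) (\<omega> n) - lower_value \<Omega> (M n) (\<omega> n)) \<longlonglongrightarrow> 0) \<and>
         (\<forall>\<^sub>F n in sequentially.
            (\<forall>c. has_value_on (\<omega> n) ubar c \<longrightarrow>
                 lower_value \<Omega> (M n) (\<omega> n) \<le> c \<and> c \<le> upper_value \<Omega> (M n) (\<omega> n)) \<and>
            lower_value \<Omega> (M n) (\<omega> n) \<le> region_mean \<Omega> ubar (\<omega> n) \<and>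
            region_mean \<Omega> ubar (\<omega> n) \<le> upper_value \<Omega> (M n) (\<omega> n))"
proof -
  let ?M = "lebesgue_on \<Omega>"
  have \<Omega>: "open \<Omega>" "\<Omega> \<noteq> {}" "bounded \<Omega>" using domain by auto
  have lin: "linear_L1_Linf \<Omega> (Al n)" "linear_L1_Linf \<Omega> (Au n)" for n
    using A_bounds_regular by (auto simp: regular_L1_Linf_def)
  have A_bounded: "bounded_L1_Linf \<Omega> A"
    by (rule bounded_of_regular_minorant[OF A_linear A_bounds_regular(1) A_bounds(1)])
  obtain v where v: "v \<in> L1 \<Omega>" "ae_le \<Omega> (\<lambda>x. 0) v" "ae_eq \<Omega> (A v) f" "TV_L1 \<Omega> \<gamma> v < \<infinity>"
    using solvable unfolding J_def by blast
  have "ae_eq \<Omega> (A ubar) (A v)"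
    using ubar(2) v(3) unfolding ae_eq_def by eventually_elim simp
  then have ubar_v: "ae_eq \<Omega> ubar v" using A_injective ubar(1) v(1) by (simp add: injective_L1_def)
  have ubar_nonneg: "AE x in ?M. 0 \<le> ubar x"
    using ubar_v v(2) unfolding ae_eq_def ae_le_def by eventually_elim simp
  have "TV_L1 \<Omega> \<gamma> ubar < \<infinity>" using TV_L1_cong[OF ubar(1) v(1) ubar_v] v(4) by simp
  moreover have "0 \<le> TV_L1 \<Omega> \<gamma> ubar" using \<gamma>_pos by (intro TV_L1_nonneg) simp
  ultimately obtain jbar where jbar: "TV_L1 \<Omega> \<gamma> ubar = ereal jbar"
    by (cases "TV_L1 \<Omega> \<gamma> ubar") auto
  have ubar_bounds: "AE x in ?M. Al n ubar x \<le> fu n x" "AE x in ?M. - Au n ubar x \<le> - fl n x" for n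
  proof -
    have "AE x in ?M. Al n ubar x \<le> A ubar x" "AE x in ?M. A ubar x \<le> Au n ubar x"
      using A_bounds[of n] ubar(1) ubar_nonneg by (auto simp: op_le_def ae_le_def)
    note * = this ubar(2)[unfolded ae_eq_def] f_bounds[of n, unfolded ae_le_def]
    show "AE x in ?M. Al n ubar x \<le> fu n x" using *(1,3,5) by eventually_elim simp
    show "AE x in ?M. - Au n ubar x \<le> - fl n x" using *(2,3,4) by eventually_elim simp
  qed
  have ubar_feasible: "ubar \<in> primal_feasible \<Omega> (B n) (\<phi> n)" for n
    using ubar(1) ubar_nonneg ubar_bounds[of n]
    by (simp add: primal_feasible_def B_def \<phi>_def pair_op_def ae_le_def)
  have u_feasible: "u n \<in> primal_feasible \<Omega> (B n) (\<phi> n)" for n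
    using u_min[of n] by (simp add: primal_solution_def)
  have u_L1: "u n \<in> L1 \<Omega>" for n using u_feasible[of n] by (simp add: primal_feasible_def)
  have p_Linf: "p n \<in> Linf \<Omega>" for n using p_subgradient[of n] by (simp add: subdifferential_def)
  define j where "j n = pairing \<Omega> (p n) (u n)" for n
  have J_u: "TV_L1 \<Omega> \<gamma> (u n) = ereal (j n)" for n
    using p_subgradient[of n] by (simp add: subdifferential_def J_def j_def)
  have "TV_L1 \<Omega> \<gamma> (u n) \<le> TV_L1 \<Omega> \<gamma> ubar" for n
    using u_min[of n] ubar_feasible[of n] by (simp add: primal_solution_def J_def)
  then have j_le: "j n \<le> jbar" for n by (simp add: J_u jbar)

  \<comment> \<open>Used for the minimisers and, with a larger energy bound, for the points of the sets \<open>M n\<close>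
    that attain the extreme means.\<close>
  have stable: "(\<lambda>n. L1_norm \<Omega> (\<lambda>x. w n x - ubar x)) \<longlonglongrightarrow> 0"
    if w: "\<And>n. w n \<in> primal_feasible \<Omega> (B n) (\<phi> n)" and Jw: "\<And>n. TV_L1 \<Omega> \<gamma> (w n) \<le> ereal c"
    for w c
  proof (rule residual_tendsto_imp_L1_tendsto[OF domain_regular \<gamma>_pos A_bounded A_injective ubar _ Jw])
    show w1: "w n \<in> L1 \<Omega>" for n using w[of n] by (simp add: primal_feasible_def)
    fix e :: real assume e: "e > 0"
    (* The energy bounds the norm by c / \<gamma>; the summand 1 makes L positive for the division. *)
    define L where "L = \<bar>c\<bar> / \<gamma> + 1"
    have L: "L > 0" using \<gamma>_pos by (simp add: L_def add_nonneg_pos)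
    have w_le: "L1_norm \<Omega> (w n) \<le> L" for n
    proof -
      have "L1_norm \<Omega> (w n) \<le> c / \<gamma>"
        using TV_L1_norm_le[OF Jw] \<gamma>_pos by (simp add: pos_le_divide_eq mult.commute)
      also have "\<dots> \<le> \<bar>c\<bar> / \<gamma>" using \<gamma>_pos by (intro divide_right_mono) auto
      finally show ?thesis by (simp add: L_def)
    qed
    have "0 < ereal (e / 2)" "0 < ereal (e / (2 * L))" using e L by simp_all
    from order_tendstoD(2)[OF f_bounds_conv this(1)] order_tendstoD(2)[OF A_bounds_conv this(2)]
    show "\<forall>\<^sub>F n in sequentially. AE x in ?M. \<bar>A (w n) x - f x\<bar> \<le> e"
    proof eventually_elim
      case (elim n)
      have "AE x in ?M. \<bar>A (w n) x - f x\<bar> \<le> e / 2 + e / (2 * L) * L1_norm \<Omega> (w n)"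
        using w[of n] unfolding B_def \<phi>_def
        by (rule feasible_residual_bound[OF A_bounds lin f_bounds f_bounds_Linf
              less_imp_le[OF elim(1)] less_imp_le[OF elim(2)]])
      moreover have "e / (2 * L) * L1_norm \<Omega> (w n) \<le> e / (2 * L) * L"
        using e L w_le[of n] by (intro mult_left_mono) auto
      moreover have "e / (2 * L) * L = e / 2" using L by simp
      ultimately show ?case by (elim eventually_mono) linarith
    qed
  qed
  have u_conv: "(\<lambda>n. L1_norm \<Omega> (\<lambda>x. u n x - ubar x)) \<longlonglongrightarrow> 0"
    by (rule stable[OF u_feasible, of jbar]) (simp add: J_u j_le)

  \<comment> \<open>Feasibility of \<open>ubar\<close> bounds the pairing below by the dual value, which equals \<open>j n\<close> since there
    is no duality gap.\<close>
  have p_ubar: "j n \<le> pairing \<Omega> (p n) ubar" for n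
  proof -
    have dual: "lam n \<in> Linf \<Omega>" "ae_le \<Omega> (\<lambda>x. 0) (lam n)"
      and mu: "fst (mu n) \<in> Linf_dual \<Omega>" "nonneg_functional \<Omega> (fst (mu n))"
        "snd (mu n) \<in> Linf_dual \<Omega>" "nonneg_functional \<Omega> (snd (mu n))"
      using dual_sol[of n] by (auto simp: dual_solution_def dual_feasible_def)
    note fl = Linf_uminus[OF f_bounds_Linf(1)[of n]]
    note adj = adjoint_rep_pair_op[OF \<Omega>(1,3) A_bounds_regular mu]
    have "j n \<le> - fst (mu n) (fu n) - snd (mu n) (\<lambda>x. - fl n x)"
      using u_min[of n] dual_sol[of n] unfolding B_def \<phi>_def J_def
      by (rule dual_value_ge_primal_value[OF \<Omega> domain_regular \<gamma>_pos A_bounds_regular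
            f_bounds_Linf(2) fl _ J_u])
    moreover have "fst (mu n) (Al n ubar) \<le> fst (mu n) (fu n)"
      by (rule nonneg_functional_mono[OF mu(1,2) linear_Linf[OF lin(1) ubar(1)] f_bounds_Linf(2)
            ubar_bounds(1)])
    moreover have "snd (mu n) (\<lambda>x. - Au n ubar x) \<le> snd (mu n) (\<lambda>x. - fl n x)"
      by (rule nonneg_functional_mono[OF mu(3,4) Linf_uminus[OF linear_Linf[OF lin(2) ubar(1)]] fl
            ubar_bounds(2)])
    moreover have "0 \<le> pairing \<Omega> (lam n) ubar"
    proof -
      have "AE x in ?M. 0 \<le> lam n x * ubar x"
        using dual(2) ubar_nonneg unfolding ae_le_def by eventually_elim simp
      then show ?thesis unfolding pairing_def by (rule integral_nonneg_AE)
    qed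
    moreover have "pairing \<Omega> (p n) ubar
        = pairing \<Omega> (lam n) ubar - (fst (mu n) (Al n ubar) - snd (mu n) (Au n ubar))"
      unfolding p_def B_def using pairing_diff_left[OF dual(1) adj(1) ubar(1)] adj(2)[OF ubar(1)] by simp
    moreover have "snd (mu n) (\<lambda>x. - Au n ubar x) = - snd (mu n) (Au n ubar)"
      by (rule Linf_dual_uminus[OF mu(3) linear_Linf[OF lin(2) ubar(1)]])
    ultimately show ?thesis by linarith
  qed
  have p_ubar_le: "pairing \<Omega> (p n) ubar \<le> jbar" for n
    using p_subgradient[of n] ubar(1) jbar by (auto simp: subdifferential_def J_def)

  have ubar_M: "\<forall>\<^sub>F n in sequentially. ubar \<in> M n"
  proof -
    (* Both remaining conditions of membership hold as soon as J ubar - J (u n) < \<delta>. *)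
    define \<delta> where "\<delta> = min \<epsilon> C"
    have \<delta>: "\<delta> > 0" "\<delta> \<le> \<epsilon>" "\<delta> \<le> C" using \<epsilon>_pos C_pos by (auto simp: \<delta>_def)
    have "ereal (jbar - \<delta>) < TV_L1 \<Omega> \<gamma> ubar" using \<delta> by (simp add: jbar)
    from TV_L1_eventually_gt[OF u_L1 ubar(1) u_conv this]
    show ?thesis
    proof (rule eventually_mono)
      fix n assume "ereal (jbar - \<delta>) < TV_L1 \<Omega> \<gamma> (u n)"
      then have gap: "jbar - \<delta> < j n" by (simp add: J_u)
      have "pairing \<Omega> (p n) (\<lambda>x. ubar x - u n x) \<le> C"
        using pairing_diff[OF p_Linf[of n] ubar(1) u_L1[of n]] p_ubar_le[of n] gap \<delta>
        by (simp add: j_def)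
      moreover have "J ubar - ereal (pairing \<Omega> (p n) ubar) \<le> ereal \<epsilon>"
        using p_ubar[of n] gap \<delta> by (simp add: J_def jbar)
      ultimately show "ubar \<in> M n" using ubar_feasible[of n] by (simp add: M_def near_minimisers_def)
    qed
  qed

  have u_M: "u n \<in> M n" for n
    using u_feasible[of n] \<epsilon>_pos C_pos
    by (simp add: M_def near_minimisers_def J_def J_u j_def[symmetric])
      (simp add: pairing_def)
  then have M_ne: "M n \<noteq> {}" for n by blast
  have M_eq: "M n = near_minimisers \<Omega> (TV_L1 \<Omega> \<gamma>) (pair_op (Al n) (Au n)) (\<phi> n) (u n) (p n) \<epsilon> C" for n
    by (simp add: M_def B_def J_def)
  have p_sub: "p n \<in> subdifferential \<Omega> (TV_L1 \<Omega> \<gamma>) (u n)" for n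
    using p_subgradient[of n] by (simp add: J_def)
  have M_compact: "compact ((\<lambda>w. pairing \<Omega> w (indicator (\<omega> n))) ` M n)" for n
    unfolding M_eq
    by (rule near_minimisers_mean_compact[OF domain_regular \<gamma>_pos A_bounds_regular u_L1 p_sub
          indicator_Linf[OF \<omega>_region]])
  note lower = lower_value_attained[OF M_compact M_ne]
  note upper = upper_value_attained[OF M_compact M_ne]

  have "(\<lambda>n. upper_value \<Omega> (M n) (\<omega> n) - lower_value \<Omega> (M n) (\<omega> n)) \<longlonglongrightarrow> 0"
    if \<kappa>: "\<kappa> > 0" "\<forall>\<^sub>F n in sequentially. \<kappa> \<le> measure lebesgue (\<omega> n)" for \<kappa>
  proof -
    obtain a where a: "\<And>n. a n \<in> M n" "\<And>n. lower_value \<Omega> (M n) (\<omega> n) = region_mean \<Omega> (a n) (\<omega> n)"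
      using lower(1) by metis
    obtain b where b: "\<And>n. b n \<in> M n" "\<And>n. upper_value \<Omega> (M n) (\<omega> n) = region_mean \<Omega> (b n) (\<omega> n)"
      using upper(1) by metis
    have M_feasible: "w \<in> primal_feasible \<Omega> (B n) (\<phi> n)" if "w \<in> M n" for w n
      using that by (simp add: M_def near_minimisers_def)
    have M_L1: "w \<in> L1 \<Omega>" if "w \<in> M n" for w n
      using M_feasible[OF that] by (simp add: primal_feasible_def)
    have M_le: "TV_L1 \<Omega> \<gamma> w \<le> ereal (\<epsilon> + C + jbar)" if "w \<in> M n" for w n
    proof -
      have "TV_L1 \<Omega> \<gamma> w \<le> ereal (\<epsilon> + C + j n)"
        using near_minimisers_TV_L1_le(2)[OF u_L1 p_sub that[unfolded M_eq]] by (simp add: j_def)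
      also have "\<dots> \<le> ereal (\<epsilon> + C + jbar)" using j_le[of n] by simp
      finally show ?thesis .
    qed
    have "(\<lambda>n. L1_norm \<Omega> (\<lambda>x. b n x - ubar x)) \<longlonglongrightarrow> 0" "(\<lambda>n. L1_norm \<Omega> (\<lambda>x. a n x - ubar x)) \<longlonglongrightarrow> 0"
      by (rule stable[OF M_feasible[OF b(1)] M_le[OF b(1)]] stable[OF M_feasible[OF a(1)] M_le[OF a(1)]])+
    from tendsto_divide[OF tendsto_add[OF this] tendsto_const[of \<kappa>]]
    have lim: "(\<lambda>n. (L1_norm \<Omega> (\<lambda>x. b n x - ubar x) + L1_norm \<Omega> (\<lambda>x. a n x - ubar x)) / \<kappa>) \<longlonglongrightarrow> 0"
      using \<kappa>(1) by simp
    show ?thesis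
    proof (rule Lim_null_comparison[OF _ lim])
      show "\<forall>\<^sub>F n in sequentially. norm (upper_value \<Omega> (M n) (\<omega> n) - lower_value \<Omega> (M n) (\<omega> n))
          \<le> (L1_norm \<Omega> (\<lambda>x. b n x - ubar x) + L1_norm \<Omega> (\<lambda>x. a n x - ubar x)) / \<kappa>"
        using \<kappa>(2)
      proof (rule eventually_mono)
        fix n assume "\<kappa> \<le> measure lebesgue (\<omega> n)"
        from region_mean_diff_le[OF \<omega>_region \<kappa>(1) this M_L1[OF b(1)] M_L1[OF a(1)] ubar(1)]
        show "norm (upper_value \<Omega> (M n) (\<omega> n) - lower_value \<Omega> (M n) (\<omega> n))
          \<le> (L1_norm \<Omega> (\<lambda>x. b n x - ubar x) + L1_norm \<Omega> (\<lambda>x. a n x - ubar x)) / \<kappa>"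
          by (simp add: a(2) b(2))
      qed
    qed
  qed
  moreover have "\<forall>\<^sub>F n in sequentially.
      (\<forall>c. has_value_on (\<omega> n) ubar c \<longrightarrow>
           lower_value \<Omega> (M n) (\<omega> n) \<le> c \<and> c \<le> upper_value \<Omega> (M n) (\<omega> n)) \<and>
      lower_value \<Omega> (M n) (\<omega> n) \<le> region_mean \<Omega> ubar (\<omega> n) \<and>
      region_mean \<Omega> ubar (\<omega> n) \<le> upper_value \<Omega> (M n) (\<omega> n)"
    using ubar_M
  proof (rule eventually_mono)
    fix n assume n: "ubar \<in> M n"
    have "region_mean \<Omega> ubar (\<omega> n) = c" if "has_value_on (\<omega> n) ubar c" for c
      using lmeasurable_open[OF \<Omega>(3,1)] that
      by (intro region_mean_has_value[OF _ \<omega>_region ubar(1)]) (simp_all add: fmeasurableD)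
    then show "(\<forall>c. has_value_on (\<omega> n) ubar c \<longrightarrow>
           lower_value \<Omega> (M n) (\<omega> n) \<le> c \<and> c \<le> upper_value \<Omega> (M n) (\<omega> n)) \<and>
      lower_value \<Omega> (M n) (\<omega> n) \<le> region_mean \<Omega> ubar (\<omega> n) \<and>
      region_mean \<Omega> ubar (\<omega> n) \<le> upper_value \<Omega> (M n) (\<omega> n)"
      using lower(2)[OF n] upper(2)[OF n] by metis
  qed
  ultimately show ?thesis by blast
qed

end
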